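(* Let $K$ be a field, $S=K[x_1,\ldots,x_n]$, and let $I\subset S$ be a monomial ideal of Borel type with $\operatorname{Ass}(S/I)=\{P_0,\ldots,P_m\}$, where $P_i=(x_1,\ldots,x_{n_i})$ and $n\geq n_0>n_1>\cdots>n_m\geq 1$. Let $I=\bigcap_{i=0}^m Q_i$ be the reduced primary decomposition of $I$, with $P_i=\sqrt{Q_i}$ for all $0\leq i\leq m$, and set $I_k=\bigcap_{j=k}^m Q_j$ for $0\leq k\leq m$. Then the following assertions hold: (1) $\operatorname{sdepth}(S/I_i)=\operatorname{depth}(S/I_i)=n-n_i$, for all $0\leq i\leq m$. (2) $\operatorname{sdepth}(I_0)\leq \operatorname{sdepth}(I_1)\leq\cdots\leq\operatorname{sdepth}(I_m)$. (3) $\operatorname{depth}(I_i)=n-n_i+1\leq \operatorname{sdepth}(I_i)\leq \operatorname{sdepth}(P_i)=n-\left\lfloor \frac{n_i}{2}\right\rfloor$, for all $0\leq i\leq m$.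
   Context: Borel type: a monomial ideal $I\subset S=K[x_1,\ldots,x_n]$ is of Borel type if $(I:x_j^{\infty})=(I:(x_1,\ldots,x_j)^{\infty})$ for all $1\leq j\leq n$. Stanley depth: Let $M$ be a finitely generated $\mathbb Z^n$-graded $S$-module. A Stanley decomposition of $M$ is a finite direct sum $\mathcal D: M=\bigoplus_{i=1}^r m_iK[Z_i]$ of $\mathbb Z^n$-graded $K$-vector spaces, where each $m_i\in M$ is homogeneous with respect to the $\mathbb Z^n$-grading, $Z_i\subset\{x_1,\ldots,x_n\}$, and $m_iK[Z_i]=\{um_i : u\in K[Z_i]\}\subset M$ is a free $K[Z_i]$-submodule of $M$. Set $\operatorname{sdepth}(\mathcal D)=\min_{i}|Z_i|$ and $\operatorname{sdepth}(M)=\max\{\operatorname{sdepth}(\mathcal D) : \mathcal D \text{ is a Stanley decomposition of } M\}$. For a monomial ideal $J\subset S$, $\operatorname{sdepth}(J)$ and $\operatorname{sdepth}(S/J)$ are the Stanley depths of $J$ and $S/J$ as $\mathbb Z^n$-graded $S$-modules. Depth is taken with respect to the graded maximal ideal $(x_1,\ldots,x_n)$. *)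

theory Defs
  imports "HOL-Library.Poly_Mapping" "HOL-Algebra.Algebra"
begin

section \<open>Polynomial rings in finitely many variables\<close>

text \<open>A polynomial is a finitely supported map from exponent vectors to coefficients. The variables
  are indexed by natural numbers, and \<open>S = K[x\<^sub>1, \<dots>, x\<^sub>n]\<close> consists of the polynomials involving only
  variables with index in \<open>{1..n}\<close>; the field \<open>K\<close> is the type \<open>'k\<close>.\<close>

type_synonym 'k mpoly = "(nat \<Rightarrow>\<^sub>0 nat) \<Rightarrow>\<^sub>0 'k"

definition polys_in :: "nat set \<Rightarrow> ('k::field) mpoly set" where
  "polys_in Z = {p. \<forall>b \<in> Poly_Mapping.keys p. Poly_Mapping.keys b \<subseteq> Z}"

definition mpoly_ring :: "nat \<Rightarrow> ('k::field) mpoly ring" where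
  "mpoly_ring n =
     \<lparr>carrier = polys_in {1..n}, monoid.mult = (*), one = 1, ring.zero = 0, add = (+)\<rparr>"

definition monomial :: "(nat \<Rightarrow>\<^sub>0 nat) \<Rightarrow> ('k::field) mpoly" where
  "monomial b = Poly_Mapping.single b 1"

definition var :: "nat \<Rightarrow> ('k::field) mpoly" where
  "var j = monomial (Poly_Mapping.single j 1)"

definition var_ideal :: "nat \<Rightarrow> nat \<Rightarrow> ('k::field) mpoly set" where
  "var_ideal n j = genideal (mpoly_ring n) (var ` {1..j})"

definition monomial_ideal :: "nat \<Rightarrow> ('k::field) mpoly set \<Rightarrow> bool" where
  "monomial_ideal n I \<longleftrightarrow>
     (\<exists>B. (\<forall>b\<in>B. Poly_Mapping.keys b \<subseteq> {1..n}) \<and> I = genideal (mpoly_ring n) (monomial ` B))"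


section \<open>Ideals of Borel type\<close>

definition colon_ideal :: "('a, 'c) ring_scheme \<Rightarrow> 'a set \<Rightarrow> 'a set \<Rightarrow> 'a set" where
  "colon_ideal R I A = {f \<in> carrier R. \<forall>g\<in>A. f \<otimes>\<^bsub>R\<^esub> g \<in> I}"

primrec ideal_power :: "('a, 'c) ring_scheme \<Rightarrow> 'a set \<Rightarrow> nat \<Rightarrow> 'a set" where
  "ideal_power R J 0 = carrier R"
| "ideal_power R J (Suc k) = ideal_prod R J (ideal_power R J k)"

definition saturation :: "('a, 'c) ring_scheme \<Rightarrow> 'a set \<Rightarrow> 'a set \<Rightarrow> 'a set" where
  "saturation R I J = (\<Union>k. colon_ideal R I (ideal_power R J k))"

definition saturation_elem :: "('a, 'c) ring_scheme \<Rightarrow> 'a set \<Rightarrow> 'a \<Rightarrow> 'a set" where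
  "saturation_elem R I x = (\<Union>k::nat. colon_ideal R I {x [^]\<^bsub>R\<^esub> k})"

definition borel_type :: "nat \<Rightarrow> ('k::field) mpoly set \<Rightarrow> bool" where
  "borel_type n I \<longleftrightarrow>
     (\<forall>j\<in>{1..n}. saturation_elem (mpoly_ring n) I (var j) =
                 saturation (mpoly_ring n) I (var_ideal n j))"


section \<open>Primary decompositions\<close>

definition radical_ideal :: "('a, 'c) ring_scheme \<Rightarrow> 'a set \<Rightarrow> 'a set" where
  "radical_ideal R I = {f \<in> carrier R. \<exists>k::nat. f [^]\<^bsub>R\<^esub> k \<in> I}"

definition primary_ideal :: "('a, 'c) ring_scheme \<Rightarrow> 'a set \<Rightarrow> bool" where
  "primary_ideal R Q \<longleftrightarrow> ideal Q R \<and> Q \<noteq> carrier R \<and>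
     (\<forall>a\<in>carrier R. \<forall>b\<in>carrier R. a \<otimes>\<^bsub>R\<^esub> b \<in> Q \<longrightarrow> a \<in> Q \<or> b \<in> radical_ideal R Q)"

text \<open>Reduced: the radicals are pairwise distinct and no component can be omitted. Intersecting with
  the carrier makes the empty intersection the unit ideal.\<close>

definition reduced_primary_decomposition ::
    "('a, 'c) ring_scheme \<Rightarrow> 'a set \<Rightarrow> 'i set \<Rightarrow> ('i \<Rightarrow> 'a set) \<Rightarrow> bool" where
  "reduced_primary_decomposition R I A Q \<longleftrightarrow> finite A \<and>
     (\<forall>i\<in>A. primary_ideal R (Q i)) \<and>
     I = carrier R \<inter> (\<Inter>i\<in>A. Q i) \<and>
     inj_on (\<lambda>i. radical_ideal R (Q i)) A \<and>
     (\<forall>i\<in>A. I \<noteq> carrier R \<inter> (\<Inter>j\<in>A - {i}. Q j))"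


section \<open>Ideals and quotient rings as modules\<close>

definition ideal_module :: "('a, 'c) ring_scheme \<Rightarrow> 'a set \<Rightarrow> ('a, 'a) module" where
  "ideal_module R J =
     \<lparr>carrier = J, monoid.mult = (\<otimes>\<^bsub>R\<^esub>), one = \<one>\<^bsub>R\<^esub>, ring.zero = \<zero>\<^bsub>R\<^esub>, add = (\<oplus>\<^bsub>R\<^esub>),
      smult = (\<otimes>\<^bsub>R\<^esub>)\<rparr>"

definition quotient_module :: "('a, 'c) ring_scheme \<Rightarrow> 'a set \<Rightarrow> ('a, 'a set) module" where
  "quotient_module R J =
     \<lparr>carrier = carrier (R Quot J), monoid.mult = (\<otimes>\<^bsub>R Quot J\<^esub>), one = \<one>\<^bsub>R Quot J\<^esub>,
      ring.zero = \<zero>\<^bsub>R Quot J\<^esub>, add = (\<oplus>\<^bsub>R Quot J\<^esub>),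
      smult = (\<lambda>r C. (J +>\<^bsub>R\<^esub> r) \<otimes>\<^bsub>R Quot J\<^esub> C)\<rparr>"

definition associated_primes ::
    "('a, 'c) ring_scheme \<Rightarrow> ('a, 'm, 'd) module_scheme \<Rightarrow> 'a set set" where
  "associated_primes R M = {P. primeideal P R \<and>
     (\<exists>v\<in>carrier M. P = {r \<in> carrier R. r \<odot>\<^bsub>M\<^esub> v = \<zero>\<^bsub>M\<^esub>})}"


section \<open>Depth\<close>

definition seq_submodule :: "('a, 'm, 'd) module_scheme \<Rightarrow> 'a list \<Rightarrow> 'm set" where
  "seq_submodule M xs =
     {(\<Oplus>\<^bsub>M\<^esub>i\<in>{..<length xs}. (xs ! i) \<odot>\<^bsub>M\<^esub> w i) | w. w \<in> {..<length xs} \<rightarrow> carrier M}"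

text \<open>\<open>x\<^sub>1, \<dots>, x\<^sub>r\<close> is \<open>M\<close>-regular if each \<open>x\<^sub>i\<close> is a nonzerodivisor on \<open>M / (x\<^sub>1, \<dots>, x\<^sub>i\<^sub>-\<^sub>1)M\<close> and
  \<open>(x\<^sub>1, \<dots>, x\<^sub>r)M \<noteq> M\<close>. The quotients are unfolded into membership in the submodule.\<close>

definition regular_sequence ::
    "('a, 'c) ring_scheme \<Rightarrow> ('a, 'm, 'd) module_scheme \<Rightarrow> 'a list \<Rightarrow> bool" where
  "regular_sequence R M xs \<longleftrightarrow> set xs \<subseteq> carrier R \<and>
     (\<forall>i<length xs. \<forall>v\<in>carrier M.
        (xs ! i) \<odot>\<^bsub>M\<^esub> v \<in> seq_submodule M (take i xs) \<longrightarrow> v \<in> seq_submodule M (take i xs)) \<and>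
     seq_submodule M xs \<noteq> carrier M"

definition depth :: "nat \<Rightarrow> (('k::field) mpoly, 'm, 'd) module_scheme \<Rightarrow> nat" where
  "depth n M =
     Max {length xs | xs. set xs \<subseteq> var_ideal n n \<and> regular_sequence (mpoly_ring n) M xs}"


section \<open>Stanley depth\<close>

text \<open>A \<open>\<int>\<^sup>n\<close>-grading of a module is given by the map sending a degree to the corresponding graded
  component. Degrees are integer vectors vanishing outside the index set \<open>{1..n}\<close>.\<close>

definition degrees :: "nat \<Rightarrow> (nat \<Rightarrow> int) set" where
  "degrees n = {a. \<forall>j. j \<notin> {1..n} \<longrightarrow> a j = 0}"

definition stanley_space ::
    "(('k::field) mpoly, 'm, 'd) module_scheme \<Rightarrow> 'm \<times> nat set \<Rightarrow> 'm set" where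
  "stanley_space M = (\<lambda>(v, Z). {u \<odot>\<^bsub>M\<^esub> v | u. u \<in> polys_in Z})"

text \<open>A decomposition is the list of the pairs \<open>(m\<^sub>i, Z\<^sub>i)\<close>. The spaces \<open>m\<^sub>i K[Z\<^sub>i]\<close> are graded because
  the \<open>m\<^sub>i\<close> are homogeneous, so the sum is direct as a sum of graded vector spaces as soon as each
  element of \<open>M\<close> has a unique representation.\<close>

definition stanley_decomposition ::
    "nat \<Rightarrow> (('k::field) mpoly, 'm, 'd) module_scheme \<Rightarrow> ((nat \<Rightarrow> int) \<Rightarrow> 'm set)
      \<Rightarrow> ('m \<times> nat set) list \<Rightarrow> bool" where
  "stanley_decomposition n M gr D \<longleftrightarrow>
     (\<forall>(v, Z) \<in> set D.
        v \<in> carrier M \<and> (\<exists>a\<in>degrees n. v \<in> gr a) \<and> Z \<subseteq> {1..n} \<and>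
        (\<forall>u\<in>polys_in Z. u \<odot>\<^bsub>M\<^esub> v = \<zero>\<^bsub>M\<^esub> \<longrightarrow> u = 0)) \<and>
     (\<forall>v\<in>carrier M. \<exists>!w. w \<in> (\<Pi>\<^sub>E i\<in>{..<length D}. stanley_space M (D ! i)) \<and>
        v = (\<Oplus>\<^bsub>M\<^esub>i\<in>{..<length D}. w i))"

definition sdepth_decomposition :: "('m \<times> nat set) list \<Rightarrow> nat" where
  "sdepth_decomposition D = Min ((\<lambda>(v, Z). card Z) ` set D)"

definition sdepth ::
    "nat \<Rightarrow> (('k::field) mpoly, 'm, 'd) module_scheme \<Rightarrow> ((nat \<Rightarrow> int) \<Rightarrow> 'm set) \<Rightarrow> nat" where
  "sdepth n M gr = Max {sdepth_decomposition D | D. stanley_decomposition n M gr D}"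

definition poly_component :: "nat \<Rightarrow> (nat \<Rightarrow> int) \<Rightarrow> ('k::field) mpoly set" where
  "poly_component n a =
     {p \<in> carrier (mpoly_ring n). \<forall>b\<in>Poly_Mapping.keys p. \<forall>j. int (Poly_Mapping.lookup b j) = a j}"

definition sdepth_ideal :: "nat \<Rightarrow> ('k::field) mpoly set \<Rightarrow> nat" where
  "sdepth_ideal n J =
     sdepth n (ideal_module (mpoly_ring n) J) (\<lambda>a. J \<inter> poly_component n a)"

definition sdepth_quotient :: "nat \<Rightarrow> ('k::field) mpoly set \<Rightarrow> nat" where
  "sdepth_quotient n J =
     sdepth n (quotient_module (mpoly_ring n) J)
       (\<lambda>a. (\<lambda>p. J +>\<^bsub>mpoly_ring n\<^esub> p) ` poly_component n a)"

end

theory Submission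
  imports Defs
begin

text \<open>
  Write \<open>I\<^sub>k\<close> for the intersection of the components \<open>Q\<^sub>j\<close> with \<open>j \<ge> k\<close> and \<open>d\<close> for \<open>d k\<close>, so that the radical
  of \<open>Q\<^sub>k\<close> is \<open>P\<^sub>k = (x\<^sub>1, \<dots>, x\<^sub>d)\<close>. Some power \<open>x\<^sub>d\<^sup>N\<close> lies in \<open>Q\<^sub>k\<close>, while \<open>x\<^sub>d\<close> lies outside every \<open>P\<^sub>j\<close> with
  \<open>j > k\<close>; therefore \<open>I\<^sub>k\<^sub>+\<^sub>1 = (I\<^sub>k : x\<^sub>d\<^sup>N)\<close> (\<open>I_from_colon\<close>). Starting from \<open>I\<^sub>0 = I\<close>, this shows that every \<open>I\<^sub>k\<close>
  is a monomial ideal, although the components need not be. Let \<open>E\<close> be its set of exponent vectors. The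
  variables beyond \<open>x\<^sub>d\<close> can be cancelled in \<open>E\<close>, because they avoid \<open>P\<^sub>k, \<dots>, P\<^sub>m\<close> (\<open>cylinder_E_from\<close>), and since
  \<open>Q\<^sub>k\<close> cannot be omitted there is a monomial \<open>x\<^sup>u\<close> outside \<open>I\<^sub>k\<close> with \<open>x\<^sub>j x\<^sup>u\<close> in \<open>I\<^sub>k\<close> for all \<open>j \<le> d\<close>
  (\<open>ex_socle_exponent\<close>). In particular \<open>(I\<^sub>k : x\<^sup>u) = P\<^sub>k\<close>.

  A Stanley decomposition of a quotient of monomial ideals amounts to a finite partition
  of the exponents that belong to the numerator only into boxes \<open>a + \<nat>\<^sup>Z\<close> (\<open>le_sdepth_iff\<close>), so Stanley depth
  is a question about such partitions. Finitely many exponents determine \<open>E\<close>, and grouping exponents by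
  their truncation partitions the complement of \<open>E\<close> into boxes that are free in the directions
  \<open>d + 1, \<dots>, n\<close>; the box that contains \<open>u\<close> is free in no other direction, whence sdepth \<open>S / I\<^sub>k = n - d\<close>. For
  \<open>E\<close> itself the direction of \<open>x\<^sub>1\<close> can be made free as well, as \<open>E\<close> meets every line in that direction in a
  ray. Shifting boxes shows that Stanley depth does not decrease under colon by a monomial
  (\<open>partitionable_colon\<close>). Applied to \<open>I\<^sub>k\<^sub>+\<^sub>1 = (I\<^sub>k : x\<^sub>d\<^sup>N)\<close> and to \<open>P\<^sub>k = (I\<^sub>k : x\<^sup>u)\<close>, this yields
  sdepth \<open>I\<^sub>k\<close> \<open>\<le>\<close> sdepth \<open>I\<^sub>k\<^sub>+\<^sub>1\<close> and the bound of sdepth \<open>I\<^sub>k\<close> by sdepth \<open>P\<^sub>k\<close>.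

  The Stanley depth of \<open>P\<^sub>k\<close> is found by combinatorics of subsets. For odd \<open>d\<close> the nonempty subsets of a
  \<open>d\<close>-cycle are partitioned into intervals \<open>[A, B]\<close> with \<open>2 |B| \<ge> d\<close>, one for each matching of the cycle:
  \<open>A\<close> consists of the unmatched points, and \<open>B\<close> adds the first point of every edge
  (\<open>unique_cyclic_matching\<close>). No partition does better, because the boxes based at the \<open>d\<close> unit vectors
  compete for the \<open>d (d + 1) / 2\<close> exponents of degree two (\<open>partitionable_prime_le\<close>).

  Depth is bounded above with the Koszul complex on \<open>x\<^sub>1, \<dots>, x\<^sub>n\<close>. Multiplication by \<open>f \<in> (x\<^sub>1, \<dots>, x\<^sub>n)\<close> is
  null-homotopic on it. So if \<open>z\<close> is a cycle of degree \<open>i\<close> with coefficients in \<open>M\<close>, then \<open>f z\<close> is the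
  differential of a chain \<open>w\<close>; if moreover \<open>f\<close> is regular on \<open>M\<close> and \<open>z\<close> is not a boundary, then \<open>w\<close> is a
  cycle of degree \<open>i + 1\<close> over \<open>M / f M\<close> that is not a boundary. Hence a regular sequence has at most
  \<open>n - i\<close> members (\<open>regular_sequence_length_le\<close>). The form \<open>x\<^sup>u e\<^sub>1 \<and> \<dots> \<and> e\<^sub>d\<close> is such a cycle over \<open>S / I\<^sub>k\<close>
  in degree \<open>d\<close>, and its differential is one over \<open>I\<^sub>k\<close> in degree \<open>d - 1\<close>. The bounds are attained by
  \<open>x\<^sub>d\<^sub>+\<^sub>1, \<dots>, x\<^sub>n\<close> on \<open>S / I\<^sub>k\<close> and by \<open>x\<^sub>d\<^sub>+\<^sub>1, \<dots>, x\<^sub>n, x\<^sub>1\<close> on \<open>I\<^sub>k\<close>.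
\<close>

abbreviation "lookup \<equiv> Poly_Mapping.lookup"
abbreviation "keys \<equiv> Poly_Mapping.keys"
abbreviation "single \<equiv> Poly_Mapping.single"

section \<open>Exponent sets and partitions into boxes\<close>

definition expos :: "nat \<Rightarrow> (nat \<Rightarrow>\<^sub>0 nat) set" where
  "expos n = {b. keys b \<subseteq> {1..n}}"

definition upclosed :: "nat \<Rightarrow> (nat \<Rightarrow>\<^sub>0 nat) set \<Rightarrow> bool" where
  "upclosed n E \<longleftrightarrow> E \<subseteq> expos n \<and> (\<forall>b\<in>E. \<forall>e\<in>expos n. b + e \<in> E)"

text \<open>Up-closed sets with this property are the exponent sets of ideals extended from
  \<open>K[x\<^sub>1, \<dots>, x\<^sub>d]\<close>: the variables \<open>x\<^sub>d\<^sub>+\<^sub>1, \<dots>, x\<^sub>n\<close> are nonzerodivisors modulo such an ideal.\<close>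

definition cylinder :: "nat \<Rightarrow> nat \<Rightarrow> (nat \<Rightarrow>\<^sub>0 nat) set \<Rightarrow> bool" where
  "cylinder n d E \<longleftrightarrow> (\<forall>b e. keys e \<subseteq> {d+1..n} \<longrightarrow> b + e \<in> E \<longrightarrow> b \<in> E)"

text \<open>The exponents of the monomials in the Stanley space \<open>x\<^sup>a K[Z]\<close>.\<close>

definition box :: "(nat \<Rightarrow>\<^sub>0 nat) \<Rightarrow> nat set \<Rightarrow> (nat \<Rightarrow>\<^sub>0 nat) set" where
  "box a Z = {a + e | e. keys e \<subseteq> Z}"

definition box_partition ::
    "nat \<Rightarrow> (nat \<Rightarrow>\<^sub>0 nat) set \<Rightarrow> ((nat \<Rightarrow>\<^sub>0 nat) \<times> nat set) set \<Rightarrow> bool" where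
  "box_partition n Y \<D> \<longleftrightarrow> finite \<D> \<and> (\<forall>(a, Z)\<in>\<D>. Z \<subseteq> {1..n}) \<and>
     (\<Union>(a, Z)\<in>\<D>. box a Z) = Y \<and>
     (\<forall>p\<in>\<D>. \<forall>q\<in>\<D>. p \<noteq> q \<longrightarrow> case_prod box p \<inter> case_prod box q = {})"

definition partitionable :: "nat \<Rightarrow> (nat \<Rightarrow>\<^sub>0 nat) set \<Rightarrow> nat \<Rightarrow> bool" where
  "partitionable n Y s \<longleftrightarrow> (\<exists>\<D>. box_partition n Y \<D> \<and> (\<forall>(a, Z)\<in>\<D>. s \<le> card Z))"

lemma box_partitionD:
  assumes "box_partition n Y \<D>"
  shows "finite \<D>"
    and "(\<Union>p\<in>\<D>. case_prod box p) = Y"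
    and "(a, Z) \<in> \<D> \<Longrightarrow> Z \<subseteq> {1..n}"
    and "(a, Z) \<in> \<D> \<Longrightarrow> box a Z \<subseteq> Y"
    and "p \<in> \<D> \<Longrightarrow> q \<in> \<D> \<Longrightarrow> p \<noteq> q \<Longrightarrow> case_prod box p \<inter> case_prod box q = {}"
    and "b \<in> Y \<Longrightarrow> \<exists>a Z. (a, Z) \<in> \<D> \<and> b \<in> box a Z"
  using assms unfolding box_partition_def by (simp, simp, fast, fast, fast, fast)

lemma pointwise_le_add_diff:
  fixes a b :: "nat \<Rightarrow>\<^sub>0 nat"
  assumes "\<And>j. lookup a j \<le> lookup b j"
  shows "a + (b - a) = b"
  by (rule poly_mapping_eqI) (simp add: lookup_add lookup_minus assms)

lemma keys_add_nat: "keys (a + e) = keys a \<union> keys e" for a e :: "nat \<Rightarrow>\<^sub>0 nat"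
  by (auto simp: in_keys_iff lookup_add)

lemma keys_diff_nat: "keys (a - e) \<subseteq> keys a" for a e :: "nat \<Rightarrow>\<^sub>0 nat"
  by (auto simp: in_keys_iff lookup_minus)

lemma expos_add_iff: "a + e \<in> expos n \<longleftrightarrow> a \<in> expos n \<and> e \<in> expos n"
  by (auto simp: expos_def keys_add_nat)

lemma lookup_outside: "b \<in> expos n \<Longrightarrow> j \<notin> {1..n} \<Longrightarrow> lookup b j = 0"
  unfolding expos_def in_keys_iff subset_iff by blast

lemma upclosed_expos: "upclosed n E \<Longrightarrow> b \<in> E \<Longrightarrow> b \<in> expos n"
  by (auto simp: upclosed_def)

lemma upclosedD_le:
  assumes "upclosed n E" "a \<in> E" "b \<in> expos n" "\<And>j. lookup a j \<le> lookup b j"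
  shows "b \<in> E"
proof -
  have "b - a \<in> expos n"
    using assms(3) keys_diff_nat[of b a] by (auto simp: expos_def)
  then have "a + (b - a) \<in> E"
    using assms by (auto simp: upclosed_def)
  then show ?thesis using pointwise_le_add_diff[of a b] assms(4) by simp
qed

lemma mem_box_iff:
  "b \<in> box a Z \<longleftrightarrow> (\<forall>j. lookup a j \<le> lookup b j) \<and> (\<forall>j. j \<notin> Z \<longrightarrow> lookup a j = lookup b j)"
proof
  assume "b \<in> box a Z"
  then obtain e where "b = a + e" "keys e \<subseteq> Z" by (auto simp: box_def)
  then show "(\<forall>j. lookup a j \<le> lookup b j) \<and> (\<forall>j. j \<notin> Z \<longrightarrow> lookup a j = lookup b j)"
    by (auto simp: lookup_add in_keys_iff)
next
  assume *: "(\<forall>j. lookup a j \<le> lookup b j) \<and> (\<forall>j. j \<notin> Z \<longrightarrow> lookup a j = lookup b j)"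
  then have "b = a + (b - a)" using pointwise_le_add_diff[of a b] by simp
  moreover have "keys (b - a) \<subseteq> Z" using * by (auto simp: in_keys_iff lookup_minus)
  ultimately show "b \<in> box a Z" unfolding box_def by blast
qed

lemma base_in_box: "a \<in> box a Z"
  by (simp add: mem_box_iff)

lemma partitionableI:
  assumes "finite C"
    and "\<And>c. c \<in> C \<Longrightarrow> Z c \<subseteq> {1..n} \<and> s \<le> card (Z c) \<and> box (a c) (Z c) \<subseteq> Y"
    and "\<And>b. b \<in> Y \<Longrightarrow> \<exists>c\<in>C. b \<in> box (a c) (Z c)"
    and "\<And>b c c'. c \<in> C \<Longrightarrow> c' \<in> C \<Longrightarrow> b \<in> box (a c) (Z c) \<Longrightarrow> b \<in> box (a c') (Z c') \<Longrightarrow> c = c'"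
  shows "partitionable n Y s"
proof -
  let ?B = "(\<lambda>c. (a c, Z c)) ` C"
  have "(\<Union>(a, Z)\<in>?B. box a Z) = Y"
    using assms(2,3) by auto
  moreover have "case_prod box p \<inter> case_prod box q = {}" if "p \<in> ?B" "q \<in> ?B" "p \<noteq> q" for p q
    using that assms(4) by auto
  ultimately have "box_partition n Y ?B"
    unfolding box_partition_def using assms(1,2) by auto
  then show ?thesis unfolding partitionable_def using assms(2) by fastforce
qed

subsection \<open>Finitely many exponents determine an exponent set\<close>

text \<open>The coordinates are treated one after the other. A monotone subsequence of natural numbers
  either increases already, or it decreases and is constant from some point on.\<close>

lemma monotone_subsequence_coordinates:
  fixes f :: "nat \<Rightarrow> 'a \<Rightarrow> nat"
  assumes "finite V"
  shows "\<exists>r :: nat \<Rightarrow> nat. strict_mono r \<and> (\<forall>j\<in>V. mono (\<lambda>i. f (r i) j))"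
  using assms
proof (induction V)
  case empty
  show ?case by (intro exI[of _ id]) (simp add: strict_mono_def)
next
  case (insert j V)
  then obtain r :: "nat \<Rightarrow> nat" where r: "strict_mono r" "\<forall>j\<in>V. mono (\<lambda>i. f (r i) j)" by blast
  obtain q :: "nat \<Rightarrow> nat" where q: "strict_mono q" "monoseq (\<lambda>i. f (r (q i)) j)"
    using seq_monosub[of "\<lambda>i. f (r i) j"] by auto
  let ?h = "\<lambda>i. f (r (q i)) j"
  have "\<exists>N. mono (\<lambda>i. ?h (N + i))"
  proof (cases "incseq ?h")
    case True
    then show ?thesis by (intro exI[of _ 0]) simp
  next
    case False
    then have dec: "decseq ?h" using q(2) by (simp add: monoseq_iff)
    define v where "v = (LEAST v. \<exists>i. ?h i = v)"
    have "\<exists>i. ?h i = v" unfolding v_def by (rule LeastI_ex) blast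
    then obtain N where N: "?h N = v" by blast
    have "?h (N + i) = v" for i
    proof (rule antisym)
      show "?h (N + i) \<le> v" using decseqD[OF dec, of N "N + i"] N by simp
      show "v \<le> ?h (N + i)" unfolding v_def by (rule Least_le) blast
    qed
    then show ?thesis by (intro exI[of _ N]) (simp add: mono_def)
  qed
  then obtain N where N: "mono (\<lambda>i. ?h (N + i))" by blast
  let ?r = "\<lambda>i. r (q (N + i))"
  have "strict_mono ?r" using r(1) q(1) by (simp add: strict_mono_def)
  moreover have "mono (\<lambda>i. f (?r i) k)" if "k \<in> V" for k
    using r(2) that q(1) by (auto simp: mono_def strict_mono_less_eq)
  ultimately show ?case using N by (intro exI[of _ ?r]) auto
qed

definition truncate :: "(nat \<Rightarrow> nat) \<Rightarrow> (nat \<Rightarrow>\<^sub>0 nat) \<Rightarrow> (nat \<Rightarrow>\<^sub>0 nat)" where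
  "truncate g b = Poly_Mapping.mapp (\<lambda>j t. min t (g j)) b"

lemma lookup_truncate: "lookup (truncate g b) j = min (lookup b j) (g j)"
  by (simp add: truncate_def lookup_mapp when_def in_keys_iff)

lemma truncate_in_expos: "b \<in> expos n \<Longrightarrow> truncate g b \<in> expos n"
  by (auto simp: expos_def in_keys_iff lookup_truncate subset_iff)

text \<open>A form of Dickson's lemma. By \<open>monotone_subsequence_coordinates\<close> an infinite sequence of distinct minimal exponents
  would contain two comparable ones. So there are finitely many of them, and \<open>g\<close> may be any common
  upper bound.\<close>

lemma ex_truncation:
  assumes E: "upclosed n E"
  shows "\<exists>g. \<forall>b\<in>E. truncate g b \<in> E"
proof -
  define le where "le a b \<longleftrightarrow> (\<forall>j. lookup a j \<le> lookup b j)" for a b :: "nat \<Rightarrow>\<^sub>0 nat"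
  define M where "M = {b\<in>E. \<forall>c\<in>E. le c b \<longrightarrow> c = b}"
  have le_eqI: "a = b" if "le a b" "le b a" for a b
    using that by (intro poly_mapping_eqI) (auto simp: le_def intro: antisym)
  have fin: "finite M"
  proof (rule ccontr)
    assume "infinite M"
    then obtain f :: "nat \<Rightarrow> _" where f: "inj f" "range f \<subseteq> M"
      using infinite_countable_subset by blast
    obtain r :: "nat \<Rightarrow> nat" where r: "strict_mono r"
        "\<forall>j\<in>{1..n}. mono (\<lambda>i. lookup (f (r i)) j)"
      using monotone_subsequence_coordinates[of "{1..n}" "\<lambda>i. lookup (f i)"] by auto
    have inE: "f i \<in> E" "f i \<in> M" for i using f(2) by (auto simp: M_def)
    have "le (f (r 0)) (f (r 1))"
      unfolding le_def
    proof
      fix j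
      show "lookup (f (r 0)) j \<le> lookup (f (r 1)) j"
      proof (cases "j \<in> {1..n}")
        case True
        then show ?thesis using r(2) by (auto simp: mono_def)
      next
        case False
        then have "lookup (f (r 0)) j = 0"
          using inE(1)[of "r 0"] by (intro lookup_outside[OF upclosed_expos[OF E]])
        then show ?thesis by simp
      qed
    qed
    then have "f (r 0) = f (r 1)" using inE by (auto simp: M_def)
    then have "r 0 = r 1" using f(1) by (simp add: inj_eq)
    then show False using r(1) by (metis strict_mono_eq zero_neq_one)
  qed
  have below: "\<exists>c\<in>M. le c b" if "b \<in> E" for b
  proof -
    let ?s = "\<lambda>c. \<Sum>j\<in>{1..n}. lookup c j"
    have "b \<in> E \<and> le b b" using that by (simp add: le_def)
    then obtain c where c: "c \<in> E" "le c b" "\<And>c'. c' \<in> E \<Longrightarrow> le c' b \<Longrightarrow> ?s c \<le> ?s c'"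
      using ex_has_least_nat[of "\<lambda>c. c \<in> E \<and> le c b" b ?s] by blast
    have "c' = c" if c': "c' \<in> E" "le c' c" for c'
    proof (rule ccontr)
      assume "c' \<noteq> c"
      then obtain j where j: "lookup c' j < lookup c j"
        using le_eqI c'(2) by (meson le_def not_le_imp_less)
      then have "j \<in> {1..n}"
        using lookup_outside[OF upclosed_expos[OF E c(1)], of j] by (cases "j \<in> {1..n}") auto
      then have "?s c' < ?s c" using j c'(2) by (intro sum_strict_mono_ex1) (auto simp: le_def)
      moreover have "le c' b" using c'(2) c(2) by (meson le_def order_trans)
      ultimately show False using c(3)[OF c'(1)] by simp
    qed
    then show ?thesis using c by (auto simp: M_def)
  qed
  define g where "g j = (\<Sum>c\<in>M. lookup c j)" for j
  have "truncate g b \<in> E" if b: "b \<in> E" for b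
  proof -
    obtain c where c: "c \<in> M" "le c b" using below b by blast
    have "lookup c j \<le> lookup (truncate g b) j" for j
      using c fin by (auto simp: le_def lookup_truncate g_def intro: member_le_sum)
    moreover have "truncate g b \<in> expos n"
      using b E by (auto simp: upclosed_def intro!: truncate_in_expos)
    ultimately show ?thesis using upclosedD_le[OF E, of c] c(1) by (auto simp: M_def)
  qed
  then show ?thesis by blast
qed

text \<open>The coordinates beyond \<open>d\<close> may be truncated to \<open>0\<close>, since they do not affect membership.\<close>

lemma ex_truncation_cylinder:
  assumes E: "upclosed n E" and "cylinder n d E"
  shows "\<exists>g. (\<forall>b\<in>expos n. truncate g b \<in> E \<longleftrightarrow> b \<in> E) \<and> (\<forall>j. d < j \<longrightarrow> g j = 0)"
proof -
  obtain g0 where g0: "\<forall>b\<in>E. truncate g0 b \<in> E" using ex_truncation[OF E] by blast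
  define g where "g j = (if j \<le> d then g0 j else 0)" for j
  have "truncate g b \<in> E \<longleftrightarrow> b \<in> E" if b: "b \<in> expos n" for b
  proof
    assume "truncate g b \<in> E"
    then show "b \<in> E" using upclosedD_le[OF E _ b] by (simp add: lookup_truncate)
  next
    assume "b \<in> E"
    then have 0: "truncate g0 b \<in> E" using g0 by blast
    let ?e = "truncate g0 b - truncate g b"
    have "truncate g b + ?e = truncate g0 b"
      by (rule pointwise_le_add_diff) (simp add: lookup_truncate g_def)
    moreover have "keys ?e \<subseteq> {d+1..n}"
      using b by (auto simp: in_keys_iff lookup_minus lookup_truncate g_def expos_def subset_iff
          split: if_splits)
    ultimately show "truncate g b \<in> E" using assms(2) 0 unfolding cylinder_def by metis
  qed
  then show ?thesis by (intro exI[of _ g]) (simp add: g_def)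
qed

lemma finite_expos_below: "finite {c\<in>expos n. \<forall>j. lookup c j \<le> g j}" (is "finite ?C")
proof -
  let ?m = "\<Sum>j\<in>{1..n}. g j"
  let ?F = "{f. \<forall>j. (j \<in> {1..n} \<longrightarrow> f j \<in> {..?m}) \<and> (j \<notin> {1..n} \<longrightarrow> f j = 0)}"
  have "lookup c \<in> ?F" if c: "c \<in> ?C" for c
  proof -
    have "lookup c j \<le> ?m" if "j \<in> {1..n}" for j
    proof -
      have "g j \<le> ?m" using that by (intro member_le_sum) auto
      moreover have "lookup c j \<le> g j" using c by blast
      ultimately show ?thesis by linarith
    qed
    moreover have "lookup c j = 0" if "j \<notin> {1..n}" for j
      using lookup_outside[of c n j] c that by simp
    ultimately show ?thesis by blast
  qed
  then have "lookup ` ?C \<subseteq> ?F" by (rule image_subsetI)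
  moreover have "finite ?F" by (rule finite_set_of_finite_funs) auto
  ultimately have "finite (lookup ` ?C)" using finite_subset by blast
  then show ?thesis by (rule finite_imageD) (simp add: inj_on_def)
qed

text \<open>The fibres of the truncation map are boxes: the coordinates that reach the bound are free, and
  the other ones are determined.\<close>

lemma mem_box_truncation_iff:
  assumes "\<And>j. lookup c j \<le> g j" and b: "b \<in> expos n"
  shows "b \<in> box c {j\<in>{1..n}. lookup c j = g j} \<longleftrightarrow> truncate g b = c"
proof
  assume box: "b \<in> box c {j\<in>{1..n}. lookup c j = g j}"
  show "truncate g b = c"
  proof (rule poly_mapping_eqI)
    fix j
    show "lookup (truncate g b) j = lookup c j"
    proof (cases "j \<in> {j\<in>{1..n}. lookup c j = g j}")
      case True
      moreover have "lookup c j \<le> lookup b j" using box unfolding mem_box_iff by blast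
      ultimately show ?thesis by (simp add: lookup_truncate)
    next
      case False
      then have "lookup c j = lookup b j" using box unfolding mem_box_iff by blast
      then show ?thesis using assms(1)[of j] by (simp add: lookup_truncate)
    qed
  qed
next
  assume c: "truncate g b = c"
  have "lookup c j = lookup b j" if "j \<notin> {j\<in>{1..n}. lookup c j = g j}" for j
  proof (cases "j \<in> {1..n}")
    case True
    then show ?thesis using that c[symmetric] by (auto simp: lookup_truncate min_def split: if_splits)
  next
    case False
    then have "lookup b j = 0" using lookup_outside[OF b] by simp
    then show ?thesis using c[symmetric] by (simp add: lookup_truncate)
  qed
  then show "b \<in> box c {j\<in>{1..n}. lookup c j = g j}"
    using c[symmetric] by (auto simp: mem_box_iff lookup_truncate)
qed

section \<open>Box partitions of monomial ideals and of their complements\<close>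

lemma expos_single: "single j t \<in> expos n \<longleftrightarrow> j \<in> {1..n} \<or> t = 0"
  by (auto simp: expos_def)

lemma lookup_single_if: "lookup (single j t) k = (if j = k then t else 0)"
  by (simp add: lookup_single when_def)

lemma box_subset_expos: "a \<in> expos n \<Longrightarrow> Z \<subseteq> {1..n} \<Longrightarrow> box a Z \<subseteq> expos n"
  unfolding box_def expos_def by (clarsimp simp only: keys_add_nat mem_Collect_eq Un_iff) blast

lemma partitionable_complement:
  assumes E: "upclosed n E" and cyl: "cylinder n d E"
  shows "partitionable n (expos n - E) (n - d)"
proof -
  obtain g where g: "\<And>b. b \<in> expos n \<Longrightarrow> truncate g b \<in> E \<longleftrightarrow> b \<in> E" "\<And>j. d < j \<Longrightarrow> g j = 0"
    using ex_truncation_cylinder[OF E cyl] by blast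
  let ?C = "{c\<in>expos n. \<forall>j. lookup c j \<le> g j}"
  let ?Z = "\<lambda>c. {j\<in>{1..n}. lookup c j = g j}"
  have box: "b \<in> box c (?Z c) \<longleftrightarrow> truncate g b = c" if "c \<in> ?C" "b \<in> expos n" for b c
    using mem_box_truncation_iff that by blast
  have sub: "box c (?Z c) \<subseteq> expos n" if "c \<in> ?C" for c
    using that by (intro box_subset_expos) auto
  show ?thesis
  proof (rule partitionableI[where C = "?C - E" and a = "\<lambda>c. c" and Z = ?Z])
    show "finite (?C - E)" using finite_expos_below by blast
  next
    fix c assume c: "c \<in> ?C - E"
    have "lookup c j = g j" if "d < j" for j
      using c g(2)[OF that] by (metis (mono_tags, lifting) DiffD1 le_zero_eq mem_Collect_eq)
    then have "card {d+1..n} \<le> card (?Z c)" by (intro card_mono) auto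
    moreover have "box c (?Z c) \<subseteq> expos n - E"
      using sub[of c] box[of c] g(1) c by blast
    ultimately show "?Z c \<subseteq> {1..n} \<and> n - d \<le> card (?Z c) \<and> box c (?Z c) \<subseteq> expos n - E"
      by auto
  next
    fix b assume b: "b \<in> expos n - E"
    have "truncate g b \<in> ?C - E"
      using b g(1)[of b] by (auto simp: lookup_truncate intro: truncate_in_expos)
    then show "\<exists>c\<in>?C - E. b \<in> box c (?Z c)" using box b by blast
  next
    fix b c c' assume *: "c \<in> ?C - E" "c' \<in> ?C - E" "b \<in> box c (?Z c)" "b \<in> box c' (?Z c')"
    then have "b \<in> expos n" using sub by blast
    then show "c = c'" using * box by blast
  qed
qed

text \<open>The set \<open>E\<close> meets every line parallel to the first axis in a ray or not at all. The box of an
  exponent \<open>b\<close> is based at the start of the ray through \<open>b\<close>, truncated in the remaining coordinates, and it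
  is always free in direction \<open>1\<close>. Compared with the partition of the complement this gains one free
  direction.\<close>

lemma partitionable_upclosed:
  assumes E: "upclosed n E" and cyl: "cylinder n d E" and d: "1 \<le> d" "d \<le> n"
  shows "partitionable n E (n - d + 1)"
proof -
  obtain g where g: "\<And>b. b \<in> expos n \<Longrightarrow> truncate g b \<in> E \<longleftrightarrow> b \<in> E" "\<And>j. d < j \<Longrightarrow> g j = 0"
    using ex_truncation_cylinder[OF E cyl] by blast
  define set1 where "set1 t b = Poly_Mapping.update 1 t b" for t and b :: "nat \<Rightarrow>\<^sub>0 nat"
  have lookup_set1: "lookup (set1 t b) j = (if j = 1 then t else lookup b j)" for t b j
    by (simp add: set1_def lookup_update)
  have set1_expos: "set1 t b \<in> expos n" if "b \<in> expos n" for t b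
    using that d by (auto simp: expos_def keys_update set1_def in_keys_iff lookup_update subset_iff)
  let ?Z = "\<lambda>c. insert 1 {j\<in>{2..n}. lookup c j = g j}"
  define C where "C = {c\<in>E. (\<forall>j. lookup c j \<le> g j) \<and> (\<forall>t. t < lookup c 1 \<longrightarrow> set1 t c \<notin> E)}"
  have C: "c \<in> E" "c \<in> expos n" "lookup c j \<le> g j" "set1 t c \<in> E \<Longrightarrow> lookup c 1 \<le> t" if "c \<in> C" for c j t
    using that upclosed_expos[OF E] by (auto simp: C_def not_less[symmetric])
  have Zn: "?Z c \<subseteq> {1..n}" for c using d by auto
  have agree: "lookup c j = min (lookup b j) (g j)"
    if "c \<in> C" "b \<in> box c (?Z c)" "j \<noteq> 1" for b c j
  proof (cases "j \<in> ?Z c")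
    case True
    moreover have "lookup c j \<le> lookup b j" using that(2) unfolding mem_box_iff by blast
    ultimately show ?thesis using that(3) by simp
  next
    case False
    then have "lookup c j = lookup b j" using that(2) unfolding mem_box_iff by blast
    then show ?thesis using C(3)[OF that(1), of j] by simp
  qed
  \<comment> \<open>Along the line through a point of its box, the base point marks where the ray in the exponent set starts.\<close>
  have least: "set1 t b \<in> E \<longleftrightarrow> lookup c 1 \<le> t" if c: "c \<in> C" and b: "b \<in> box c (?Z c)" for b c t
  proof
    have bn: "b \<in> expos n" using box_subset_expos[OF C(2)[OF c] Zn] b by blast
    assume "lookup c 1 \<le> t"
    then show "set1 t b \<in> E" using upclosedD_le[OF E C(1)[OF c], of "set1 t b"] b set1_expos[OF bn]
      by (simp add: lookup_set1 mem_box_iff)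
  next
    have bn: "b \<in> expos n" using box_subset_expos[OF C(2)[OF c] Zn] b by blast
    assume "set1 t b \<in> E"
    then have "truncate g (set1 t b) \<in> E" using g(1) set1_expos[OF bn] by blast
    then have "set1 t c \<in> E"
      using agree[OF c b] by (elim upclosedD_le[OF E]) (auto simp: lookup_set1 lookup_truncate set1_expos C[OF c])
    then show "lookup c 1 \<le> t" by (rule C(4)[OF c])
  qed
  show ?thesis
  proof (rule partitionableI[where C = C and a = "\<lambda>c. c" and Z = ?Z])
    have "C \<subseteq> {c\<in>expos n. \<forall>j. lookup c j \<le> g j}" using C by blast
    then show "finite C" using finite_expos_below finite_subset by blast
  next
    fix c assume c: "c \<in> C"
    have "lookup c j = g j" if "d < j" for j
      using C(3)[OF c, of j] g(2)[OF that] by simp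
    then have "card (insert 1 {d+1..n}) \<le> card (?Z c)" using d by (intro card_mono) auto
    then have "n - d + 1 \<le> card (?Z c)" using d by simp
    moreover have "b \<in> E" if "b \<in> box c (?Z c)" for b
    proof (rule upclosedD_le[OF E C(1)[OF c]])
      show "b \<in> expos n" using that box_subset_expos[OF C(2)[OF c] Zn] by blast
      show "lookup c j \<le> lookup b j" for j using that unfolding mem_box_iff by blast
    qed
    ultimately show "?Z c \<subseteq> {1..n} \<and> n - d + 1 \<le> card (?Z c) \<and> box c (?Z c) \<subseteq> E"
      using Zn by blast
  next
    fix b assume b: "b \<in> E"
    then have bn: "b \<in> expos n" using upclosed_expos[OF E] by blast
    define t where "t = (LEAST t. set1 t b \<in> E)"
    have "set1 (lookup b 1) b = b" by (rule poly_mapping_eqI) (simp add: lookup_set1)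
    then have b1: "set1 (lookup b 1) b \<in> E" using b by simp
    then have t: "set1 t b \<in> E" "t \<le> lookup b 1"
      unfolding t_def by (rule LeastI, rule Least_le)
    have tmin: "set1 s b \<notin> E" if "s < t" for s
      using that not_less_Least unfolding t_def by blast
    define c where "c = truncate g (set1 t b)"
    have cE: "c \<in> E" unfolding c_def using g(1)[OF set1_expos[OF bn]] t by blast
    have "set1 s c \<notin> E" if s: "s < lookup c 1" for s
    proof
      assume "set1 s c \<in> E"
      then have "set1 s b \<in> E"
        by (elim upclosedD_le[OF E]) (auto simp: lookup_set1 lookup_truncate c_def set1_expos[OF bn])
      moreover have "s < t" using s by (simp add: c_def lookup_truncate lookup_set1)
      ultimately show False using tmin by blast
    qed
    then have "c \<in> C" using cE by (auto simp: C_def) (auto simp: c_def lookup_truncate)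
    moreover have "b \<in> box c (?Z c)"
    proof -
      have "lookup c j = lookup b j" if j: "j \<notin> ?Z c" for j
      proof (cases "j \<in> {1..n}")
        case True
        then show ?thesis using j by (auto simp: c_def lookup_truncate lookup_set1 min_def split: if_splits)
      next
        case False
        then show ?thesis
          using lookup_outside[OF bn False] lookup_outside[OF upclosed_expos[OF E cE] False] by simp
      qed
      then show ?thesis
        using t(2) by (auto simp: mem_box_iff c_def lookup_truncate lookup_set1)
    qed
    ultimately show "\<exists>c\<in>C. b \<in> box c (?Z c)" by blast
  next
    fix b c c' assume *: "c \<in> C" "c' \<in> C" "b \<in> box c (?Z c)" "b \<in> box c' (?Z c')"
    then have "lookup c 1 = lookup c' 1" using least[of c b] least[of c' b] by (metis order_antisym order_refl)
    then show "c = c'" using agree[of c b] agree[of c' b] * by (intro poly_mapping_eqI) metis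
  qed
qed

lemma box_colon:
  "{b. b + e \<in> box a Z} = (if \<forall>j. j \<notin> Z \<longrightarrow> lookup e j \<le> lookup a j then box (a - e) Z else {})"
proof -
  have "(\<forall>j. lookup a j \<le> lookup b j + lookup e j) \<and> (\<forall>j. j \<notin> Z \<longrightarrow> lookup a j = lookup b j + lookup e j)
    \<longleftrightarrow> (\<forall>j. j \<notin> Z \<longrightarrow> lookup e j \<le> lookup a j) \<and>
      (\<forall>j. lookup a j - lookup e j \<le> lookup b j) \<and> (\<forall>j. j \<notin> Z \<longrightarrow> lookup a j - lookup e j = lookup b j)"
    for b
    unfolding all_conj_distrib[symmetric] by (rule all_cong1) auto
  then show ?thesis by (auto simp: mem_box_iff lookup_add lookup_minus)
qed

text \<open>The colon set is covered by the translates by \<open>- e\<close> of the boxes of \<open>E\<close>, cut down to exponents with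
  nonnegative coordinates. Each of these is empty or again a box with the same free directions, so no
  cardinality drops.\<close>

lemma partitionable_colon:
  assumes "partitionable n E s"
  shows "partitionable n {b. b + e \<in> E} s"
proof -
  obtain \<D> where D: "box_partition n E \<D>" and s: "\<And>a Z. (a, Z) \<in> \<D> \<Longrightarrow> s \<le> card Z"
    using assms unfolding partitionable_def by blast
  note fin = box_partitionD(1)[OF D] and E = box_partitionD(2)[OF D, symmetric]
    and Z = box_partitionD(3)[OF D] and disj = box_partitionD(5)[OF D]
  define C where "C = {p\<in>\<D>. \<forall>j. j \<notin> snd p \<longrightarrow> lookup e j \<le> lookup (fst p) j}"
  have box: "b \<in> box (fst p - e) (snd p) \<longleftrightarrow> b + e \<in> case_prod box p" if "p \<in> C" for b p
    using that box_colon[of e "fst p" "snd p"] by (cases p) (auto simp: C_def)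
  show ?thesis
  proof (rule partitionableI[where C = C and a = "\<lambda>p. fst p - e" and Z = snd])
    show "finite C" using fin by (simp add: C_def)
  next
    fix p assume p: "p \<in> C"
    then have pD: "(fst p, snd p) \<in> \<D>" by (simp add: C_def)
    moreover have "box (fst p - e) (snd p) \<subseteq> {b. b + e \<in> E}" using box[OF p] p unfolding E C_def by blast
    ultimately show "snd p \<subseteq> {1..n} \<and> s \<le> card (snd p) \<and> box (fst p - e) (snd p) \<subseteq> {b. b + e \<in> E}"
      using Z s by blast
  next
    fix b assume "b \<in> {b. b + e \<in> E}"
    then obtain p where p: "p \<in> \<D>" "b + e \<in> case_prod box p" using E by blast
    then have "b \<in> {b. b + e \<in> box (fst p) (snd p)}" by (cases p) auto
    then have "p \<in> C" using p(1) unfolding box_colon C_def by (auto split: if_splits)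
    then show "\<exists>c\<in>C. b \<in> box (fst c - e) (snd c)" using box p by blast
  next
    fix b p q assume "p \<in> C" "q \<in> C" "b \<in> box (fst p - e) (snd p)" "b \<in> box (fst q - e) (snd q)"
    then show "p = q" using disj[of p q] box by (auto simp: C_def)
  qed
qed

text \<open>The box containing \<open>u\<close> cannot be free in a direction \<open>j \<le> d\<close>, as it would then contain \<open>u + e\<^sub>j\<close>.\<close>

lemma partitionable_complement_le:
  assumes part: "partitionable n (expos n - E) s" and u: "u \<in> expos n - E"
    and soc: "\<And>j. j \<in> {1..d} \<Longrightarrow> u + single j 1 \<in> E"
  shows "s \<le> n - d"
proof -
  obtain \<D> where D: "box_partition n (expos n - E) \<D>" and s: "\<And>a Z. (a, Z) \<in> \<D> \<Longrightarrow> s \<le> card Z"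
    using part unfolding partitionable_def by blast
  obtain a Z where aZ: "(a, Z) \<in> \<D>" "u \<in> box a Z"
    using box_partitionD(6)[OF D u] by blast
  note Z = box_partitionD(3)[OF D aZ(1)] and sub = box_partitionD(4)[OF D aZ(1)]
  have "j \<notin> {1..d}" if "j \<in> Z" for j
  proof
    assume "j \<in> {1..d}"
    then have "u + single j 1 \<in> E" by (rule soc)
    moreover have "u + single j 1 \<in> box a Z"
      using aZ(2) that by (auto simp: mem_box_iff lookup_add lookup_single_if trans_le_add1)
    ultimately show False using sub by blast
  qed
  then have "Z \<subseteq> {d+1..n}" using Z by fastforce
  then have "card Z \<le> n - d" using card_mono[of "{d+1..n}" Z] by simp
  then show ?thesis using s aZ by fastforce
qed

section \<open>Interval partitions of the nonempty subsets of a finite set\<close>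

text \<open>On a cycle with successor map \<open>s\<close>, such a set \<open>R\<close> consists of the second points of the edges \<open>{p, s p}\<close> of a
  matching that covers everything outside \<open>C\<close>. The set is forced. A point outside \<open>C\<close> whose successor lies
  in \<open>C\<close> must itself be in \<open>R\<close>, and going backwards from there along a run of points outside \<open>C\<close>,
  membership in \<open>R\<close> alternates. So \<open>q \<in> R\<close> exactly when the distance from \<open>q\<close> to the next point of \<open>C\<close> is odd.\<close>

lemma unique_cyclic_matching:
  fixes s :: "'a \<Rightarrow> 'a"
  assumes sV: "\<And>q. q \<in> V \<Longrightarrow> s q \<in> V"
    and reach: "\<And>q. q \<in> V \<Longrightarrow> \<exists>t. (s ^^ t) q \<in> C"
    and C: "C \<subseteq> V"
  shows "\<exists>!R. R \<subseteq> V \<and> (\<forall>q\<in>R. s q \<notin> R) \<and> R \<inter> C = {} \<and> (\<forall>q\<in>V - C. q \<in> R \<or> s q \<in> R)"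
proof -
  define h where "h q = (LEAST t. (s ^^ t) q \<in> C)" for q
  have h0: "h q = 0" if "q \<in> C" for q
    using that Least_le[of "\<lambda>t. (s ^^ t) q \<in> C" 0] by (simp add: h_def)
  have hSuc: "h q = Suc (h (s q))" if "q \<in> V - C" for q
  proof -
    obtain t where "(s ^^ t) q \<in> C" using reach \<open>q \<in> V - C\<close> by blast
    then show ?thesis
      using Least_Suc[of "\<lambda>t. (s ^^ t) q \<in> C" t] that by (simp add: h_def funpow_swap1)
  qed
  define R where "R = {q\<in>V - C. odd (h q)}"
  show ?thesis
  proof (rule ex1I[of _ R])
    have "s q \<notin> R" if "q \<in> R" for q
      using that hSuc[of q] by (auto simp: R_def)
    moreover have "q \<in> R \<or> s q \<in> R" if "q \<in> V - C" for q
    proof (rule disjCI)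
      assume "s q \<notin> R"
      then have "s q \<in> C \<or> even (h (s q))" using sV that by (auto simp: R_def)
      then have "even (h (s q))" using h0 by fastforce
      then show "q \<in> R" using hSuc[OF that] that by (simp add: R_def)
    qed
    ultimately show "R \<subseteq> V \<and> (\<forall>q\<in>R. s q \<notin> R) \<and> R \<inter> C = {} \<and> (\<forall>q\<in>V - C. q \<in> R \<or> s q \<in> R)"
      by (auto simp: R_def)
  next
    fix R' assume R': "R' \<subseteq> V \<and> (\<forall>q\<in>R'. s q \<notin> R') \<and> R' \<inter> C = {} \<and> (\<forall>q\<in>V - C. q \<in> R' \<or> s q \<in> R')"
    have "q \<in> R' \<longleftrightarrow> q \<notin> C \<and> odd (h q)" if "q \<in> V" for q
      using that
    proof (induction "h q" arbitrary: q)
      case 0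
      then have "q \<in> C" using hSuc[of q] by auto
      then show ?case using R' by blast
    next
      case (Suc t)
      then have "q \<notin> C" using h0 by fastforce
      then have hq: "h q = Suc (h (s q))" using hSuc Suc.prems by blast
      then have "s q \<in> R' \<longleftrightarrow> s q \<notin> C \<and> odd (h (s q))"
        using Suc.hyps sV[OF Suc.prems] by simp
      then have "s q \<in> R' \<longleftrightarrow> odd (h (s q))" using h0[of "s q"] by auto
      moreover have "q \<in> R' \<longleftrightarrow> s q \<notin> R'" using R' \<open>q \<notin> C\<close> Suc.prems by blast
      ultimately show ?case using hq \<open>q \<notin> C\<close> by simp
    qed
    then show "R' = R" using R' by (auto simp: R_def)
  qed
qed

text \<open>By \<open>partitionable_prime\<close> below, such a family shows that the ideal generated by all variables of
  \<open>K[x\<^sub>1, \<dots>, x\<^sub>d]\<close> has Stanley depth at least \<open>d / 2\<close>.\<close>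

definition interval_partition :: "nat \<Rightarrow> (nat set \<times> nat set) set \<Rightarrow> bool" where
  "interval_partition d F \<longleftrightarrow>
     (\<forall>A B. (A, B) \<in> F \<longrightarrow> A \<noteq> {} \<and> A \<subseteq> B \<and> B \<subseteq> {1..d} \<and> d \<le> 2 * card B) \<and>
     (\<forall>C. C \<subseteq> {1..d} \<longrightarrow> C \<noteq> {} \<longrightarrow> (\<exists>!p. p \<in> F \<and> fst p \<subseteq> C \<and> C \<subseteq> snd p))"

text \<open>On the cycle \<open>1, \<dots>, d\<close> a set \<open>R\<close> without two consecutive points stands for the matching with edges
  \<open>{p, s p}\<close> for \<open>s p \<in> R\<close>. Its interval runs from the set of unmatched points to the complement of \<open>R\<close>. That
  every nonempty subset lies in exactly one interval is \<open>unique_cyclic_matching\<close>. Since \<open>d\<close> is odd, a matching leaves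
  a point uncovered, so the lower end is nonempty; and \<open>R\<close> contains fewer than half of the points.\<close>

lemma ex_interval_partition_odd:
  assumes "odd d"
  shows "\<exists>F. interval_partition d F"
proof -
  define V where "V = {1..d}"
  define s where "s q = (if q = d then 1 else Suc q)" for q
  have sV: "s q \<in> V" if "q \<in> V" for q using that by (auto simp: s_def V_def)
  have up: "(s ^^ t) q = q + t" if "q + t \<le> d" for t q
    using that by (induction t) (auto simp: s_def)
  have reach: "\<exists>t. (s ^^ t) q = c" if "q \<in> V" "c \<in> V" for q c
  proof -
    have "(s ^^ (c - 1)) (s ((s ^^ (d - q)) q)) = c"
      using that up[of q "d - q"] up[of 1 "c - 1"] by (auto simp: V_def s_def)
    then have "(s ^^ (c - 1 + Suc (d - q))) q = c" unfolding funpow_add by simp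
    then show ?thesis by blast
  qed
  define valid where "valid R \<longleftrightarrow> R \<subseteq> V \<and> (\<forall>q\<in>R. s q \<notin> R)" for R
  define top where "top R = V - R" for R
  define bottom where "bottom R = {q\<in>V. q \<notin> R \<and> s q \<notin> R}" for R
  have card_valid: "2 * card R < d" if "valid R" for R
  proof -
    have fin: "finite R" using that finite_subset[of R V] by (auto simp: valid_def V_def)
    have inj: "inj_on s V" by (auto simp: inj_on_def s_def V_def split: if_splits)
    have "card (s ` R) = card R"
      using that inj by (auto simp: valid_def intro: card_image inj_on_subset)
    moreover have "R \<inter> s ` R = {}" using that by (auto simp: valid_def)
    ultimately have "2 * card R = card (R \<union> s ` R)"
      using fin by (simp add: card_Un_disjoint)
    also have "\<dots> \<le> card V"
      using that sV by (intro card_mono) (auto simp: valid_def V_def)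
    finally have "2 * card R \<le> d" by (simp add: V_def)
    then show ?thesis using assms by (metis dvd_triv_left order_le_imp_less_or_eq)
  qed
  let ?F = "(\<lambda>R. (bottom R, top R)) ` {R. valid R}"
  have "bottom R \<noteq> {} \<and> bottom R \<subseteq> top R \<and> top R \<subseteq> {1..d} \<and> d \<le> 2 * card (top R)"
    if "valid R" for R
  proof -
    have fin: "finite R" "R \<subseteq> V" using that finite_subset[of R V] by (auto simp: valid_def V_def)
    have "card {q\<in>V. s q \<in> R} \<le> card R"
    proof (rule card_inj_on_le[of s])
      show "inj_on s {q\<in>V. s q \<in> R}" by (auto simp: inj_on_def s_def V_def split: if_splits)
    qed (use fin in auto)
    then have "card (R \<union> {q\<in>V. s q \<in> R}) \<le> 2 * card R"
      using card_Un_le[of R "{q\<in>V. s q \<in> R}"] by simp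
    then have "card (R \<union> {q\<in>V. s q \<in> R}) < card V" using card_valid[OF that] by (simp add: V_def)
    moreover have "V \<subseteq> bottom R \<union> (R \<union> {q\<in>V. s q \<in> R})" by (auto simp: bottom_def)
    ultimately have "bottom R \<noteq> {}"
      using fin card_mono[of "R \<union> {q\<in>V. s q \<in> R}" V] by (fastforce simp: V_def)
    moreover have "card (top R) = d - card R"
      using fin by (simp add: top_def V_def card_Diff_subset)
    ultimately show ?thesis
      using card_valid[OF that] by (auto simp: bottom_def top_def V_def)
  qed
  moreover have "\<exists>!p. p \<in> ?F \<and> fst p \<subseteq> C \<and> C \<subseteq> snd p" if C: "C \<subseteq> {1..d}" "C \<noteq> {}" for C
  proof -
    obtain c where c: "c \<in> C" using C by blast
    have iff: "valid R \<and> bottom R \<subseteq> C \<and> C \<subseteq> top R \<longleftrightarrow>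
      R \<subseteq> V \<and> (\<forall>q\<in>R. s q \<notin> R) \<and> R \<inter> C = {} \<and> (\<forall>q\<in>V - C. q \<in> R \<or> s q \<in> R)" for R
      using C by (auto simp: valid_def bottom_def top_def V_def)
    have "\<exists>!R. valid R \<and> bottom R \<subseteq> C \<and> C \<subseteq> top R"
      unfolding iff
    proof (rule unique_cyclic_matching)
      show "\<exists>t. (s ^^ t) q \<in> C" if "q \<in> V" for q
      proof -
        have "c \<in> V" using c C by (auto simp: V_def)
        then obtain t where "(s ^^ t) q = c" using reach \<open>q \<in> V\<close> by blast
        then show ?thesis using c by blast
      qed
    qed (use sV C in \<open>auto simp: V_def\<close>)
    then obtain R where R: "valid R \<and> bottom R \<subseteq> C \<and> C \<subseteq> top R"
      and unique: "\<And>R'. valid R' \<and> bottom R' \<subseteq> C \<and> C \<subseteq> top R' \<Longrightarrow> R' = R" by (elim ex1E) blast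
    show ?thesis
    proof (rule ex1I[of _ "(bottom R, top R)"])
      show "(bottom R, top R) \<in> ?F \<and> fst (bottom R, top R) \<subseteq> C \<and> C \<subseteq> snd (bottom R, top R)"
        using R by simp
      fix p assume p: "p \<in> ?F \<and> fst p \<subseteq> C \<and> C \<subseteq> snd p"
      then obtain R' where "valid R'" "p = (bottom R', top R')" by blast
      then show "p = (bottom R, top R)" using unique[of R'] p by simp
    qed
  qed
  ultimately show ?thesis
    unfolding interval_partition_def by (intro exI[of _ ?F]) fast
qed

text \<open>For even \<open>d\<close> the subsets containing \<open>d\<close> form the single interval \<open>[{d}, {1..d}]\<close>, which is added to a
  partition for \<open>d - 1\<close>.\<close>

lemma ex_interval_partition:
  assumes "1 \<le> d"
  shows "\<exists>F. interval_partition d F"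
proof (cases "odd d")
  case True
  then show ?thesis by (rule ex_interval_partition_odd)
next
  case False
  define e where "e = d - 1"
  have e: "odd e" "d = Suc e" using False assms by (auto simp: e_def)
  obtain F where "interval_partition e F" using ex_interval_partition_odd[OF e(1)] by blast
  note F = this[unfolded interval_partition_def, THEN conjunct1, rule_format]
    and ex1 = this[unfolded interval_partition_def, THEN conjunct2, rule_format]
  let ?F = "insert ({d}, {1..d}) F"
  have "A \<noteq> {} \<and> A \<subseteq> B \<and> B \<subseteq> {1..d} \<and> d \<le> 2 * card B" if "(A, B) \<in> ?F" for A B
  proof (cases "(A, B) \<in> F")
    case True
    have "e \<noteq> 2 * card B" using e(1) by auto
    moreover have "{1..e} \<subseteq> {1..d}" using e(2) by simp
    moreover note F[OF True]
    ultimately have "d \<le> 2 * card B" "B \<subseteq> {1..d}" using e(2) by (linarith, blast)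
    then show ?thesis using F[OF True] by blast
  qed (use that assms in auto)
  moreover have "\<exists>!p. p \<in> ?F \<and> fst p \<subseteq> C \<and> C \<subseteq> snd p" if C: "C \<subseteq> {1..d}" "C \<noteq> {}" for C
  proof (cases "d \<in> C")
    case True
    have "p = ({d}, {1..d})" if "p \<in> ?F" "C \<subseteq> snd p" for p
    proof (rule ccontr)
      assume "p \<noteq> ({d}, {1..d})"
      then have "(fst p, snd p) \<in> F" using that by simp
      from F[OF this] have "snd p \<subseteq> {1..e}" by blast
      then show False using True that(2) e by auto
    qed
    then show ?thesis using C True by (intro ex1I[of _ "({d}, {1..d})"]) auto
  next
    case False
    have "C \<subseteq> {1..e}"
    proof
      fix x assume "x \<in> C"
      then show "x \<in> {1..e}" using C False e(2) by (cases "x = d") auto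
    qed
    moreover have "(p \<in> ?F \<and> fst p \<subseteq> C \<and> C \<subseteq> snd p) \<longleftrightarrow> (p \<in> F \<and> fst p \<subseteq> C \<and> C \<subseteq> snd p)" for p
      using False by auto
    ultimately show ?thesis using ex1 C(2) by simp
  qed
  ultimately show ?thesis
    unfolding interval_partition_def by (intro exI[of _ ?F]) blast
qed

section \<open>The prime ideals generated by variables\<close>

definition prime_expos :: "nat \<Rightarrow> nat \<Rightarrow> (nat \<Rightarrow>\<^sub>0 nat) set" where
  "prime_expos n d = {b\<in>expos n. \<exists>j\<in>{1..d}. 0 < lookup b j}"

text \<open>Grouping exponents by their support turns an interval \<open>[A, B]\<close> into the box based at the indicator
  vector of \<open>A\<close> with the directions of \<open>B\<close> and of \<open>d + 1, \<dots>, n\<close> free.\<close>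

lemma partitionable_prime:
  assumes d: "1 \<le> d" "d \<le> n"
  shows "partitionable n (prime_expos n d) (n - d div 2)"
proof -
  obtain F where "interval_partition d F" using ex_interval_partition[OF d(1)] by blast
  note F = this[unfolded interval_partition_def, THEN conjunct1, rule_format]
    and ex1 = this[unfolded interval_partition_def, THEN conjunct2, rule_format]
  define one_on :: "nat set \<Rightarrow> (nat \<Rightarrow>\<^sub>0 nat)"
    where "one_on A = Abs_poly_mapping (\<lambda>j. if j \<in> A then 1 else 0)" for A
  have one_on: "lookup (one_on A) j = (if j \<in> A then 1 else 0)" if "A \<subseteq> {1..d}" for A j
    using finite_subset[OF that] by (simp add: one_on_def)
  let ?Z = "\<lambda>p. snd p \<union> {d+1..n}"
  have box: "b \<in> box (one_on (fst p)) (?Z p) \<longleftrightarrow> fst p \<subseteq> keys b \<inter> {1..d} \<and> keys b \<inter> {1..d} \<subseteq> snd p"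
    if p: "p \<in> F" and b: "b \<in> expos n" for p b
  proof -
    have FF: "fst p \<subseteq> snd p" "snd p \<subseteq> {1..d}" using F[of "fst p" "snd p"] p by auto
    have le: "lookup (one_on (fst p)) j \<le> lookup b j \<longleftrightarrow> (j \<in> fst p \<longrightarrow> j \<in> keys b)" for j
      using FF by (simp add: one_on in_keys_iff Suc_le_eq)
    have eq: "lookup (one_on (fst p)) j = lookup b j \<longleftrightarrow> j \<notin> keys b" if "j \<notin> ?Z p" for j
      using that FF by (auto simp: one_on in_keys_iff)
    have "keys b \<subseteq> {1..n}" using b by (simp add: expos_def)
    then have "j \<in> {1..d} \<or> j \<in> {d+1..n}" if "j \<in> keys b" for j using that by fastforce
    then have "(\<forall>j. j \<notin> ?Z p \<longrightarrow> j \<notin> keys b) \<longleftrightarrow> keys b \<inter> {1..d} \<subseteq> snd p"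
      using FF(2) by (intro iffI subsetI allI impI notI) (force, blast)
    moreover have "(\<forall>j. j \<in> fst p \<longrightarrow> j \<in> keys b) \<longleftrightarrow> fst p \<subseteq> keys b \<inter> {1..d}"
      using FF by blast
    ultimately show ?thesis unfolding mem_box_iff using le eq by simp
  qed
  have prime_iff: "b \<in> prime_expos n d \<longleftrightarrow> b \<in> expos n \<and> keys b \<inter> {1..d} \<noteq> {}" for b
    by (auto simp: prime_expos_def in_keys_iff)
  have sub: "box (one_on (fst p)) (?Z p) \<subseteq> expos n" if "p \<in> F" for p
  proof (rule box_subset_expos)
    have FF: "fst p \<subseteq> snd p" "snd p \<subseteq> {1..d}" using F[of "fst p" "snd p"] that by auto
    then show "?Z p \<subseteq> {1..n}" using d by auto
    show "one_on (fst p) \<in> expos n"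
    proof -
      have sub: "fst p \<subseteq> {1..d}" using FF by (rule subset_trans)
      have "keys (one_on (fst p)) \<subseteq> fst p"
        using one_on[OF sub] by (auto simp: in_keys_iff split: if_splits)
      then have "keys (one_on (fst p)) \<subseteq> {1..d}" using sub by (rule subset_trans)
      then show ?thesis using d by (auto simp: expos_def)
    qed
  qed
  show ?thesis
  proof (rule partitionableI[where C = F and a = "\<lambda>p. one_on (fst p)" and Z = ?Z])
    have "F \<subseteq> Pow {1..d} \<times> Pow {1..d}" using F by fastforce
    then show "finite F" by (rule finite_subset) simp
  next
    fix p assume p: "p \<in> F"
    have FF: "fst p \<noteq> {}" "fst p \<subseteq> snd p" "snd p \<subseteq> {1..d}" "d \<le> 2 * card (snd p)"
      using F[of "fst p" "snd p"] p by auto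
    have "card (?Z p) = card (snd p) + (n - d)"
      using FF(3) by (subst card_Un_disjoint) (auto intro: finite_subset)
    moreover have "?Z p \<subseteq> {1..n}" using FF(3) d by auto
    moreover have "box (one_on (fst p)) (?Z p) \<subseteq> prime_expos n d"
      using box[OF p] sub[OF p] FF(1) prime_iff by blast
    ultimately show "?Z p \<subseteq> {1..n} \<and> n - d div 2 \<le> card (?Z p) \<and>
        box (one_on (fst p)) (?Z p) \<subseteq> prime_expos n d"
      using FF(4) d by auto
  next
    fix b assume "b \<in> prime_expos n d"
    then show "\<exists>p\<in>F. b \<in> box (one_on (fst p)) (?Z p)"
      using ex1[of "keys b \<inter> {1..d}"] box prime_iff by (metis inf_le2)
  next
    fix b p q
    assume *: "p \<in> F" "q \<in> F" "b \<in> box (one_on (fst p)) (?Z p)" "b \<in> box (one_on (fst q)) (?Z q)"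
    then have b: "b \<in> expos n" using sub by blast
    have "fst p \<noteq> {}" using F[of "fst p" "snd p"] * by auto
    then have "keys b \<inter> {1..d} \<noteq> {}" using box[OF *(1) b] * by blast
    then show "p = q"
      using ex1[of "keys b \<inter> {1..d}"] box[OF _ b] * by blast
  qed
qed

text \<open>Each unit vector \<open>e\<^sub>i\<close> with \<open>i \<le> d\<close> is minimal in the set and hence the base of its own box. If \<open>j \<le> d\<close> is a
  free direction there, this box contains \<open>e\<^sub>i + e\<^sub>j\<close>. By disjointness every unordered pair \<open>{i, j}\<close> arises from at
  most one box, so these boxes have at most \<open>d (d + 1) / 2\<close> free directions among \<open>{1..d}\<close> altogether.\<close>

lemma partitionable_prime_le:
  assumes d: "1 \<le> d" "d \<le> n" and part: "partitionable n (prime_expos n d) s"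
  shows "s \<le> n - d div 2"
proof -
  obtain \<D> where D: "box_partition n (prime_expos n d) \<D>" and s: "\<And>a Z. (a, Z) \<in> \<D> \<Longrightarrow> s \<le> card Z"
    using part unfolding partitionable_def by blast
  note Z = box_partitionD(3)[OF D] and disj = box_partitionD(5)[OF D]
  have ex: "\<exists>Z. (single i 1, Z) \<in> \<D>" if i: "i \<in> {1..d}" for i
  proof -
    have "single i 1 \<in> prime_expos n d"
      using i d by (auto simp: prime_expos_def expos_single intro!: bexI[of _ i])
    then obtain a Z where aZ: "(a, Z) \<in> \<D>" "single i 1 \<in> box a Z"
      using box_partitionD(6)[OF D] by blast
    then have "a \<in> prime_expos n d" using box_partitionD(4)[OF D aZ(1)] base_in_box[of a Z] by blast
    then obtain j where j: "0 < lookup a j" unfolding prime_expos_def by blast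
    have le: "lookup a k \<le> lookup (single i 1) k" for k using aZ(2) unfolding mem_box_iff by blast
    have "a = single i 1"
    proof (rule poly_mapping_eqI)
      fix k
      have "j = i" using le[of j] j by (simp add: lookup_single_if split: if_splits)
      then show "lookup a k = lookup (single i 1) k"
        using le[of k] j by (auto simp: lookup_single_if split: if_splits)
    qed
    then show ?thesis using aZ by blast
  qed
  then obtain Zs where Zs: "\<And>i. i \<in> {1..d} \<Longrightarrow> (single i 1, Zs i) \<in> \<D>" by metis
  define T where "T = (SIGMA i:{1..d}. Zs i \<inter> {1..d})"
  have T: "i \<in> {1..d}" "j \<in> {1..d}" "single i 1 + single j 1 \<in> box (single i 1) (Zs i)"
    if "(i, j) \<in> T" for i j
    using that unfolding T_def box_def by auto
  have antisym: "i = j" if "(i, j) \<in> T" "(j, i) \<in> T" for i j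
  proof (rule ccontr)
    assume "i \<noteq> j"
    then have "single i (1::nat) \<noteq> single j 1"
      by (metis lookup_single_eq lookup_single_not_eq zero_neq_one)
    then have "box (single i 1) (Zs i) \<inter> box (single j 1) (Zs j) = {}"
      using disj[OF Zs[OF T(1)[OF that(1)]] Zs[OF T(1)[OF that(2)]]] by simp
    then show False using T(3)[OF that(1)] T(3)[OF that(2)] by (auto simp: add.commute)
  qed
  have "T \<subseteq> {1..d} \<times> {1..d}" unfolding T_def by blast
  note finT = finite_subset[OF this] this
  have "card T + card (T\<inverse>) = card (T \<union> T\<inverse>) + card (T \<inter> T\<inverse>)"
    by (rule card_Un_Int) (simp_all add: finT)
  also have "card (T \<union> T\<inverse>) \<le> card ({1..d} \<times> {1..d})"
    using finT by (intro card_mono) auto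
  also have "card (T \<inter> T\<inverse>) \<le> card ((\<lambda>i. (i, i)) ` {1..d})"
    using finT antisym by (intro card_mono) auto
  also have "\<dots> \<le> d" using card_image_le[of "{1..d}" "\<lambda>i. (i, i)"] by simp
  finally have le: "2 * card T \<le> d * d + d" by (simp add: card_inverse)
  have "s + d - n \<le> card (Zs i \<inter> {1..d})" if "i \<in> {1..d}" for i
  proof -
    have fin: "finite (Zs i)" using Z[OF Zs[OF that]] finite_subset by blast
    have "Zs i \<subseteq> (Zs i \<inter> {1..d}) \<union> {d+1..n}" using Z[OF Zs[OF that]] by fastforce
    then have "card (Zs i) \<le> card (Zs i \<inter> {1..d} \<union> {d+1..n})" using fin by (intro card_mono) auto
    also have "\<dots> \<le> card (Zs i \<inter> {1..d}) + (n - d)"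
      using card_Un_le[of "Zs i \<inter> {1..d}" "{d+1..n}"] by simp
    finally show ?thesis using s[OF Zs[OF that]] d by linarith
  qed
  then have "(\<Sum>i\<in>{1..d}. s + d - n) \<le> (\<Sum>i\<in>{1..d}. card (Zs i \<inter> {1..d}))"
    by (rule sum_mono)
  also have "\<dots> = card T" unfolding T_def by (rule card_SigmaI[symmetric]) auto
  finally have "2 * (d * (s + d - n)) \<le> d * (d + 1)" using le by simp
  then have "d * (2 * (s + d - n)) \<le> d * (d + 1)" by (simp add: algebra_simps)
  then have "2 * (s + d - n) \<le> d + 1" using d by (simp only: mult_le_cancel1)
  then show ?thesis using d by linarith
qed

section \<open>Spans of monomials\<close>

definition mspan :: "(nat \<Rightarrow>\<^sub>0 nat) set \<Rightarrow> ('k::field) mpoly set" where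
  "mspan Y = {p. keys p \<subseteq> Y}"

lemma mspan_iff_lookup: "p \<in> mspan Y \<longleftrightarrow> (\<forall>b. b \<notin> Y \<longrightarrow> lookup p b = 0)"
  by (auto simp: mspan_def in_keys_iff)

lemma polys_in_eq_mspan: "polys_in Z = mspan {b. keys b \<subseteq> Z}"
  by (auto simp: polys_in_def mspan_def)

lemma polys_in_expos: "polys_in {1..n} = mspan (expos n)"
  unfolding polys_in_eq_mspan expos_def ..

lemma carrier_mpoly_ring: "carrier (mpoly_ring n) = mspan (expos n)"
  unfolding mpoly_ring_def polys_in_expos by simp

lemma mspan_zero: "0 \<in> mspan Y"
  by (simp add: mspan_def)

lemma mspan_add: "p \<in> mspan Y \<Longrightarrow> q \<in> mspan Y \<Longrightarrow> p + q \<in> mspan Y"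
  by (simp add: mspan_iff_lookup lookup_add)

lemma mspan_diff: "p \<in> mspan Y \<Longrightarrow> q \<in> mspan Y \<Longrightarrow> p - q \<in> mspan Y"
  by (simp add: mspan_iff_lookup lookup_minus)

lemma mspan_uminus: "p \<in> mspan Y \<Longrightarrow> - p \<in> mspan Y"
  by (simp add: mspan_iff_lookup)

lemma mspan_sum: "(\<And>i. i \<in> A \<Longrightarrow> f i \<in> mspan Y) \<Longrightarrow> sum f A \<in> mspan Y"
  by (induction A rule: infinite_finite_induct) (auto simp: mspan_zero mspan_add)

lemma mspan_mono: "Y \<subseteq> Y' \<Longrightarrow> p \<in> mspan Y \<Longrightarrow> p \<in> mspan Y'"
  by (auto simp: mspan_def)

lemma mspan_single: "c \<noteq> 0 \<Longrightarrow> single b c \<in> mspan Y \<longleftrightarrow> b \<in> Y"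
  by (simp add: mspan_def)

lemma mspan_singleI: "b \<in> Y \<Longrightarrow> single b c \<in> mspan Y"
  by (simp add: mspan_def)

lemma mspan_mult:
  assumes "p \<in> mspan A" "q \<in> mspan B" "\<And>a b. a \<in> A \<Longrightarrow> b \<in> B \<Longrightarrow> a + b \<in> Y"
  shows "p * q \<in> mspan Y"
  using assms keys_mult[of p q] by (fastforce simp: mspan_def)

lemma mspan_expos_mult:
  assumes "upclosed n E" "r \<in> mspan (expos n)" "p \<in> mspan E"
  shows "r * p \<in> mspan E"
proof -
  have "a + b \<in> E" if "a \<in> expos n" "b \<in> E" for a b
    using assms(1) that by (metis add.commute upclosed_def)
  then show ?thesis using assms by (intro mspan_mult[of r "expos n" p E])
qed

lemma upclosed_trivial: "upclosed n (expos n)" "upclosed n {}"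
  by (auto simp: upclosed_def expos_add_iff)

lemma sum_singles: "(\<Sum>b\<in>keys p. single b (lookup p b)) = p"
  by (rule poly_mapping_eqI) (simp add: lookup_sum lookup_single when_def in_keys_iff sum.delta')

lemma mspan_induct [consumes 1, case_names zero add single]:
  assumes "p \<in> mspan Y" "P 0" "\<And>p q. P p \<Longrightarrow> P q \<Longrightarrow> P (p + q)"
    and "\<And>b c. b \<in> Y \<Longrightarrow> P (single b c)"
  shows "P p"
proof -
  have "P (\<Sum>b\<in>K. single b (lookup p b))" if "finite K" "K \<subseteq> Y" for K
    using that assms(2-4) by (induction K) auto
  then show ?thesis using sum_singles[of p] assms(1) by (metis finite_keys mem_Collect_eq mspan_def)
qed

definition restrict_to :: "(nat \<Rightarrow>\<^sub>0 nat) set \<Rightarrow> ('k::field) mpoly \<Rightarrow> 'k mpoly" where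
  "restrict_to Y p = (\<Sum>b\<in>keys p \<inter> Y. single b (lookup p b))"

lemma lookup_restrict_to: "lookup (restrict_to Y p) b = (if b \<in> Y then lookup p b else 0)"
  by (simp add: restrict_to_def lookup_sum lookup_single when_def in_keys_iff sum.delta')

lemma restrict_to_mspan: "restrict_to Y p \<in> mspan Y"
  by (simp add: mspan_iff_lookup lookup_restrict_to)

lemma lookup_single_mult: "lookup (single e c * p) (e + b) = c * lookup p b"
  for p :: "('k::field) mpoly"
proof -
  have "single e c * p = (\<Sum>x\<in>keys p. single (e + x) (c * lookup p x))"
    using arg_cong[OF sum_singles[of p], of "(*) (single e c)"]
    by (simp add: sum_distrib_left mult_single)
  then show ?thesis
    by (simp add: lookup_sum lookup_single when_def in_keys_iff sum.delta')
qed

lemma lookup_single_mult_0: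
  "(\<And>b. k \<noteq> e + b) \<Longrightarrow> lookup (single e c * p) k = 0" for p :: "('k::field) mpoly"
  using keys_mult[of "single e c" p] not_in_keys_iff_lookup_eq_zero[of k "single e c * p"]
  by (fastforce split: if_splits)

lemma monomial_mult_mspan_iff: "monomial e * p \<in> mspan Y \<longleftrightarrow> p \<in> mspan {b. b + e \<in> Y}"
proof -
  have "(\<forall>k. k \<notin> Y \<longrightarrow> lookup (monomial e * p) k = 0)
    \<longleftrightarrow> (\<forall>b. e + b \<notin> Y \<longrightarrow> lookup (monomial e * p) (e + b) = 0)"
    using lookup_single_mult_0[of _ e 1 p] unfolding monomial_def by metis
  then show ?thesis
    by (simp add: mspan_iff_lookup monomial_def lookup_single_mult add.commute[of _ e])
qed

text \<open>Up to a nonzero scalar, a homogeneous element is a monomial, so the Stanley space generated by it is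
  the span of a box.\<close>

lemma mspan_box:
  assumes "c \<noteq> (0 :: 'k::field)"
  shows "(\<lambda>u. u * single b c) ` polys_in Z = mspan (box b Z)"
proof
  show "(\<lambda>u. u * single b c) ` polys_in Z \<subseteq> mspan (box b Z)"
  proof
    fix q assume "q \<in> (\<lambda>u. u * single b c) ` polys_in Z"
    then obtain u where u: "u \<in> polys_in Z" "q = u * single b c" by blast
    show "q \<in> mspan (box b Z)"
      unfolding u(2)
    proof (rule mspan_mult[OF u(1)[unfolded polys_in_eq_mspan] mspan_singleI[OF singletonI]])
      fix e b' :: "nat \<Rightarrow>\<^sub>0 nat" assume "e \<in> {e. keys e \<subseteq> Z}" "b' \<in> {b}"
      then have "e + b' = b + e" "keys e \<subseteq> Z" by (simp_all add: add.commute)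
      then show "e + b' \<in> box b Z" unfolding box_def by blast
    qed
  qed
  show "mspan (box b Z) \<subseteq> (\<lambda>u. u * single b c) ` polys_in Z"
  proof
    fix q :: "'k mpoly" assume q: "q \<in> mspan (box b Z)"
    let ?u = "\<Sum>x\<in>keys q. single (x - b) (lookup q x / c)"
    have x: "keys (x - b) \<subseteq> Z \<and> x - b + b = x" if "x \<in> keys q" for x
    proof -
      have "x \<in> box b Z" using q that by (auto simp: mspan_def)
      then show ?thesis by (auto simp: box_def add.commute)
    qed
    have "?u * single b c = (\<Sum>x\<in>keys q. single x (lookup q x))"
      unfolding sum_distrib_right using x assms by (intro sum.cong refl) (simp add: mult_single)
    then have "q = ?u * single b c" by (simp add: sum_singles)
    moreover have "?u \<in> polys_in Z"
      unfolding polys_in_eq_mspan using x by (intro mspan_sum mspan_singleI) auto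
    ultimately show "q \<in> (\<lambda>u. u * single b c) ` polys_in Z" by blast
  qed
qed

section \<open>Quotients of monomial ideals and their Stanley decompositions\<close>

lemma stanley_space_eq: "stanley_space M (v, Z) = (\<lambda>u. u \<odot>\<^bsub>M\<^esub> v) ` polys_in Z"
  by (auto simp: stanley_space_def)

text \<open>The module \<open>M\<close> is presented as the quotient of the monomial ideal with exponents \<open>E\<close> by the one with
  exponents \<open>F\<close>, through the projection \<open>\<pi>\<close>. Taking \<open>F = {}\<close> gives a monomial ideal, and taking all
  exponents for \<open>E\<close> gives a quotient ring; so both kinds of modules are treated at once by computing with
  polynomials.\<close>

locale monomial_module =
  fixes n :: nat and M :: "(('k::field) mpoly, 'm, 'd) module_scheme"
    and gr :: "(nat \<Rightarrow> int) \<Rightarrow> 'm set" and E F :: "(nat \<Rightarrow>\<^sub>0 nat) set" and \<pi> :: "'k mpoly \<Rightarrow> 'm"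
  assumes upE: "upclosed n E" and upF: "upclosed n F" and FE: "F \<subseteq> E"
    and abelian: "abelian_group M"
    and carrier_eq: "carrier M = \<pi> ` mspan E"
    and hom_add: "\<And>p q. p \<in> mspan E \<Longrightarrow> q \<in> mspan E \<Longrightarrow> \<pi> (p + q) = \<pi> p \<oplus>\<^bsub>M\<^esub> \<pi> q"
    and hom_smult: "\<And>r p. r \<in> mspan (expos n) \<Longrightarrow> p \<in> mspan E \<Longrightarrow> \<pi> (r * p) = r \<odot>\<^bsub>M\<^esub> \<pi> p"
    and kernel: "\<And>p. p \<in> mspan E \<Longrightarrow> \<pi> p = \<zero>\<^bsub>M\<^esub> \<longleftrightarrow> p \<in> mspan F"
    and graded: "\<And>a. gr a = \<pi> ` (mspan E \<inter> poly_component n a)"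
begin

interpretation abelian_group M by (rule abelian)

lemma hom_closed: "p \<in> mspan E \<Longrightarrow> \<pi> p \<in> carrier M"
  by (simp add: carrier_eq)

lemma hom_zero: "\<pi> 0 = \<zero>\<^bsub>M\<^esub>"
  using kernel[of 0] by (simp add: mspan_zero)

lemma hom_eq_iff:
  assumes "p \<in> mspan E" "q \<in> mspan E"
  shows "\<pi> p = \<pi> q \<longleftrightarrow> p - q \<in> mspan F"
proof -
  have d: "p - q \<in> mspan E" using assms by (rule mspan_diff)
  have "\<pi> p = \<pi> (p - q) \<oplus>\<^bsub>M\<^esub> \<pi> q" using hom_add[OF d assms(2)] by simp
  then have "\<pi> p = \<pi> q \<longleftrightarrow> \<pi> (p - q) = \<zero>\<^bsub>M\<^esub>"
    using hom_closed[OF d] hom_closed[OF assms(1)] hom_closed[OF assms(2)] by (metis l_zero r_zero a_comm add.l_cancel zero_closed)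
  then show ?thesis using kernel[OF d] by simp
qed

lemma hom_sum:
  assumes "\<And>i. i \<in> A \<Longrightarrow> f i \<in> mspan E"
  shows "\<pi> (sum f A) = (\<Oplus>\<^bsub>M\<^esub>i\<in>A. \<pi> (f i))"
  using assms
proof (induction A rule: infinite_finite_induct)
  case (insert x A)
  then show ?case
    by (simp add: hom_add mspan_sum hom_closed Pi_iff)
qed (auto simp: hom_zero)

text \<open>The generator of a free Stanley space is the class of a scalar multiple of a monomial \<open>x\<^sup>a\<close>, and
  freeness says that no monomial of \<open>x\<^sup>a K[Z]\<close> vanishes in \<open>M\<close>.\<close>

lemma boxes_of_stanley_decomposition:
  assumes D: "stanley_decomposition n M gr D" and vZ: "(v, Z) \<in> set D"
  shows "\<exists>a. box a Z \<subseteq> E - F \<and> stanley_space M (v, Z) = \<pi> ` mspan (box a Z)"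
proof -
  have *: "\<exists>\<alpha>\<in>degrees n. v \<in> gr \<alpha>" "Z \<subseteq> {1..n}"
      "\<And>u. u \<in> polys_in Z \<Longrightarrow> u \<odot>\<^bsub>M\<^esub> v = \<zero>\<^bsub>M\<^esub> \<Longrightarrow> u = 0"
    using D vZ unfolding stanley_decomposition_def by blast+
  have ZS: "polys_in Z \<subseteq> mspan (expos n)" using *(2) by (auto simp: polys_in_def mspan_def expos_def)
  obtain \<alpha> p where p: "v = \<pi> p" "p \<in> mspan E" "p \<in> poly_component n \<alpha>" using *(1) graded by blast
  have smult: "u \<odot>\<^bsub>M\<^esub> v = \<pi> (u * p)" if "u \<in> polys_in Z" for u
    using hom_smult[of u p] that ZS p by auto
  have up: "u * p \<in> mspan E" if "u \<in> polys_in Z" for u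
    using mspan_expos_mult[OF upE, of u p] that ZS p by auto
  have free: "u = 0" if "u \<in> polys_in Z" "u * p \<in> mspan F" for u
    using *(3)[OF that(1)] kernel[OF up[OF that(1)]] smult that by auto
  have one: "1 \<in> polys_in Z" by (simp add: polys_in_def)
  have "p \<noteq> 0" using free[OF one] by (auto simp: mspan_zero)
  then obtain b where b: "b \<in> keys p" by (metis in_keys_iff lookup_zero poly_mapping_eqI)
  have "keys p = {b}"
  proof -
    have "b' = b" if b': "b' \<in> keys p" for b'
    proof (rule poly_mapping_eqI)
      fix j
      have "int (lookup b' j) = \<alpha> j" "int (lookup b j) = \<alpha> j"
        using p(3) b b' by (auto simp: poly_component_def)
      then show "lookup b' j = lookup b j" by linarith
    qed
    then show ?thesis using b by blast
  qed
  define c where "c = lookup p b"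
  have pb: "single b c = p" using sum_singles[of p] \<open>keys p = {b}\<close> by (simp add: c_def)
  have c: "c \<noteq> 0" using b by (simp add: c_def in_keys_iff)
  have img: "(\<lambda>u. u * p) ` polys_in Z = mspan (box b Z)"
    using mspan_box[OF c, of b Z] unfolding pb .
  have "x \<in> E - F" if "x \<in> box b Z" for x
  proof -
    have "single x 1 \<in> (\<lambda>u. u * p) ` polys_in Z" unfolding img by (rule mspan_singleI[OF that])
    then obtain u where u: "u \<in> polys_in Z" "u * p = single x 1" by auto
    have "u \<noteq> 0" using u(2) by (metis mult_zero_left single_zero lookup_single_eq lookup_zero zero_neq_one)
    then have "u * p \<notin> mspan F" using free u(1) by blast
    then show ?thesis using up[OF u(1)] u(2) mspan_single[of "1 :: 'k" x] by auto
  qed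
  moreover have "stanley_space M (v, Z) = \<pi> ` (\<lambda>u. u * p) ` polys_in Z"
    unfolding stanley_space_eq image_image using smult by (intro image_cong) auto
  ultimately show ?thesis unfolding img by blast
qed

text \<open>A monomial that is nonzero in \<open>M\<close> is a sum of elements of the Stanley spaces, so it occurs in one of
  them and the boxes cover. If it occurred in two, it would have two representations.\<close>

lemma partition_of_stanley_decomposition:
  assumes D: "stanley_decomposition n M gr D"
  shows "\<exists>\<D>. box_partition n (E - F) \<D> \<and> snd ` \<D> = snd ` set D"
proof -
  have "\<exists>a. box a (snd (D ! i)) \<subseteq> E - F \<and> stanley_space M (D ! i) = \<pi> ` mspan (box a (snd (D ! i)))"
    if "i < length D" for i
    using boxes_of_stanley_decomposition[OF D, of "fst (D ! i)" "snd (D ! i)"] that by simp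
  then obtain a where a: "\<And>i. i < length D \<Longrightarrow> box (a i) (snd (D ! i)) \<subseteq> E - F"
    "\<And>i. i < length D \<Longrightarrow> stanley_space M (D ! i) = \<pi> ` mspan (box (a i) (snd (D ! i)))"
    by metis
  define Y where "Y i = box (a i) (snd (D ! i))" for i
  note Y = a[folded Y_def]
  have YE: "p \<in> mspan E" if "i < length D" "p \<in> mspan (Y i)" for i p
    using that Y(1) by (auto elim!: mspan_mono[rotated])
  have ex1: "\<exists>!w. w \<in> (\<Pi>\<^sub>E i\<in>{..<length D}. \<pi> ` mspan (Y i)) \<and> v = (\<Oplus>\<^bsub>M\<^esub>i\<in>{..<length D}. w i)"
    if "v \<in> carrier M" for v
  proof -
    have "(\<Pi>\<^sub>E i\<in>{..<length D}. stanley_space M (D ! i)) = (\<Pi>\<^sub>E i\<in>{..<length D}. \<pi> ` mspan (Y i))"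
      using Y(2) by (intro PiE_cong) auto
    then show ?thesis using D that unfolding stanley_decomposition_def by auto
  qed
  have cover: "\<exists>i<length D. b \<in> Y i" if b: "b \<in> E - F" for b
  proof -
    have bE: "single b 1 \<in> mspan E" using b by (intro mspan_singleI) auto
    obtain w where w: "w \<in> (\<Pi>\<^sub>E i\<in>{..<length D}. \<pi> ` mspan (Y i))"
      "\<pi> (single b 1) = (\<Oplus>\<^bsub>M\<^esub>i\<in>{..<length D}. w i)"
      using ex1[OF hom_closed[OF bE]] by blast
    have "\<exists>q. q \<in> mspan (Y i) \<and> w i = \<pi> q" if "i < length D" for i
      using PiE_mem[OF w(1), of i] that by auto
    then obtain q where q: "\<And>i. i < length D \<Longrightarrow> q i \<in> mspan (Y i) \<and> w i = \<pi> (q i)" by metis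
    have "(\<Oplus>\<^bsub>M\<^esub>i\<in>{..<length D}. w i) = (\<Oplus>\<^bsub>M\<^esub>i\<in>{..<length D}. \<pi> (q i))"
      using q YE by (intro finsum_cong') (auto intro!: hom_closed)
    also have "\<dots> = \<pi> (\<Sum>i<length D. q i)" using q YE by (intro hom_sum[symmetric]) auto
    finally have "single b 1 - (\<Sum>i<length D. q i) \<in> mspan F"
      using hom_eq_iff[OF bE mspan_sum, of "{..<length D}" q] w(2) q YE by auto
    then have "(\<Sum>i<length D. lookup (q i) b) = 1"
      using b by (auto simp: mspan_iff_lookup lookup_minus lookup_sum)
    then obtain i where "i < length D" "lookup (q i) b \<noteq> 0"
      by (metis (no_types, lifting) lessThan_iff sum.neutral zero_neq_one)
    then show ?thesis using q by (auto simp: mspan_iff_lookup)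
  qed
  have disj: "i = j" if ij: "i < length D" "j < length D" "b \<in> Y i" "b \<in> Y j" for i j b
  proof (rule ccontr)
    assume "i \<noteq> j"
    have bEF: "b \<in> E - F" using ij Y(1) by blast
    then have bE: "single b 1 \<in> mspan E" by (intro mspan_singleI) auto
    let ?v = "\<pi> (single b 1)"
    \<comment> \<open>The representation that places the whole monomial in the k-th Stanley space.\<close>
    define w where "w k = (\<lambda>l\<in>{..<length D}. if l = k then ?v else \<zero>\<^bsub>M\<^esub>)" for k
    have w: "w k \<in> (\<Pi>\<^sub>E i\<in>{..<length D}. \<pi> ` mspan (Y i)) \<and> ?v = (\<Oplus>\<^bsub>M\<^esub>l\<in>{..<length D}. w k l)"
      if k: "k < length D" "b \<in> Y k" for k
    proof
      show "w k \<in> (\<Pi>\<^sub>E i\<in>{..<length D}. \<pi> ` mspan (Y i))"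
      proof (rule PiE_I)
        fix l assume "l \<in> {..<length D}"
        then show "w k l \<in> \<pi> ` mspan (Y l)"
          using imageI[OF mspan_singleI[OF k(2)], of \<pi>] imageI[OF mspan_zero, of \<pi> "Y l"] hom_zero
          by (cases "l = k") (simp_all add: w_def)
      qed (simp add: w_def)
      have "(\<Oplus>\<^bsub>M\<^esub>l\<in>{..<length D}. w k l) = (\<Oplus>\<^bsub>M\<^esub>l\<in>{..<length D}. if k = l then ?v else \<zero>\<^bsub>M\<^esub>)"
        by (rule finsum_cong') (auto simp: w_def hom_closed[OF bE])
      also have "\<dots> = ?v"
        using add.finprod_singleton[of k "{..<length D}" "\<lambda>_. ?v"] k hom_closed[OF bE] by (simp add: finsum_def)
      finally show "?v = (\<Oplus>\<^bsub>M\<^esub>l\<in>{..<length D}. w k l)" by simp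
    qed
    have "w i = w j" using ex1[OF hom_closed[OF bE]] w ij by blast
    then have "?v = \<zero>\<^bsub>M\<^esub>" using \<open>i \<noteq> j\<close> ij by (auto simp: w_def fun_eq_iff split: if_splits)
    then show False using kernel[OF bE] bEF by (simp add: mspan_single)
  qed
  let ?B = "(\<lambda>i. (a i, snd (D ! i))) ` {..<length D}"
  have Z: "snd (D ! i) \<subseteq> {1..n}" if "i < length D" for i
  proof -
    have "D ! i \<in> set D" using that by simp
    then show ?thesis using D unfolding stanley_decomposition_def case_prod_beta by blast
  qed
  have "box_partition n (E - F) ?B"
    unfolding box_partition_def
  proof (intro conjI)
    show "\<forall>(a, Z)\<in>?B. Z \<subseteq> {1..n}" using Z by blast
    have "(\<Union>(a, Z)\<in>?B. box a Z) = (\<Union>i<length D. Y i)" unfolding Y_def by simp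
    also have "\<dots> = E - F" using cover Y(1) by blast
    finally show "(\<Union>(a, Z)\<in>?B. box a Z) = E - F" .
    show "\<forall>p\<in>?B. \<forall>q\<in>?B. p \<noteq> q \<longrightarrow> case_prod box p \<inter> case_prod box q = {}"
      using disj unfolding Y_def by auto
  qed simp
  moreover have "snd ` ?B = snd ` set D"
    by (force simp: image_iff in_set_conv_nth)
  ultimately show ?thesis by blast
qed

text \<open>An element of \<open>M\<close> is split by restricting a representing polynomial to the boxes. The parts are unique
  because the boxes are disjoint and disjoint from \<open>F\<close>.\<close>

lemma stanley_decomposition_of_partition:
  assumes B: "box_partition n (E - F) \<D>"
  shows "\<exists>D. stanley_decomposition n M gr D \<and> snd ` set D = snd ` \<D>"
proof -
  obtain L where L: "set L = \<D>" "distinct L"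
    using finite_distinct_list[OF box_partitionD(1)[OF B]] by blast
  define r where "r = length L"
  define Y where "Y i = case_prod box (L ! i)" for i
  have YEF: "Y i \<subseteq> E - F" if "i < r" for i
    using box_partitionD(4)[OF B, of "fst (L ! i)" "snd (L ! i)"] L that by (auto simp: Y_def r_def case_prod_beta)
  have cover: "\<exists>i<r. b \<in> Y i" if "b \<in> E - F" for b
    using box_partitionD(6)[OF B that] L unfolding Y_def r_def by (force simp: in_set_conv_nth)
  have disj: "i = j" if "i < r" "j < r" "b \<in> Y i" "b \<in> Y j" for i j b
  proof (rule ccontr)
    assume "i \<noteq> j"
    then have "L ! i \<noteq> L ! j" using L that by (simp add: r_def nth_eq_iff_index_eq)
    moreover have "L ! i \<in> \<D>" "L ! j \<in> \<D>" using L that by (auto simp: r_def)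
    ultimately have "Y i \<inter> Y j = {}"
      unfolding Y_def by (intro box_partitionD(5)[OF B])
    then show False using that by blast
  qed
  have YE: "p \<in> mspan E" if "i < r" "p \<in> mspan (Y i)" for i p
    using that YEF by (auto elim!: mspan_mono[rotated])
  define D where "D = map (\<lambda>(a, Z). (\<pi> (monomial a), Z)) L"
  have lenD: "length D = r" by (simp add: D_def r_def)
  have space: "stanley_space M (\<pi> (monomial a), Z) = \<pi> ` mspan (box a Z)"
    and free: "\<And>u. u \<in> polys_in Z \<Longrightarrow> u \<odot>\<^bsub>M\<^esub> \<pi> (monomial a) = \<zero>\<^bsub>M\<^esub> \<Longrightarrow> u = 0"
    and Z: "Z \<subseteq> {1..n}" and aE: "monomial a \<in> (mspan E :: 'k mpoly set)" "a \<in> E"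
    if aZ: "(a, Z) \<in> \<D>" for a Z
  proof -
    show Z: "Z \<subseteq> {1..n}" using box_partitionD(3)[OF B aZ] .
    then have ZS: "polys_in Z \<subseteq> (mspan (expos n) :: 'k mpoly set)"
      by (auto simp: polys_in_def mspan_def expos_def)
    show "a \<in> E" using box_partitionD(4)[OF B aZ] base_in_box[of a Z] by blast
    then show aE: "monomial a \<in> (mspan E :: 'k mpoly set)" by (simp add: monomial_def mspan_singleI)
    have smult: "u \<odot>\<^bsub>M\<^esub> \<pi> (monomial a) = \<pi> (u * monomial a)" if "u \<in> polys_in Z" for u
      using hom_smult[of u "monomial a"] that ZS aE by auto
    have img: "(\<lambda>u. u * monomial a) ` polys_in Z = (mspan (box a Z) :: 'k mpoly set)"
      using mspan_box[of 1 a Z] by (simp add: monomial_def)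
    show "stanley_space M (\<pi> (monomial a), Z) = \<pi> ` mspan (box a Z)"
      unfolding img[symmetric] stanley_space_eq image_image using smult by (intro image_cong) auto
    fix u assume u: "u \<in> polys_in Z" "u \<odot>\<^bsub>M\<^esub> \<pi> (monomial a) = \<zero>\<^bsub>M\<^esub>"
    have "u * monomial a \<in> mspan (box a Z)" using img u(1) by blast
    then have "keys (u * monomial a) \<subseteq> box a Z" by (simp add: mspan_def)
    moreover have "u * monomial a \<in> mspan E" using mspan_expos_mult[OF upE, of u] ZS u aE by auto
    then have "keys (u * monomial a) \<subseteq> F" using kernel u smult by (auto simp: mspan_def)
    ultimately have "keys (u * monomial a) = {}" using box_partitionD(4)[OF B aZ] by blast
    then have "lookup (monomial a * u) b = 0" for b
      by (metis emptyE in_keys_iff mult.commute)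
    then have "lookup u b = 0" for b
      using lookup_single_mult[of a 1 u b] by (metis monomial_def mult_1)
    then show "u = 0" by (intro poly_mapping_eqI) simp
  qed
  have spaces: "stanley_space M (D ! i) = \<pi> ` mspan (Y i)" if "i < r" for i
    using that space[of "fst (L ! i)" "snd (L ! i)"] L
    by (auto simp: D_def r_def Y_def case_prod_beta)
  have ex1: "\<exists>!w. w \<in> (\<Pi>\<^sub>E i\<in>{..<r}. \<pi> ` mspan (Y i)) \<and> v = (\<Oplus>\<^bsub>M\<^esub>i\<in>{..<r}. w i)"
    if v: "v \<in> carrier M" for v
  proof -
    obtain p where p: "p \<in> mspan E" "v = \<pi> p" using v carrier_eq by auto
    show ?thesis
    proof (rule ex_ex1I)
      let ?q = "\<lambda>i. restrict_to (Y i) p"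
      have qE: "?q i \<in> mspan E" if "i < r" for i using YE[OF that restrict_to_mspan] .
      have sumE: "(\<Sum>i<r. ?q i) \<in> mspan E" using qE by (intro mspan_sum) auto
      have "p - (\<Sum>i<r. ?q i) \<in> mspan F"
        unfolding mspan_iff_lookup
      proof (intro allI impI)
        fix b assume b: "b \<notin> F"
        show "lookup (p - (\<Sum>i<r. ?q i)) b = 0"
        proof (cases "b \<in> E")
          case True
          then obtain i where i: "i < r" "b \<in> Y i" using cover b by blast
          have "(\<Sum>i<r. lookup (?q i) b) = (\<Sum>k<r. if k = i then lookup p b else 0)"
            using disj i by (intro sum.cong) (auto simp: lookup_restrict_to)
          then show ?thesis using i by (simp add: lookup_minus lookup_sum)
        next
          case False
          then show ?thesis
            using mspan_diff[OF p(1) sumE] by (simp add: mspan_iff_lookup)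
        qed
      qed
      then have "v = \<pi> (\<Sum>i<r. ?q i)" using hom_eq_iff[OF p(1) sumE] p by simp
      also have "\<dots> = (\<Oplus>\<^bsub>M\<^esub>i\<in>{..<r}. \<pi> (?q i))" using qE by (intro hom_sum) auto
      also have "\<dots> = (\<Oplus>\<^bsub>M\<^esub>i\<in>{..<r}. (\<lambda>i\<in>{..<r}. \<pi> (?q i)) i)"
        using hom_closed[OF qE] by (intro finsum_cong') auto
      finally show "\<exists>w. w \<in> (\<Pi>\<^sub>E i\<in>{..<r}. \<pi> ` mspan (Y i)) \<and> v = (\<Oplus>\<^bsub>M\<^esub>i\<in>{..<r}. w i)"
        using restrict_to_mspan by (intro exI[of _ "\<lambda>i\<in>{..<r}. \<pi> (?q i)"]) auto
    next
      have lift: "\<exists>q. (\<forall>i<r. q i \<in> mspan (Y i) \<and> w i = \<pi> (q i)) \<and> v = \<pi> (\<Sum>i<r. q i)"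
        if w: "w \<in> (\<Pi>\<^sub>E i\<in>{..<r}. \<pi> ` mspan (Y i)) \<and> v = (\<Oplus>\<^bsub>M\<^esub>i\<in>{..<r}. w i)" for w
      proof -
        have "\<exists>q. q \<in> mspan (Y i) \<and> w i = \<pi> q" if "i < r" for i
          using PiE_mem[OF conjunct1[OF w], of i] that by auto
        then obtain q where q: "\<And>i. i < r \<Longrightarrow> q i \<in> mspan (Y i) \<and> w i = \<pi> (q i)" by metis
        have "(\<Oplus>\<^bsub>M\<^esub>i\<in>{..<r}. w i) = (\<Oplus>\<^bsub>M\<^esub>i\<in>{..<r}. \<pi> (q i))"
          using q YE by (intro finsum_cong') (auto intro!: hom_closed)
        also have "\<dots> = \<pi> (\<Sum>i<r. q i)" using q YE by (intro hom_sum[symmetric]) auto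
        finally show ?thesis using q w by auto
      qed
      fix w w' assume w: "w \<in> (\<Pi>\<^sub>E i\<in>{..<r}. \<pi> ` mspan (Y i)) \<and> v = (\<Oplus>\<^bsub>M\<^esub>i\<in>{..<r}. w i)"
        and w': "w' \<in> (\<Pi>\<^sub>E i\<in>{..<r}. \<pi> ` mspan (Y i)) \<and> v = (\<Oplus>\<^bsub>M\<^esub>i\<in>{..<r}. w' i)"
      obtain q where q: "\<And>i. i < r \<Longrightarrow> q i \<in> mspan (Y i) \<and> w i = \<pi> (q i)" "v = \<pi> (\<Sum>i<r. q i)"
        using lift[OF w] by blast
      obtain q' where q': "\<And>i. i < r \<Longrightarrow> q' i \<in> mspan (Y i) \<and> w' i = \<pi> (q' i)" "v = \<pi> (\<Sum>i<r. q' i)"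
        using lift[OF w'] by blast
      have "(\<Sum>i<r. q i) \<in> mspan E" "(\<Sum>i<r. q' i) \<in> mspan E"
        using q(1) q'(1) YE by (auto intro!: mspan_sum)
      then have F: "(\<Sum>i<r. q i) - (\<Sum>i<r. q' i) \<in> mspan F"
        using hom_eq_iff q(2) q'(2) by metis
      have "q i = q' i" if i: "i < r" for i
      proof (rule poly_mapping_eqI)
        fix b
        show "lookup (q i) b = lookup (q' i) b"
        proof (cases "b \<in> Y i")
          case True
          have other: "lookup (q k) b = 0" "lookup (q' k) b = 0" if "k < r" "k \<noteq> i" for k
            using q(1)[OF that(1)] q'(1)[OF that(1)] disj[OF that(1) i _ True] that(2)
            by (auto simp: mspan_iff_lookup)
          have "(\<Sum>k<r. lookup (q k) b) = lookup (q i) b" "(\<Sum>k<r. lookup (q' k) b) = lookup (q' i) b"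
            using i other by (auto simp: sum.remove[of "{..<r}" i] intro!: sum.neutral)
          moreover have "b \<notin> F" using True YEF i by blast
          ultimately show ?thesis using F by (auto simp: mspan_iff_lookup lookup_minus lookup_sum)
        next
          case False
          then show ?thesis using q(1)[OF i] q'(1)[OF i] by (auto simp: mspan_iff_lookup)
        qed
      qed
      then have "w i = w' i" if "i < r" for i using q(1) q'(1) that by simp
      moreover have "w i = w' i" if "\<not> i < r" for i
        using w w' that by (auto simp: PiE_iff extensional_def)
      ultimately show "w = w'" by blast
    qed
  qed
  have "stanley_decomposition n M gr D"
    unfolding stanley_decomposition_def
  proof (intro conjI ballI)
    fix vZ assume "vZ \<in> set D"
    then obtain a Z where aZ: "(a, Z) \<in> \<D>" "vZ = (\<pi> (monomial a), Z)"
      using L by (auto simp: D_def)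
    have "\<pi> (monomial a) \<in> gr (\<lambda>j. int (lookup a j))"
      unfolding graded using aE[OF aZ(1)] upclosed_expos[OF upE]
      by (intro imageI) (auto simp: poly_component_def carrier_mpoly_ring monomial_def mspan_singleI)
    moreover have "(\<lambda>j. int (lookup a j)) \<in> degrees n"
      using lookup_outside[OF upclosed_expos[OF upE aE(2)[OF aZ(1)]]] by (simp add: degrees_def)
    ultimately show "case vZ of (v, Z) \<Rightarrow> v \<in> carrier M \<and> (\<exists>a\<in>degrees n. v \<in> gr a) \<and>
        Z \<subseteq> {1..n} \<and> (\<forall>u\<in>polys_in Z. u \<odot>\<^bsub>M\<^esub> v = \<zero>\<^bsub>M\<^esub> \<longrightarrow> u = 0)"
      using aZ free[OF aZ(1)] Z[OF aZ(1)] hom_closed[OF aE(1)[OF aZ(1)]] by blast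
  next
    fix v assume "v \<in> carrier M"
    moreover have "(\<Pi>\<^sub>E i\<in>{..<r}. stanley_space M (D ! i)) = (\<Pi>\<^sub>E i\<in>{..<r}. \<pi> ` mspan (Y i))"
      using spaces by (intro PiE_cong) auto
    ultimately show "\<exists>!w. w \<in> (\<Pi>\<^sub>E i\<in>{..<length D}. stanley_space M (D ! i)) \<and>
        v = (\<Oplus>\<^bsub>M\<^esub>i\<in>{..<length D}. w i)"
      using ex1 unfolding lenD by simp
  qed
  moreover have "snd ` set D = snd ` \<D>" using L by (force simp: D_def)
  ultimately show ?thesis by blast
qed

text \<open>The existence of one partition guarantees that the maximum defining the Stanley depth is taken over a
  nonempty set; that the module is nonzero guarantees that no decomposition is empty.\<close>

theorem le_sdepth_iff:
  assumes ne: "E - F \<noteq> {}" and part: "partitionable n (E - F) t"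
  shows "s \<le> sdepth n M gr \<longleftrightarrow> partitionable n (E - F) s"
proof -
  let ?V = "{sdepth_decomposition D | D. stanley_decomposition n M gr D}"
  have sd: "sdepth_decomposition D = Min (card ` snd ` set D)" for D :: "('m \<times> nat set) list"
    by (simp add: sdepth_decomposition_def image_image case_prod_beta)
  have D_ne: "set D \<noteq> {}" and D_le: "sdepth_decomposition D \<le> n" if D: "stanley_decomposition n M gr D" for D
  proof -
    obtain \<D> where B: "box_partition n (E - F) \<D>" "snd ` \<D> = snd ` set D"
      using partition_of_stanley_decomposition[OF D] by blast
    obtain a Z where aZ: "(a, Z) \<in> \<D>" using ne box_partitionD(6)[OF B(1)] by blast
    then have Z: "Z \<in> snd ` set D" using B(2) by (metis image_eqI snd_conv)
    then show "set D \<noteq> {}" by auto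
    have "sdepth_decomposition D \<le> card Z" unfolding sd using Z by (intro Min_le) auto
    also have "card Z \<le> card {1..n}" using box_partitionD(3)[OF B(1) aZ] by (intro card_mono) auto
    finally show "sdepth_decomposition D \<le> n" by simp
  qed
  have "?V \<subseteq> {..n}" using D_le by blast
  then have fin: "finite ?V" using finite_subset by blast
  obtain \<D> where "box_partition n (E - F) \<D>" using part unfolding partitionable_def by blast
  then have "\<exists>D. stanley_decomposition n M gr D" using stanley_decomposition_of_partition by metis
  then have "?V \<noteq> {}" by blast
  then have "s \<le> sdepth n M gr \<longleftrightarrow> (\<exists>t\<in>?V. s \<le> t)"
    unfolding sdepth_def by (rule Max_ge_iff[OF fin])
  also have "\<dots> \<longleftrightarrow> (\<exists>D. stanley_decomposition n M gr D \<and> s \<le> sdepth_decomposition D)"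
    by blast
  also have "\<dots> \<longleftrightarrow> (\<exists>D. stanley_decomposition n M gr D \<and> (\<forall>Z\<in>snd ` set D. s \<le> card Z))"
    using D_ne unfolding sd by (intro ex_cong1 conj_cong refl) simp
  also have "\<dots> \<longleftrightarrow> (\<exists>\<D>. box_partition n (E - F) \<D> \<and> (\<forall>Z\<in>snd ` \<D>. s \<le> card Z))"
    using partition_of_stanley_decomposition stanley_decomposition_of_partition by metis
  also have "\<dots> \<longleftrightarrow> partitionable n (E - F) s"
    unfolding partitionable_def by (intro ex_cong1) auto
  finally show ?thesis .
qed

end

section \<open>The polynomial ring and its monomial ideals\<close>

lemma mpoly_ring_simps [simp]:
  "monoid.mult (mpoly_ring n) = (*)" "one (mpoly_ring n) = 1"
  "ring.zero (mpoly_ring n) = 0" "add (mpoly_ring n) = (+)"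
  by (simp_all add: mpoly_ring_def)

lemma mspan_one: "1 \<in> mspan (expos n)"
  by (simp add: mspan_def expos_def)

lemma mspan_expos_closed: "p \<in> mspan (expos n) \<Longrightarrow> q \<in> mspan (expos n) \<Longrightarrow> p * q \<in> mspan (expos n)"
  by (rule mspan_expos_mult[OF upclosed_trivial(1)])

lemma cring_mpoly_ring: "cring (mpoly_ring n :: ('k::field) mpoly ring)"
proof (rule cringI)
  show "abelian_group (mpoly_ring n :: 'k mpoly ring)"
  proof (rule abelian_groupI)
    fix x assume "x \<in> carrier (mpoly_ring n :: 'k mpoly ring)"
    then show "\<exists>y\<in>carrier (mpoly_ring n). y \<oplus>\<^bsub>mpoly_ring n\<^esub> x = \<zero>\<^bsub>mpoly_ring n\<^esub>"
      by (intro bexI[of _ "- x"]) (auto simp: carrier_mpoly_ring mspan_uminus)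
  qed (auto simp: carrier_mpoly_ring mspan_add mspan_zero algebra_simps)
  show "comm_monoid (mpoly_ring n :: 'k mpoly ring)"
    by (rule comm_monoidI) (auto simp: carrier_mpoly_ring mspan_one mspan_expos_closed algebra_simps)
qed (auto simp: algebra_simps)

lemma nat_pow_mpoly_ring: "f [^]\<^bsub>mpoly_ring n\<^esub> (k :: nat) = f ^ k" for f :: "('k::field) mpoly"
  by (induction k) (simp_all add: mult.commute)

lemma ideal_mspan:
  assumes "upclosed n E"
  shows "ideal (mspan E) (mpoly_ring n :: ('k::field) mpoly ring)"
proof -
  interpret R: cring "mpoly_ring n :: 'k mpoly ring" by (rule cring_mpoly_ring)
  have sub: "mspan E \<subseteq> carrier (mpoly_ring n :: 'k mpoly ring)"
    using assms unfolding carrier_mpoly_ring by (auto simp: upclosed_def elim: mspan_mono[rotated])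
  show ?thesis
  proof (rule idealI[OF R.ring_axioms])
    show "subgroup (mspan E) (add_monoid (mpoly_ring n :: 'k mpoly ring))"
    proof (rule R.add.subgroupI)
      show "mspan E \<noteq> ({} :: 'k mpoly set)" using mspan_zero by blast
      show "\<ominus>\<^bsub>mpoly_ring n\<^esub> p \<in> mspan E" if p: "p \<in> mspan E" for p :: "'k mpoly"
      proof -
        have "\<ominus>\<^bsub>mpoly_ring n\<^esub> p = - p"
          using p sub mspan_uminus[OF p] by (intro R.minus_equality) auto
        then show ?thesis using mspan_uminus[OF p] by simp
      qed
    qed (use sub mspan_add in auto)
  next
    fix a p :: "'k mpoly" assume "a \<in> mspan E" "p \<in> carrier (mpoly_ring n)"
    then have "p * a \<in> mspan E" by (simp add: carrier_mpoly_ring mspan_expos_mult[OF assms])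
    then show "p \<otimes>\<^bsub>mpoly_ring n\<^esub> a \<in> mspan E" "a \<otimes>\<^bsub>mpoly_ring n\<^esub> p \<in> mspan E"
      by (simp_all add: mult.commute)
  qed
qed

lemma genideal_monomials:
  assumes B: "\<And>b. b \<in> B \<Longrightarrow> keys b \<subseteq> {1..n}"
  defines "E \<equiv> {b + e | b e. b \<in> B \<and> e \<in> expos n}"
  shows "upclosed n E" "genideal (mpoly_ring n) (monomial ` B) = (mspan E :: ('k::field) mpoly set)"
proof -
  interpret R: cring "mpoly_ring n :: 'k mpoly ring" by (rule cring_mpoly_ring)
  have Bn: "b \<in> expos n" if "b \<in> B" for b using B[OF that] by (simp add: expos_def)
  show up: "upclosed n E"
    unfolding upclosed_def E_def
  proof (intro conjI ballI subsetI)
    fix x e assume "x \<in> {b + e | b e. b \<in> B \<and> e \<in> expos n}" "e \<in> expos n"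
    then obtain b e' where "b \<in> B" "e' \<in> expos n" "x = b + e'" by blast
    moreover have "e' + e \<in> expos n" using \<open>e \<in> expos n\<close> \<open>e' \<in> expos n\<close> by (simp add: expos_add_iff)
    ultimately show "x + e \<in> {b + e | b e. b \<in> B \<and> e \<in> expos n}"
      using add.assoc by blast
  qed (use Bn in \<open>auto simp: expos_add_iff\<close>)
  have "b \<in> E" if "b \<in> B" for b
  proof -
    have "b = b + 0 \<and> b \<in> B \<and> (0 :: nat \<Rightarrow>\<^sub>0 nat) \<in> expos n" using that by (simp add: expos_def)
    then show ?thesis unfolding E_def by blast
  qed
  then have gen: "monomial ` B \<subseteq> (mspan E :: 'k mpoly set)" by (auto simp: monomial_def mspan_singleI)
  show "genideal (mpoly_ring n) (monomial ` B) = (mspan E :: 'k mpoly set)"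
  proof
    show "genideal (mpoly_ring n) (monomial ` B) \<subseteq> (mspan E :: 'k mpoly set)"
      by (rule R.genideal_minimal[OF ideal_mspan[OF up] gen])
    have carr: "monomial ` B \<subseteq> carrier (mpoly_ring n :: 'k mpoly ring)"
      using Bn by (auto simp: carrier_mpoly_ring monomial_def mspan_singleI)
    interpret I: ideal "genideal (mpoly_ring n) (monomial ` B)" "mpoly_ring n :: 'k mpoly ring"
      by (rule R.genideal_ideal[OF carr])
    show "(mspan E :: 'k mpoly set) \<subseteq> genideal (mpoly_ring n) (monomial ` B)"
    proof
      fix p :: "'k mpoly" assume "p \<in> mspan E"
      then show "p \<in> genideal (mpoly_ring n) (monomial ` B)"
      proof (induction p rule: mspan_induct)
        case zero
        then show ?case using I.zero_closed by simp
      next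
        case (add p q)
        then show ?case using I.a_closed by simp
      next
        case (single x c)
        then obtain b e where be: "b \<in> B" "e \<in> expos n" "x = b + e" by (auto simp: E_def)
        have "monomial b \<otimes>\<^bsub>mpoly_ring n\<^esub> single e c \<in> genideal (mpoly_ring n) (monomial ` B)"
          using R.genideal_self[OF carr] be
          by (intro I.I_r_closed) (auto simp: carrier_mpoly_ring mspan_singleI)
        then show ?case using be by (simp add: monomial_def mult_single)
      qed
    qed
  qed
qed

lemma upclosed_prime: "upclosed n (prime_expos n d)"
  by (auto simp: upclosed_def prime_expos_def expos_add_iff lookup_add)

lemma var_ideal_eq:
  assumes "d \<le> n"
  shows "var_ideal n d = (mspan (prime_expos n d) :: ('k::field) mpoly set)"
proof -
  let ?B = "(\<lambda>j. single j (1 :: nat)) ` {1..d}"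
  have "keys b \<subseteq> {1..n}" if "b \<in> ?B" for b using that assms by auto
  note gen = genideal_monomials(2)[of ?B n, OF this]
  have "{b + e | b e. b \<in> ?B \<and> e \<in> expos n} = prime_expos n d"
  proof (intro equalityI subsetI)
    fix x assume "x \<in> {b + e | b e. b \<in> ?B \<and> e \<in> expos n}"
    then obtain j e where "j \<in> {1..d}" "e \<in> expos n" "x = single j 1 + e" by blast
    then show "x \<in> prime_expos n d"
      using assms by (auto simp: prime_expos_def expos_add_iff expos_single lookup_add intro!: bexI[of _ j])
  next
    fix x assume x: "x \<in> prime_expos n d"
    then obtain j where j: "j \<in> {1..d}" "0 < lookup x j" by (auto simp: prime_expos_def)
    have "single j 1 + (x - single j 1) = x"
      by (rule pointwise_le_add_diff) (use j in \<open>auto simp: lookup_single_if\<close>)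
    moreover have "x - single j 1 \<in> expos n"
      using x keys_diff_nat[of x "single j 1"] unfolding prime_expos_def expos_def by blast
    ultimately show "x \<in> {b + e | b e. b \<in> ?B \<and> e \<in> expos n}" using j(1) by (metis (mono_tags, lifting) image_eqI mem_Collect_eq)
  qed
  moreover have "var ` {1..d} = (monomial ` ?B :: 'k mpoly set)" by (simp add: image_image var_def)
  ultimately show ?thesis using gen unfolding var_ideal_def by simp
qed

text \<open>The coefficients \<open>a j\<close> are the data of the null-homotopy of multiplication by \<open>f\<close> on the Koszul
  complex.\<close>

lemma prime_expos_combination:
  fixes f :: "('k::field) mpoly"
  assumes "f \<in> mspan (prime_expos n n)"
  shows "\<exists>a. (\<forall>j. a j \<in> mspan (expos n)) \<and> f = (\<Sum>j\<in>{1..n}. a j * var j)"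
  using assms
proof (induction f rule: mspan_induct)
  case zero
  show ?case by (intro exI[of _ "\<lambda>_. 0"]) (simp add: mspan_zero)
next
  case (add p q)
  then obtain a b where "\<forall>j. a j \<in> mspan (expos n)" "p = (\<Sum>j\<in>{1..n}. a j * var j)"
    "\<forall>j. b j \<in> mspan (expos n)" "q = (\<Sum>j\<in>{1..n}. b j * var j)" by blast
  then show ?case
    by (intro exI[of _ "\<lambda>j. a j + b j"]) (simp add: mspan_add distrib_right sum.distrib)
next
  case (single x c)
  then obtain j where j: "j \<in> {1..n}" "0 < lookup x j" "x \<in> expos n" by (auto simp: prime_expos_def)
  have x: "single j 1 + (x - single j 1) = x"
    by (rule pointwise_le_add_diff) (use j in \<open>auto simp: lookup_single_if\<close>)
  have "x - single j 1 \<in> expos n"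
    using j keys_diff_nat[of x "single j 1"] unfolding expos_def by blast
  moreover have "(\<Sum>i\<in>{1..n}. (if i = j then single (x - single j 1) c else 0) * var i)
      = (\<Sum>i\<in>{1..n}. if i = j then single (x - single j 1) c * var j else 0)"
    by (rule sum.cong) auto
  then have "(\<Sum>i\<in>{1..n}. (if i = j then single (x - single j 1) c else 0) * var i) = single x c"
    using j x by (simp add: var_def monomial_def mult_single add.commute)
  ultimately show ?case
    by (intro exI[of _ "\<lambda>i. if i = j then single (x - single j 1) c else 0"])
      (auto simp: mspan_zero mspan_singleI)
qed

section \<open>The Koszul differential\<close>

text \<open>The sign arising when \<open>e\<^sub>j\<close> is moved to its place in the wedge product of the \<open>e\<^sub>i\<close> with \<open>i \<in> T\<close> in
  increasing order.\<close>

definition koszul_sign :: "nat \<Rightarrow> nat set \<Rightarrow> 'a::comm_ring_1" where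
  "koszul_sign j T = (if even (card {i\<in>T. i < j}) then 1 else - 1)"

text \<open>A chain of the Koszul complex is the family of its coefficients, indexed by subsets \<open>T\<close> of \<open>{1..n}\<close> that
  stand for the basis elements \<open>e\<^sub>T\<close>. The coefficient of the differential at \<open>e\<^sub>T\<close> collects the contributions
  of all larger basis elements from which \<open>e\<^sub>T\<close> arises by deleting one factor.\<close>

definition koszul_diff :: "(nat \<Rightarrow> 'a::comm_ring_1) \<Rightarrow> nat \<Rightarrow> (nat set \<Rightarrow> 'a) \<Rightarrow> nat set \<Rightarrow> 'a" where
  "koszul_diff x n z T = (\<Sum>j\<in>{1..n} - T. koszul_sign j T * x j * z (insert j T))"

text \<open>Left multiplication by \<open>e\<^sub>j\<close>.\<close>

definition koszul_wedge :: "nat \<Rightarrow> (nat set \<Rightarrow> 'a::comm_ring_1) \<Rightarrow> nat set \<Rightarrow> 'a" where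
  "koszul_wedge j z T = (if j \<in> T then koszul_sign j T * z (T - {j}) else 0)"

lemma koszul_sign_insert:
  assumes "finite T" "j \<notin> T"
  shows "koszul_sign i (insert j T) = (if j < i then - koszul_sign i T else koszul_sign i T)"
proof -
  have "{k\<in>insert j T. k < i} = (if j < i then insert j {k\<in>T. k < i} else {k\<in>T. k < i})" by auto
  then show ?thesis using assms by (simp add: koszul_sign_def)
qed

lemma koszul_sign_square: "koszul_sign j T * (koszul_sign j T * p) = p"
  by (simp add: koszul_sign_def)

lemma sum_antisymmetric:
  fixes g :: "'b \<Rightarrow> 'b \<Rightarrow> 'a::ab_group_add"
  assumes "finite A" "\<And>i j. i \<in> A \<Longrightarrow> j \<in> A \<Longrightarrow> i \<noteq> j \<Longrightarrow> g j i = - g i j"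
  shows "(\<Sum>j\<in>A. \<Sum>i\<in>A - {j}. g j i) = 0"
  using assms
proof (induction A)
  case (insert a A)
  have "(\<Sum>j\<in>A. \<Sum>i\<in>insert a A - {j}. g j i) = (\<Sum>j\<in>A. g j a + (\<Sum>i\<in>A - {j}. g j i))"
  proof (rule sum.cong[OF refl])
    fix j assume "j \<in> A"
    then have "insert a A - {j} = insert a (A - {j})" using insert.hyps by auto
    then show "(\<Sum>i\<in>insert a A - {j}. g j i) = g j a + (\<Sum>i\<in>A - {j}. g j i)"
      using insert.hyps by simp
  qed
  also have "\<dots> = (\<Sum>j\<in>A. g j a)"
  proof -
    have "(\<Sum>j\<in>A. \<Sum>i\<in>A - {j}. g j i) = 0"
      by (rule insert.IH) (rule insert.prems, auto)
    then show ?thesis by (simp add: sum.distrib)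
  qed
  also have "\<dots> = - (\<Sum>j\<in>A. g a j)"
    unfolding sum_negf[symmetric] using insert.hyps by (intro sum.cong insert.prems) auto
  finally show ?case using insert.hyps by (simp add: insert_Diff_if)
qed simp

lemma koszul_diff_diff:
  assumes "finite T"
  shows "koszul_diff x n (koszul_diff x n z) T = 0"
proof -
  let ?A = "{1..n} - T"
  define g where "g j i = koszul_sign j T * x j *
    (koszul_sign i (insert j T) * x i * z (insert i (insert j T)))" for j i
  have "koszul_diff x n (koszul_diff x n z) T = (\<Sum>j\<in>?A. \<Sum>i\<in>?A - {j}. g j i)"
    unfolding koszul_diff_def g_def sum_distrib_left
    by (intro sum.cong refl) auto
  also have "\<dots> = 0"
  proof (rule sum_antisymmetric)
    fix i j assume ij: "i \<in> ?A" "j \<in> ?A" "i \<noteq> j"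
    then show "g j i = - g i j"
      unfolding g_def using assms
      by (cases "i < j") (auto simp: koszul_sign_insert insert_commute algebra_simps)
  qed simp
  finally show ?thesis .
qed

text \<open>The differential is an antiderivation with \<open>e\<^sub>j \<mapsto> x\<^sub>j\<close>, so wedging with \<open>e\<^sub>j\<close> is a homotopy between \<open>0\<close> and
  multiplication by \<open>x\<^sub>j\<close>.\<close>

lemma koszul_homotopy:
  assumes T: "T \<subseteq> {1..n}" and j: "j \<in> {1..n}"
  shows "koszul_diff x n (koszul_wedge j z) T = x j * z T - koszul_wedge j (koszul_diff x n z) T"
proof (cases "j \<in> T")
  case False
  have "koszul_diff x n (koszul_wedge j z) T =
    (\<Sum>i\<in>{1..n} - T. if i = j then koszul_sign j T * x j * (koszul_sign j (insert j T) * z T) else 0)"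
    unfolding koszul_diff_def koszul_wedge_def using False by (intro sum.cong refl) (auto simp: insert_absorb)
  also have "\<dots> = koszul_sign j T * x j * (koszul_sign j (insert j T) * z T)"
    using False j by simp
  also have "\<dots> = x j * z T"
    using False finite_subset[OF T] koszul_sign_square[of j T "x j * z T"]
    by (simp add: koszul_sign_insert ac_simps)
  finally show ?thesis using False by (simp add: koszul_wedge_def)
next
  case True
  define U where "U = T - {j}"
  have U: "T = insert j U" "j \<notin> U" "finite U" using True finite_subset[OF T] by (auto simp: U_def)
  have A: "{1..n} - U = insert j ({1..n} - T)" using j U by auto
  have "koszul_wedge j (koszul_diff x n z) T = koszul_sign j T * koszul_diff x n z U"
    using True by (simp add: koszul_wedge_def U_def)
  also have "koszul_diff x n z U = koszul_sign j U * x j * z T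
      + (\<Sum>i\<in>{1..n} - T. koszul_sign i U * x i * z (insert i U))"
    unfolding koszul_diff_def A using True U by simp
  also have "koszul_sign j T * \<dots> = x j * z T
      + (\<Sum>i\<in>{1..n} - T. koszul_sign j T * (koszul_sign i U * x i * z (insert i U)))"
    using koszul_sign_square[of j U "x j * z T"] U
    by (simp add: koszul_sign_insert distrib_left sum_distrib_left mult.assoc)
  also have "(\<Sum>i\<in>{1..n} - T. koszul_sign j T * (koszul_sign i U * x i * z (insert i U)))
      = - koszul_diff x n (koszul_wedge j z) T"
    unfolding koszul_diff_def sum_negf[symmetric]
  proof (intro sum.cong refl)
    fix i assume i: "i \<in> {1..n} - T"
    then have "i \<noteq> j" "i \<notin> U" "insert i T - {j} = insert i U" using U by auto
    then show "koszul_sign j T * (koszul_sign i U * x i * z (insert i U)) =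
        - (koszul_sign i T * x i * koszul_wedge j z (insert i T))"
      using U i by (auto simp: koszul_wedge_def koszul_sign_insert algebra_simps)
  qed
  finally show ?thesis by simp
qed

section \<open>Depth of quotients of monomial ideals\<close>

lemma lookup_var_mult_0: "lookup k j = 0 \<Longrightarrow> lookup (var j * p) k = 0" for p :: "('k::field) mpoly"
  unfolding var_def monomial_def by (rule lookup_single_mult_0) (auto simp: lookup_add)

lemma lookup_var_mult: "lookup (var j * p) (b + single j 1) = lookup p b" for p :: "('k::field) mpoly"
  using lookup_single_mult[of "single j 1" 1 p b] by (simp add: var_def monomial_def add.commute)

lemma lookup_koszul_sign: "lookup (koszul_sign j T * p) k = koszul_sign j T * lookup p k"
  for p :: "('k::field) mpoly"
  by (simp add: koszul_sign_def)

lemma var_mspan: "j \<in> {1..n} \<Longrightarrow> var j \<in> (mspan (expos n) :: ('k::field) mpoly set)"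
  by (simp add: var_def monomial_def mspan_singleI expos_single)

lemma mspan_koszul_sign: "p \<in> mspan Y \<Longrightarrow> koszul_sign j T * p \<in> mspan Y"
  by (simp add: koszul_sign_def mspan_uminus)

lemma mspan_koszul_diff:
  assumes "upclosed n E" "\<And>T. z T \<in> mspan E"
  shows "koszul_diff var n z T \<in> mspan E"
  unfolding koszul_diff_def mult.assoc
  by (intro mspan_sum mspan_koszul_sign mspan_expos_mult[OF assms(1)] assms(2) var_mspan) auto

context monomial_module
begin

interpretation abelian_group M by (rule abelian)

text \<open>The preimage under \<open>\<pi>\<close> of the submodule \<open>(f\<^sub>1, \<dots>, f\<^sub>r) M\<close> for a sequence \<open>f\<^sub>1, \<dots>, f\<^sub>r\<close>, which makes it possible to
  test regularity on polynomials.\<close>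

definition span_mod :: "'k mpoly list \<Rightarrow> 'k mpoly set" where
  "span_mod xs = {q + (\<Sum>i<length xs. xs ! i * w i) | q w. q \<in> mspan F \<and> (\<forall>i. w i \<in> mspan E)}"

lemma mult_closed: "r \<in> mspan (expos n) \<Longrightarrow> p \<in> mspan E \<Longrightarrow> r * p \<in> mspan E"
  by (rule mspan_expos_mult[OF upE])

lemma F_le_E: "p \<in> mspan F \<Longrightarrow> p \<in> mspan E"
  by (rule mspan_mono[OF FE])

lemma span_modI:
  assumes "q \<in> mspan F" "\<And>i. w i \<in> mspan E" "v = q + (\<Sum>i<length xs. xs ! i * w i)"
  shows "v \<in> span_mod xs"
  unfolding span_mod_def using assms by (intro CollectI exI[of _ q] exI[of _ w]) simp

lemma span_mod_Nil: "span_mod [] = mspan F"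
proof (intro equalityI subsetI)
  fix v :: "'k mpoly" assume "v \<in> mspan F"
  then show "v \<in> span_mod []" by (rule span_modI[where w = "\<lambda>_. 0"]) (simp_all add: mspan_zero)
qed (auto simp: span_mod_def)

lemma span_mod_snoc: "span_mod (xs @ [f]) = {q + f * p | q p. q \<in> span_mod xs \<and> p \<in> mspan E}"
proof (intro equalityI subsetI)
  fix v assume "v \<in> span_mod (xs @ [f])"
  then obtain q w where "q \<in> mspan F" "\<And>i. w i \<in> mspan E"
    "v = q + (\<Sum>i<length (xs @ [f]). (xs @ [f]) ! i * w i)" unfolding span_mod_def by blast
  moreover have "(\<Sum>i<length (xs @ [f]). (xs @ [f]) ! i * w i)
      = (\<Sum>i<length xs. xs ! i * w i) + f * w (length xs)"
    by (simp add: nth_append)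
  ultimately show "v \<in> {q + f * p | q p. q \<in> span_mod xs \<and> p \<in> mspan E}"
    unfolding span_mod_def by (auto simp: add.assoc[symmetric])
next
  fix v assume "v \<in> {q + f * p | q p. q \<in> span_mod xs \<and> p \<in> mspan E}"
  then obtain q w p where q: "q \<in> mspan F" "\<And>i. w i \<in> mspan E" "p \<in> mspan E"
    "v = q + (\<Sum>i<length xs. xs ! i * w i) + f * p" unfolding span_mod_def by blast
  let ?w = "\<lambda>i. if i = length xs then p else w i"
  have "(\<Sum>i<length (xs @ [f]). (xs @ [f]) ! i * ?w i) = (\<Sum>i<length xs. xs ! i * w i) + f * p"
    by (simp add: nth_append)
  then have "v = q + (\<Sum>i<length (xs @ [f]). (xs @ [f]) ! i * ?w i)" using q by (simp add: add.assoc)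
  then show "v \<in> span_mod (xs @ [f])" using q(2,3) by (intro span_modI[OF q(1), of ?w]) auto
qed

lemma span_mod_subset:
  assumes "set xs \<subseteq> mspan (expos n)"
  shows "span_mod xs \<subseteq> mspan E"
  using assms
proof (induction xs rule: rev_induct)
  case (snoc f xs)
  then show ?case unfolding span_mod_snoc by (auto intro!: mspan_add mult_closed)
qed (auto simp: span_mod_Nil F_le_E)

lemma span_mod_F: "p \<in> mspan F \<Longrightarrow> p \<in> span_mod xs"
proof (induction xs rule: rev_induct)
  case (snoc f xs)
  then have "p \<in> span_mod xs" "p = p + f * 0" by simp_all
  then show ?case unfolding span_mod_snoc using mspan_zero by blast
qed (simp add: span_mod_Nil)

lemma span_mod_zero: "0 \<in> span_mod xs"
  by (rule span_mod_F[OF mspan_zero])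

lemma span_mod_add:
  assumes "p \<in> span_mod xs" "q \<in> span_mod xs"
  shows "p + q \<in> span_mod xs"
  using assms
proof (induction xs arbitrary: p q rule: rev_induct)
  case (snoc f xs)
  from snoc.prems obtain p1 p2 q1 q2 where *: "p1 \<in> span_mod xs" "p2 \<in> mspan E" "p = p1 + f * p2"
    "q1 \<in> span_mod xs" "q2 \<in> mspan E" "q = q1 + f * q2" unfolding span_mod_snoc by blast
  then have "p + q = (p1 + q1) + f * (p2 + q2)" by (simp add: algebra_simps)
  then show ?case unfolding span_mod_snoc using snoc.IH[OF *(1,4)] mspan_add[OF *(2,5)] by blast
qed (simp add: span_mod_Nil mspan_add)

lemma span_mod_mult:
  assumes "r \<in> mspan (expos n)" "p \<in> span_mod xs"
  shows "r * p \<in> span_mod xs"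
  using assms(2)
proof (induction xs arbitrary: p rule: rev_induct)
  case Nil
  then show ?case using mspan_expos_mult[OF upF assms(1)] by (simp add: span_mod_Nil)
next
  case (snoc f xs)
  from snoc.prems obtain p1 p2 where *: "p1 \<in> span_mod xs" "p2 \<in> mspan E" "p = p1 + f * p2"
    unfolding span_mod_snoc by blast
  then have "r * p = r * p1 + f * (r * p2)" by (simp add: algebra_simps)
  then show ?case unfolding span_mod_snoc using snoc.IH[OF *(1)] mult_closed[OF assms(1) *(2)] by blast
qed

lemma span_mod_uminus: "p \<in> span_mod xs \<Longrightarrow> - p \<in> span_mod xs"
  using span_mod_mult[of "- 1" p xs] by (simp add: mspan_uminus mspan_one)

lemma span_mod_sum: "(\<And>i. i \<in> A \<Longrightarrow> f i \<in> span_mod xs) \<Longrightarrow> sum f A \<in> span_mod xs"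
  by (induction A rule: infinite_finite_induct) (auto simp: span_mod_zero span_mod_add)

lemma span_mod_koszul_sign: "p \<in> span_mod xs \<Longrightarrow> koszul_sign j T * p \<in> span_mod xs"
  by (simp add: koszul_sign_def span_mod_uminus)

lemma span_mod_koszul_diff:
  assumes "\<And>T. T \<subseteq> {1..n} \<Longrightarrow> z T \<in> span_mod xs" "T \<subseteq> {1..n}"
  shows "koszul_diff var n z T \<in> span_mod xs"
  unfolding koszul_diff_def mult.assoc
  by (intro span_mod_sum span_mod_koszul_sign span_mod_mult assms(1) var_mspan) (use assms(2) in auto)

lemma seq_submodule_eq:
  assumes "set xs \<subseteq> mspan (expos n)"
  shows "seq_submodule M xs = \<pi> ` span_mod xs"
proof (intro equalityI subsetI)
  have xi: "xs ! i \<in> mspan (expos n)" if "i < length xs" for i using assms that by auto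
  have eq: "\<pi> (\<Sum>i<length xs. xs ! i * w i) = (\<Oplus>\<^bsub>M\<^esub>i\<in>{..<length xs}. xs ! i \<odot>\<^bsub>M\<^esub> \<pi> (w i))"
    if w: "\<And>i. w i \<in> mspan E" for w
  proof -
    have "\<pi> (\<Sum>i<length xs. xs ! i * w i) = (\<Oplus>\<^bsub>M\<^esub>i\<in>{..<length xs}. \<pi> (xs ! i * w i))"
      using w xi by (intro hom_sum mult_closed) auto
    also have "\<dots> = (\<Oplus>\<^bsub>M\<^esub>i\<in>{..<length xs}. xs ! i \<odot>\<^bsub>M\<^esub> \<pi> (w i))"
    proof (rule finsum_cong')
      show "(\<lambda>i. xs ! i \<odot>\<^bsub>M\<^esub> \<pi> (w i)) \<in> {..<length xs} \<rightarrow> carrier M"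
        using hom_smult[OF xi w] hom_closed[OF mult_closed[OF xi w]] by auto
    qed (use hom_smult[OF xi w] in auto)
    finally show ?thesis .
  qed
  {
    fix v assume "v \<in> seq_submodule M xs"
    then obtain w where w: "w \<in> {..<length xs} \<rightarrow> carrier M"
      "v = (\<Oplus>\<^bsub>M\<^esub>i\<in>{..<length xs}. xs ! i \<odot>\<^bsub>M\<^esub> w i)" unfolding seq_submodule_def by blast
    have "\<exists>p. p \<in> mspan E \<and> (i < length xs \<longrightarrow> w i = \<pi> p)" for i
    proof (cases "i < length xs")
      case True
      then have "w i \<in> \<pi> ` mspan E" using w(1) carrier_eq by auto
      then show ?thesis by blast
    qed (use mspan_zero in blast)
    then obtain p where p: "\<And>i. p i \<in> mspan E" "\<And>i. i < length xs \<Longrightarrow> w i = \<pi> (p i)" by metis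
    have "v = (\<Oplus>\<^bsub>M\<^esub>i\<in>{..<length xs}. xs ! i \<odot>\<^bsub>M\<^esub> \<pi> (p i))"
      unfolding w(2) using p hom_smult[OF xi p(1)] hom_closed[OF mult_closed[OF xi p(1)]]
      by (intro finsum_cong') auto
    also have "\<dots> = \<pi> (0 + (\<Sum>i<length xs. xs ! i * p i))" using eq[OF p(1)] by simp
    finally have "v = \<pi> (0 + (\<Sum>i<length xs. xs ! i * p i))" .
    moreover have "0 + (\<Sum>i<length xs. xs ! i * p i) \<in> span_mod xs"
      by (rule span_modI[OF mspan_zero p(1) refl])
    ultimately show "v \<in> \<pi> ` span_mod xs" by (rule image_eqI)
  next
    fix v assume "v \<in> \<pi> ` span_mod xs"
    then obtain q w where qw: "q \<in> mspan F" "\<And>i. w i \<in> mspan E" "v = \<pi> (q + (\<Sum>i<length xs. xs ! i * w i))"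
      unfolding span_mod_def by blast
    have S: "(\<Sum>i<length xs. xs ! i * w i) \<in> mspan E" using xi qw(2) by (intro mspan_sum mult_closed) auto
    have "v = \<pi> q \<oplus>\<^bsub>M\<^esub> \<pi> (\<Sum>i<length xs. xs ! i * w i)" unfolding qw(3) by (rule hom_add[OF F_le_E[OF qw(1)] S])
    also have "\<pi> q = \<zero>\<^bsub>M\<^esub>" using kernel[OF F_le_E[OF qw(1)]] qw(1) by blast
    finally have "v = (\<Oplus>\<^bsub>M\<^esub>i\<in>{..<length xs}. xs ! i \<odot>\<^bsub>M\<^esub> \<pi> (w i))"
      using hom_closed[OF S] eq[OF qw(2)] by simp
    then show "v \<in> seq_submodule M xs"
      unfolding seq_submodule_def using hom_closed[OF qw(2)] by (auto intro!: exI[of _ "\<lambda>i. \<pi> (w i)"])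
  }
qed

lemma seq_submodule_iff:
  assumes "set xs \<subseteq> mspan (expos n)" "p \<in> mspan E"
  shows "\<pi> p \<in> seq_submodule M xs \<longleftrightarrow> p \<in> span_mod xs"
proof
  assume "\<pi> p \<in> seq_submodule M xs"
  then obtain q where q: "q \<in> span_mod xs" "\<pi> p = \<pi> q" unfolding seq_submodule_eq[OF assms(1)] by blast
  have "q \<in> mspan E" using q(1) span_mod_subset[OF assms(1)] by blast
  then have "p - q \<in> span_mod xs" using hom_eq_iff[OF assms(2)] q(2) span_mod_F by blast
  then show "p \<in> span_mod xs" using span_mod_add[OF _ q(1), of "p - q"] by simp
qed (use seq_submodule_eq[OF assms(1)] in blast)

lemma regular_sequence_iff:
  "regular_sequence (mpoly_ring n) M xs \<longleftrightarrow> set xs \<subseteq> mspan (expos n) \<and>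
    (\<forall>i<length xs. \<forall>p\<in>mspan E. xs ! i * p \<in> span_mod (take i xs) \<longrightarrow> p \<in> span_mod (take i xs)) \<and>
    span_mod xs \<noteq> mspan E" (is "?L \<longleftrightarrow> ?xs \<and> ?R")
proof (cases ?xs)
  case xs: True
  have xi: "xs ! i \<in> mspan (expos n)" if "i < length xs" for i using xs that by auto
  have t: "set (take i xs) \<subseteq> mspan (expos n)" for i using xs set_take_subset[of i xs] by blast
  have "(\<forall>v\<in>carrier M. xs ! i \<odot>\<^bsub>M\<^esub> v \<in> seq_submodule M (take i xs) \<longrightarrow> v \<in> seq_submodule M (take i xs)) \<longleftrightarrow>
      (\<forall>p\<in>mspan E. xs ! i * p \<in> span_mod (take i xs) \<longrightarrow> p \<in> span_mod (take i xs))" if i: "i < length xs" for i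
  proof -
    have "xs ! i \<odot>\<^bsub>M\<^esub> \<pi> p = \<pi> (xs ! i * p)" if "p \<in> mspan E" for p
      using hom_smult[OF xi[OF i] that] by simp
    then show ?thesis
      unfolding carrier_eq using seq_submodule_iff[OF t] mult_closed[OF xi[OF i]] by simp
  qed
  moreover have "seq_submodule M xs = carrier M \<longleftrightarrow> span_mod xs = mspan E"
  proof
    assume "seq_submodule M xs = carrier M"
    then have "mspan E \<subseteq> span_mod xs" using seq_submodule_iff[OF xs] hom_closed by blast
    then show "span_mod xs = mspan E" using span_mod_subset[OF xs] by blast
  qed (simp add: seq_submodule_eq[OF xs] carrier_eq)
  ultimately show ?thesis using xs unfolding regular_sequence_def carrier_mpoly_ring by simp
qed (auto simp: regular_sequence_def carrier_mpoly_ring)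

subsection \<open>Koszul classes bound the length of regular sequences\<close>

text \<open>Cycles of degree \<open>i\<close> of the Koszul complex of \<open>x\<^sub>1, \<dots>, x\<^sub>n\<close> with coefficients in the quotient of \<open>M\<close> by
  the sequence \<open>xs\<close>, represented by polynomials.\<close>

definition koszul_cycle :: "nat \<Rightarrow> 'k mpoly list \<Rightarrow> (nat set \<Rightarrow> 'k mpoly) \<Rightarrow> bool" where
  "koszul_cycle i xs z \<longleftrightarrow> (\<forall>T. z T \<in> mspan E) \<and> (\<forall>T. T \<subseteq> {1..n} \<longrightarrow> card T \<noteq> i \<longrightarrow> z T = 0) \<and>
     (\<forall>T. T \<subseteq> {1..n} \<longrightarrow> koszul_diff var n z T \<in> span_mod xs)"

text \<open>A boundary is allowed to come from a chain of mixed degree. This makes being a non-boundary stronger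
  and spares tracking degrees.\<close>

definition koszul_boundary :: "'k mpoly list \<Rightarrow> (nat set \<Rightarrow> 'k mpoly) \<Rightarrow> bool" where
  "koszul_boundary xs z \<longleftrightarrow> (\<exists>u. (\<forall>T. u T \<in> mspan E) \<and>
     (\<forall>T. T \<subseteq> {1..n} \<longrightarrow> z T - koszul_diff var n u T \<in> span_mod xs))"

definition koszul_class :: "nat \<Rightarrow> 'k mpoly list \<Rightarrow> bool" where
  "koszul_class i xs \<longleftrightarrow> (\<exists>z. koszul_cycle i xs z \<and> \<not> koszul_boundary xs z)"

text \<open>Above degree \<open>n\<close> there are no basis elements, so every cycle vanishes.\<close>

lemma koszul_class_le:
  assumes "koszul_class i xs"
  shows "i \<le> n"
proof (rule ccontr)
  assume "\<not> i \<le> n"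
  obtain z where z: "koszul_cycle i xs z" and nb: "\<not> koszul_boundary xs z"
    using assms unfolding koszul_class_def by blast
  have "z T = 0" if T: "T \<subseteq> {1..n}" for T
  proof -
    have "card T \<le> n" using card_mono[OF _ T] by simp
    then show ?thesis using z T \<open>\<not> i \<le> n\<close> unfolding koszul_cycle_def by auto
  qed
  then have "koszul_boundary xs z"
    unfolding koszul_boundary_def
    by (intro exI[of _ "\<lambda>_. 0"]) (simp add: koszul_diff_def span_mod_zero mspan_zero)
  then show False using nb by blast
qed

text \<open>With \<open>f = \<Sum> a\<^sub>j x\<^sub>j\<close>, the chain \<open>w = \<Sum> a\<^sub>j e\<^sub>j \<and> z\<close> satisfies \<open>d w = f z\<close> modulo \<open>xs\<close>, so \<open>w\<close> is a cycle modulo \<open>xs\<close> and \<open>f\<close>. If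
  \<open>w = d u + f y\<close> modulo \<open>xs\<close>, then applying \<open>d\<close> gives \<open>f z = f d y\<close>, and \<open>z = d y\<close> by regularity of \<open>f\<close>, contrary to
  the choice of \<open>z\<close>.\<close>

lemma koszul_class_step:
  assumes f: "f \<in> mspan (prime_expos n n)" and K: "koszul_class i xs"
    and regular: "\<And>p. p \<in> mspan E \<Longrightarrow> f * p \<in> span_mod xs \<Longrightarrow> p \<in> span_mod xs"
  shows "koszul_class (Suc i) (xs @ [f])"
proof -
  let ?d = "koszul_diff (var :: nat \<Rightarrow> 'k mpoly) n"
  obtain a where a: "\<And>j. a j \<in> mspan (expos n)" "f = (\<Sum>j\<in>{1..n}. a j * var j)"
    using prime_expos_combination[OF f] by blast
  obtain z where z: "koszul_cycle i xs z" and nb: "\<not> koszul_boundary xs z"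
    using K unfolding koszul_class_def by blast
  have zE: "z T \<in> mspan E" for T using z unfolding koszul_cycle_def by blast
  have z0: "z T = 0" if "T \<subseteq> {1..n}" "card T \<noteq> i" for T
    using z that unfolding koszul_cycle_def by blast
  have dz: "?d z T \<in> span_mod xs" if "T \<subseteq> {1..n}" for T
    using z that unfolding koszul_cycle_def by blast
  have fin: "finite T" if "T \<subseteq> {1..n}" for T using that finite_subset by blast
  have lin: "?d (\<lambda>T. \<Sum>j\<in>{1..n}. a j * v j T) T = (\<Sum>j\<in>{1..n}. a j * ?d (v j) T)" for v T
    unfolding koszul_diff_def sum_distrib_left by (subst sum.swap) (simp add: ac_simps)
  define w where "w T = (\<Sum>j\<in>{1..n}. a j * koszul_wedge j z T)" for T
  have wE: "w T \<in> mspan E" for T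
    unfolding w_def koszul_wedge_def
    using zE by (intro mspan_sum mult_closed[OF a(1)]) (auto intro: mspan_koszul_sign mspan_zero)
  have w0: "w T = 0" if T: "T \<subseteq> {1..n}" "card T \<noteq> Suc i" for T
  proof -
    have "z (T - {j}) = 0" if "j \<in> T" for j
    proof (rule z0)
      show "card (T - {j}) \<noteq> i" using T(2) card_Suc_Diff1[OF fin[OF T(1)] that] by simp
    qed (use T in blast)
    then show ?thesis unfolding w_def koszul_wedge_def by (intro sum.neutral) simp
  qed
  have dw: "f * z T - ?d w T \<in> span_mod xs" if T: "T \<subseteq> {1..n}" for T
  proof -
    have "?d w T = (\<Sum>j\<in>{1..n}. a j * ?d (koszul_wedge j z) T)" unfolding w_def by (rule lin)
    also have "\<dots> = (\<Sum>j\<in>{1..n}. a j * (var j * z T - koszul_wedge j (?d z) T))"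
      by (intro sum.cong refl) (simp only: koszul_homotopy[OF T])
    also have "\<dots> = f * z T - (\<Sum>j\<in>{1..n}. a j * koszul_wedge j (?d z) T)"
      by (simp add: a(2) sum_distrib_right sum_subtractf right_diff_distrib mult.assoc)
    finally have "f * z T - ?d w T = (\<Sum>j\<in>{1..n}. a j * koszul_wedge j (?d z) T)" by simp
    moreover have "\<dots> \<in> span_mod xs"
      unfolding koszul_wedge_def
      using dz T by (intro span_mod_sum span_mod_mult[OF a(1)])
        (auto intro!: span_mod_koszul_sign span_mod_zero dz)
    ultimately show ?thesis by simp
  qed
  have dw': "?d w T \<in> span_mod (xs @ [f])" if T: "T \<subseteq> {1..n}" for T
  proof -
    have "?d w T = - (f * z T - ?d w T) + f * z T" by simp
    then show ?thesis unfolding span_mod_snoc using span_mod_uminus[OF dw[OF T]] zE by blast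
  qed
  have "\<not> koszul_boundary (xs @ [f]) w"
  proof
    assume "koszul_boundary (xs @ [f]) w"
    then obtain u where u: "\<forall>T. T \<subseteq> {1..n} \<longrightarrow> w T - ?d u T \<in> span_mod (xs @ [f])"
      unfolding koszul_boundary_def by blast
    have "\<exists>y. y \<in> mspan E \<and> (T \<subseteq> {1..n} \<longrightarrow> w T - ?d u T - f * y \<in> span_mod xs)" for T
    proof (cases "T \<subseteq> {1..n}")
      case True
      then obtain q y where "q \<in> span_mod xs" "y \<in> mspan E" "w T - ?d u T = q + f * y"
        using u unfolding span_mod_snoc by blast
      then show ?thesis by (intro exI[of _ y]) simp
    qed (use mspan_zero in blast)
    then obtain y where yE: "\<And>T. y T \<in> mspan E"
      and y: "\<And>T. T \<subseteq> {1..n} \<Longrightarrow> w T - ?d u T - f * y T \<in> span_mod xs" by metis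
    have "z T - ?d y T \<in> span_mod xs" if T: "T \<subseteq> {1..n}" for T
    proof (rule regular)
      show "z T - ?d y T \<in> mspan E"
        using zE mspan_koszul_diff[OF upE yE] by (rule mspan_diff)
      have "?d (\<lambda>T. w T - ?d u T - f * y T) T = ?d w T - ?d (?d u) T - f * ?d y T"
        by (simp add: koszul_diff_def right_diff_distrib sum_subtractf sum_distrib_left ac_simps)
      then have "?d w T - f * ?d y T = ?d (\<lambda>T. w T - ?d u T - f * y T) T"
        using koszul_diff_diff[OF fin[OF T], of var n u] by simp
      moreover have "\<dots> \<in> span_mod xs" using y T by (rule span_mod_koszul_diff)
      ultimately have "(f * z T - ?d w T) + (?d w T - f * ?d y T) \<in> span_mod xs"
        using dw[OF T] span_mod_add by simp
      then show "f * (z T - ?d y T) \<in> span_mod xs" by (simp add: right_diff_distrib)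
    qed
    then show False using nb yE unfolding koszul_boundary_def by blast
  qed
  moreover have "koszul_cycle (Suc i) (xs @ [f]) w"
    unfolding koszul_cycle_def using wE w0 dw' by blast
  ultimately show ?thesis unfolding koszul_class_def by blast
qed

theorem regular_sequence_length_le:
  assumes K: "koszul_class i []" and xs: "set xs \<subseteq> var_ideal n n"
    and regular: "regular_sequence (mpoly_ring n) M xs"
  shows "i + length xs \<le> n"
proof -
  have "koszul_class (i + k) (take k xs)" if "k \<le> length xs" for k
    using that
  proof (induction k)
    case (Suc k)
    have "koszul_class (Suc (i + k)) (take k xs @ [xs ! k])"
    proof (rule koszul_class_step)
      show "xs ! k \<in> mspan (prime_expos n n)"
        using xs Suc.prems var_ideal_eq[of n n] by (auto simp: nth_mem subset_iff)
      show "koszul_class (i + k) (take k xs)" using Suc by simp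
      show "p \<in> span_mod (take k xs)" if "p \<in> mspan E" "xs ! k * p \<in> span_mod (take k xs)" for p
        using regular that Suc.prems unfolding regular_sequence_iff by simp
    qed
    then show ?case using Suc.prems by (simp add: take_Suc_conv_app_nth)
  qed (simp add: K)
  from koszul_class_le[OF this[of "length xs"]] show ?thesis by simp
qed

subsection \<open>Regular sequences of variables\<close>

lemma span_mod_vars:
  assumes "set js \<subseteq> {1..n}"
  shows "span_mod (map var js) = mspan (F \<union> {c + single j 1 | c j. c \<in> E \<and> j \<in> set js})"
  using assms
proof (induction js rule: rev_induct)
  case (snoc j js)
  let ?G = "\<lambda>js. F \<union> {c + single j 1 | c j. c \<in> E \<and> j \<in> set js}"
  have IH: "span_mod (map var js) = mspan (?G js)" using snoc by simp
  have shift: "var j * p \<in> mspan (?G (js @ [j]))" if "p \<in> mspan E" for p :: "'k mpoly"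
    unfolding var_def monomial_mult_mspan_iff using that by (rule mspan_mono[rotated]) auto
  have incl: "?G js \<subseteq> ?G (js @ [j])" by auto
  have "span_mod (map var (js @ [j])) = {q + var j * p | q p. q \<in> mspan (?G js) \<and> p \<in> mspan E}"
    using span_mod_snoc[of "map var js" "var j"] IH by simp
  also have "\<dots> = mspan (?G (js @ [j]))"
  proof (intro equalityI subsetI)
    fix v :: "'k mpoly" assume "v \<in> {q + var j * p | q p. q \<in> mspan (?G js) \<and> p \<in> mspan E}"
    then show "v \<in> mspan (?G (js @ [j]))"
      using shift mspan_mono[OF incl] by (auto intro!: mspan_add)
  next
    fix v :: "'k mpoly" assume "v \<in> mspan (?G (js @ [j]))"
    then show "v \<in> {q + var j * p | q p. q \<in> mspan (?G js) \<and> p \<in> mspan E}"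
    proof (induction v rule: mspan_induct)
      case zero
      have "0 = 0 + var j * (0 :: 'k mpoly)" by simp
      then show ?case using mspan_zero by blast
    next
      case (add p q)
      then obtain p1 p2 q1 q2 where *: "p1 \<in> mspan (?G js)" "p2 \<in> mspan E" "p = p1 + var j * p2"
        "q1 \<in> mspan (?G js)" "q2 \<in> mspan E" "q = q1 + var j * q2" by blast
      then have "p + q = (p1 + q1) + var j * (p2 + q2)" by (simp add: algebra_simps)
      then show ?case using mspan_add[OF *(1,4)] mspan_add[OF *(2,5)] by blast
    next
      case (single b c)
      then consider "b \<in> ?G js" | e where "e \<in> E" "b = e + single j 1" by auto
      then show ?case
      proof cases
        case 1
        have "single b c = single b c + var j * 0" by simp
        then show ?thesis using mspan_singleI[OF 1, of c] mspan_zero by blast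
      next
        case 2
        have "single b c = 0 + var j * single e c"
          using 2 by (simp add: var_def monomial_def mult_single add.commute)
        then show ?thesis using mspan_singleI[OF 2(1), of c] mspan_zero by blast
      qed
    qed
  qed
  finally show ?case .
qed (simp add: span_mod_Nil)

text \<open>A sequence of variables generates a monomial submodule, so regularity can be checked on exponents.
  The hypothesis \<open>regular\<close> says that multiplication by a later variable does not create divisibility inside \<open>E\<close> by
  an earlier one.\<close>

lemma regular_sequence_vars:
  assumes js: "set js \<subseteq> {1..n}"
    and regular: "\<And>k b c j. k < length js \<Longrightarrow> b \<in> E \<Longrightarrow> c \<in> E \<Longrightarrow> j \<in> set (take k js) \<Longrightarrow>
      b + single (js ! k) 1 = c + single j 1 \<Longrightarrow> \<exists>c'\<in>E. b = c' + single j 1"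
    and cancel: "\<And>k b. k < length js \<Longrightarrow> b \<in> E \<Longrightarrow> b + single (js ! k) 1 \<in> F \<Longrightarrow> b \<in> F"
    and proper: "b0 \<in> E" "b0 \<notin> F" "\<And>c j. c \<in> E \<Longrightarrow> j \<in> set js \<Longrightarrow> b0 \<noteq> c + single j 1"
  shows "regular_sequence (mpoly_ring n) M (map var js)"
  unfolding regular_sequence_iff
proof (intro conjI allI impI ballI)
  let ?G = "\<lambda>js. F \<union> {c + single j 1 | c j. c \<in> E \<and> j \<in> set js}"
  show "set (map var js) \<subseteq> (mspan (expos n) :: 'k mpoly set)"
    using js var_mspan[of _ n] by (fastforce simp del: atLeastAtMost_iff)
  have "single b0 1 \<notin> span_mod (map var js)"
    unfolding span_mod_vars[OF js] using proper by (auto simp: mspan_single)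
  then show "span_mod (map var js) \<noteq> mspan E" using mspan_singleI[OF proper(1)] by blast
  fix k p assume k: "k < length (map var js)" and p: "p \<in> mspan E"
    and "map var js ! k * p \<in> span_mod (take k (map var js))"
  moreover have tk: "set (take k js) \<subseteq> {1..n}" using js set_take_subset[of k js] by blast
  ultimately have "var (js ! k) * p \<in> mspan (?G (take k js))"
    by (simp add: take_map span_mod_vars)
  then have "p \<in> mspan {b. b + single (js ! k) 1 \<in> ?G (take k js)}"
    unfolding var_def monomial_mult_mspan_iff .
  then have G: "b + single (js ! k) 1 \<in> ?G (take k js)" "b \<in> E" if "b \<in> keys p" for b
    using p that unfolding mspan_def by (blast, blast)
  have "b \<in> ?G (take k js)" if b: "b \<in> keys p" for b
  proof (cases "b + single (js ! k) 1 \<in> F")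
    case True
    then show ?thesis using cancel[of k b] k G(2)[OF b] by simp
  next
    case False
    then obtain c j where c: "c \<in> E" "j \<in> set (take k js)" "b + single (js ! k) 1 = c + single j 1"
      using G(1)[OF b] by blast
    have "\<exists>c'\<in>E. b = c' + single j 1" using k by (intro regular[OF _ G(2)[OF b] c]) simp
    then show ?thesis using c(2) by blast
  qed
  then have "p \<in> mspan (?G (take k js))" unfolding mspan_def by blast
  then show "p \<in> span_mod (take k (map var js))" using span_mod_vars[OF tk] by (simp add: take_map)
qed

end

context monomial_module
begin

lemma depth_eqI:
  assumes K: "koszul_class i []" and js: "set js \<subseteq> {1..n}" "i + length js = n"
    and regular: "regular_sequence (mpoly_ring n) M (map var js)"
  shows "depth n M = length js"
  unfolding depth_def
proof (rule Max_eqI)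
  let ?L = "{length xs | xs. set xs \<subseteq> var_ideal n n \<and> regular_sequence (mpoly_ring n) M xs}"
  show le: "y \<le> length js" if "y \<in> ?L" for y
  proof -
    obtain xs where xs: "y = length xs" "set xs \<subseteq> var_ideal n n" "regular_sequence (mpoly_ring n) M xs"
      using \<open>y \<in> ?L\<close> by blast
    then show ?thesis using regular_sequence_length_le[OF K xs(2,3)] js(2) by simp
  qed
  then have "?L \<subseteq> {..length js}" by blast
  then show "finite ?L" using finite_subset by blast
  have "var j \<in> (mspan (prime_expos n n) :: 'k mpoly set)" if "j \<in> set js" for j
  proof -
    have "j \<in> {1..n}" using js(1) that by blast
    then show ?thesis
      by (auto simp: var_def monomial_def prime_expos_def expos_single intro!: mspan_singleI bexI[of _ j])
  qed
  then have "set (map var js) \<subseteq> (var_ideal n n :: 'k mpoly set)" using var_ideal_eq[of n n] by auto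
  with regular show "length js \<in> ?L" by (intro CollectI exI[of _ "map var js"]) simp
qed

end

text \<open>The Koszul chain \<open>x\<^sup>u e\<^sub>1 \<and> \<dots> \<and> e\<^sub>d\<close>.\<close>

definition top_form :: "nat \<Rightarrow> (nat \<Rightarrow>\<^sub>0 nat) \<Rightarrow> nat set \<Rightarrow> ('k::field) mpoly" where
  "top_form d u T = (if T = {1..d} then monomial u else 0)"

lemma koszul_diff_top_form:
  assumes "\<And>j. j \<in> {1..d} \<Longrightarrow> u + single j 1 \<in> Y"
  shows "koszul_diff var n (top_form d u) T \<in> mspan Y"
  unfolding koszul_diff_def mult.assoc
proof (intro mspan_sum mspan_koszul_sign)
  fix j assume "j \<in> {1..n} - T"
  show "var j * top_form d u (insert j T) \<in> mspan Y"
  proof (cases "insert j T = {1..d}")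
    case True
    then have "j \<in> {1..d}" by blast
    then show ?thesis
      using assms[of j] True by (simp add: top_form_def var_def monomial_def mult_single mspan_singleI add.commute)
  qed (simp add: top_form_def mspan_zero)
qed

text \<open>The coefficient of a boundary at \<open>e\<^sub>1 \<and> \<dots> \<and> e\<^sub>d\<close> lies in the sum of \<open>(x\<^sub>d\<^sub>+\<^sub>1, \<dots>, x\<^sub>n)\<close> and the ideal with
  exponents \<open>F\<close>. Both ideals are monomial and neither contains \<open>x\<^sup>u\<close>, so their sum does not contain it.\<close>

lemma (in monomial_module) koszul_class_quotient:
  assumes E: "E = expos n" and d: "d \<le> n"
    and u: "keys u \<subseteq> {1..d}" "u \<notin> F" "\<And>j. j \<in> {1..d} \<Longrightarrow> u + single j 1 \<in> F"
  shows "koszul_class d []"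
  unfolding koszul_class_def
proof (intro exI conjI)
  have un: "u \<in> E" using u(1) d unfolding E expos_def by auto
  show "koszul_cycle d [] (top_form d u)"
    unfolding koszul_cycle_def span_mod_Nil
  proof (intro conjI allI impI)
    show "top_form d u T \<in> mspan E" for T
      using un by (simp add: top_form_def monomial_def mspan_singleI mspan_zero)
    show "koszul_diff var n (top_form d u) T \<in> mspan F" for T
      using u(3) by (rule koszul_diff_top_form)
  qed (auto simp: top_form_def)
  show "\<not> koszul_boundary [] (top_form d u)"
  proof
    assume "koszul_boundary [] (top_form d u)"
    then obtain w where w: "(\<forall>T. w T \<in> mspan E) \<and>
        (\<forall>T. T \<subseteq> {1..n} \<longrightarrow> (top_form d u T :: 'k mpoly) - koszul_diff var n w T \<in> mspan F)"
      unfolding koszul_boundary_def span_mod_Nil by (rule exE)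
    have "lookup (koszul_diff var n w {1..d}) u = 0"
    proof -
      have "lookup (var j * w (insert j {1..d})) u = 0" if "j \<in> {1..n} - {1..d}" for j
        using that u(1) by (intro lookup_var_mult_0) (auto simp: in_keys_iff)
      then show ?thesis
        unfolding koszul_diff_def mult.assoc lookup_sum lookup_koszul_sign by (intro sum.neutral) simp
    qed
    then have "lookup (top_form d u {1..d} - koszul_diff var n w {1..d}) u = (1 :: 'k)"
      by (simp add: lookup_minus top_form_def monomial_def)
    moreover have "top_form d u {1..d} - koszul_diff var n w {1..d} \<in> mspan F" using w d by simp
    ultimately show False using u(2) by (simp add: mspan_iff_lookup)
  qed
qed

text \<open>The differential of \<open>x\<^sup>u e\<^sub>1 \<and> \<dots> \<and> e\<^sub>d\<close> has coefficients in the ideal although \<open>x\<^sup>u\<close> lies outside. Were it the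
  differential of a chain \<open>w\<close> over the ideal, comparing the coefficients of \<open>x\<^sub>1 x\<^sup>u\<close> at \<open>e\<^sub>2 \<and> \<dots> \<and> e\<^sub>d\<close> would show that
  \<open>x\<^sup>u\<close> occurs in the coefficient of \<open>w\<close> at \<open>e\<^sub>1 \<and> \<dots> \<and> e\<^sub>d\<close>.\<close>

lemma (in monomial_module) koszul_class_ideal:
  assumes F: "F = {}" and d: "1 \<le> d" "d \<le> n"
    and u: "keys u \<subseteq> {1..d}" "u \<notin> E" "\<And>j. j \<in> {1..d} \<Longrightarrow> u + single j 1 \<in> E"
  shows "koszul_class (d - 1) []"
  unfolding koszul_class_def
proof (intro exI conjI)
  let ?z = "koszul_diff var n (top_form d u) :: nat set \<Rightarrow> 'k mpoly"
  show "koszul_cycle (d - 1) [] ?z"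
    unfolding koszul_cycle_def span_mod_Nil
  proof (intro conjI allI impI)
    show "?z T \<in> mspan E" for T using u(3) by (rule koszul_diff_top_form)
    fix T assume T: "T \<subseteq> {1..n}"
    have fin: "finite T" using finite_subset[OF T] by simp
    show "koszul_diff var n ?z T \<in> mspan F"
      using koszul_diff_diff[OF fin] mspan_zero by metis
    assume card: "card T \<noteq> d - 1"
    have "top_form d u (insert j T) = (0 :: 'k mpoly)" if "j \<notin> T" for j
    proof -
      have "card (insert j T) = Suc (card T)" using fin that by simp
      then have "insert j T \<noteq> {1..d}" using card by auto
      then show ?thesis by (simp add: top_form_def)
    qed
    then show "?z T = 0" unfolding koszul_diff_def by (intro sum.neutral) auto
  qed
  show "\<not> koszul_boundary [] ?z"
  proof
    assume "koszul_boundary [] ?z"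
    then obtain w where w: "(\<forall>T. w T \<in> mspan E) \<and>
        (\<forall>T. T \<subseteq> {1..n} \<longrightarrow> ?z T - koszul_diff var n w T \<in> mspan {})"
      unfolding koszul_boundary_def span_mod_Nil unfolding F by (rule exE)
    let ?T = "{2..d}"
    let ?k = "u + single 1 1"
    have ins: "insert 1 ?T = {1..d}" using d by auto
    have coeff: "lookup (koszul_diff var n v ?T) ?k = lookup (v {1..d}) u" for v :: "nat set \<Rightarrow> 'k mpoly"
    proof -
      have "lookup (var j * v (insert j ?T)) ?k = 0" if "j \<in> {1..n} - ?T - {1}" for j
      proof (rule lookup_var_mult_0)
        have "j \<notin> {1..d}" using that by auto
        then have "lookup u j = 0" using u(1) by (auto simp: in_keys_iff)
        then show "lookup ?k j = 0" using that by (simp add: lookup_add lookup_single_if)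
      qed
      then have "(\<Sum>j\<in>{1..n} - ?T - {1}. koszul_sign j ?T * lookup (var j * v (insert j ?T)) ?k) = 0"
        by (intro sum.neutral) simp
      moreover have "(1 :: nat) \<in> {1..n} - ?T" using d by auto
      moreover have "koszul_sign 1 ?T = (1 :: 'k)"
      proof -
        have "{i\<in>?T. i < 1} = {}" by auto
        then show ?thesis unfolding koszul_sign_def by (simp only: card.empty even_zero if_True)
      qed
      ultimately show ?thesis
        unfolding koszul_diff_def mult.assoc lookup_sum lookup_koszul_sign
        using lookup_var_mult[of 1 "v {1..d}" u] ins by (subst sum.remove[of _ 1]) auto
    qed
    have "lookup (?z ?T - koszul_diff var n w ?T) ?k = lookup (top_form d u {1..d} :: 'k mpoly) u - lookup (w {1..d}) u"
      unfolding lookup_minus coeff ..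
    also have "\<dots> = 1" using w u(2) by (simp add: top_form_def monomial_def mspan_iff_lookup)
    finally have "lookup (?z ?T - koszul_diff var n w ?T) ?k \<noteq> 0" by simp
    moreover have "?T \<subseteq> {1..n}" using d by auto
    ultimately show False using w by (auto simp: mspan_iff_lookup)
  qed
qed

section \<open>Monomial ideals and their quotient rings as modules\<close>

lemma monomial_module_ideal:
  assumes "upclosed n E"
  shows "monomial_module n (ideal_module (mpoly_ring n) (mspan E :: ('k::field) mpoly set))
    (\<lambda>a. mspan E \<inter> poly_component n a) E {} (\<lambda>p. p)"
proof (rule monomial_module.intro)
  show "abelian_group (ideal_module (mpoly_ring n) (mspan E :: 'k mpoly set))"
  proof (rule abelian_groupI)
    fix p assume "p \<in> carrier (ideal_module (mpoly_ring n) (mspan E :: 'k mpoly set))"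
    then show "\<exists>q\<in>carrier (ideal_module (mpoly_ring n) (mspan E)).
        q \<oplus>\<^bsub>ideal_module (mpoly_ring n) (mspan E)\<^esub> p = \<zero>\<^bsub>ideal_module (mpoly_ring n) (mspan E)\<^esub>"
      by (intro bexI[of _ "- p"]) (auto simp: ideal_module_def mspan_uminus)
  qed (auto simp: ideal_module_def mspan_add mspan_zero algebra_simps)
  show "p = \<zero>\<^bsub>ideal_module (mpoly_ring n) (mspan E)\<^esub> \<longleftrightarrow> p \<in> mspan {}" for p :: "'k mpoly"
    by (auto simp: ideal_module_def mspan_iff_lookup intro: poly_mapping_eqI)
qed (use assms in \<open>auto simp: ideal_module_def upclosed_trivial\<close>)

lemma monomial_module_quotient:
  assumes up: "upclosed n F"
  shows "monomial_module n (quotient_module (mpoly_ring n) (mspan F :: ('k::field) mpoly set))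
    (\<lambda>a. (\<lambda>p. mspan F +>\<^bsub>mpoly_ring n\<^esub> p) ` poly_component n a) (expos n) F
    (\<lambda>p. mspan F +>\<^bsub>mpoly_ring n\<^esub> p)"
proof -
  let ?S = "mpoly_ring n :: 'k mpoly ring"
  let ?J = "mspan F :: 'k mpoly set"
  interpret R: cring ?S by (rule cring_mpoly_ring)
  interpret J: ideal ?J ?S by (rule ideal_mspan[OF up])
  interpret Q: ring "?S Quot ?J" by (rule J.quotient_is_ring)
  show ?thesis
  proof (rule monomial_module.intro)
    show "abelian_group (quotient_module ?S ?J)"
    proof (rule abelian_groupI)
      fix C assume "C \<in> carrier (quotient_module ?S ?J)"
      then show "\<exists>D\<in>carrier (quotient_module ?S ?J).
          D \<oplus>\<^bsub>quotient_module ?S ?J\<^esub> C = \<zero>\<^bsub>quotient_module ?S ?J\<^esub>"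
        using Q.l_neg[of C] Q.a_inv_closed[of C] by (auto simp: quotient_module_def)
    qed (simp_all add: quotient_module_def Q.a_ac)
    show "carrier (quotient_module ?S ?J) = (\<lambda>p. ?J +>\<^bsub>?S\<^esub> p) ` mspan (expos n)"
      by (auto simp: quotient_module_def FactRing_def A_RCOSETS_def RCOSETS_def a_r_coset_def carrier_mpoly_ring)
    show "?J +>\<^bsub>?S\<^esub> (p + q) = (?J +>\<^bsub>?S\<^esub> p) \<oplus>\<^bsub>quotient_module ?S ?J\<^esub> (?J +>\<^bsub>?S\<^esub> q)"
      if "p \<in> mspan (expos n)" "q \<in> mspan (expos n)" for p q
      using J.a_rcos_sum[of p q] that by (simp add: quotient_module_def FactRing_def carrier_mpoly_ring)
    show "?J +>\<^bsub>?S\<^esub> (r * p) = r \<odot>\<^bsub>quotient_module ?S ?J\<^esub> (?J +>\<^bsub>?S\<^esub> p)"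
      if "r \<in> mspan (expos n)" "p \<in> mspan (expos n)" for r p
      using J.rcoset_mult_add[of r p] that by (simp add: quotient_module_def FactRing_def carrier_mpoly_ring)
    show "?J +>\<^bsub>?S\<^esub> p = \<zero>\<^bsub>quotient_module ?S ?J\<^esub> \<longleftrightarrow> p \<in> mspan F" if "p \<in> mspan (expos n)" for p
      using J.a_rcos_const[of p] J.a_rcos_self[of p] that
      by (auto simp: quotient_module_def FactRing_def carrier_mpoly_ring)
    show "(\<lambda>p. ?J +>\<^bsub>?S\<^esub> p) ` poly_component n a =
        (\<lambda>p. ?J +>\<^bsub>?S\<^esub> p) ` (mspan (expos n) \<inter> poly_component n a)" for a
    proof -
      have "poly_component n a \<subseteq> (mspan (expos n) :: 'k mpoly set)"
        by (auto simp: poly_component_def carrier_mpoly_ring)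
      then show ?thesis by (simp add: Int_absorb1)
    qed
    show "F \<subseteq> expos n" using upclosed_expos[OF up] by blast
  qed (simp_all add: up upclosed_trivial)
qed

text \<open>If \<open>E\<close> belongs to an ideal extended from \<open>K[x\<^sub>1, \<dots>, x\<^sub>d]\<close>, the class of \<open>x\<^sup>u\<close> is a nonzero socle element of the
  quotient of that ring.\<close>

definition socle_exponent :: "nat \<Rightarrow> (nat \<Rightarrow>\<^sub>0 nat) set \<Rightarrow> (nat \<Rightarrow>\<^sub>0 nat) \<Rightarrow> bool" where
  "socle_exponent d E u \<longleftrightarrow> keys u \<subseteq> {1..d} \<and> u \<notin> E \<and> (\<forall>j\<in>{1..d}. u + single j 1 \<in> E)"

lemma colon_socle_exponent:
  assumes E: "upclosed n E" and cyl: "cylinder n d E" and u: "socle_exponent d E u"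
  shows "{b. b + u \<in> E} = prime_expos n d"
proof (intro equalityI subsetI)
  fix b assume b: "b \<in> {b. b + u \<in> E}"
  then have "b + u \<in> expos n" using upclosed_expos[OF E] by simp
  then have bn: "b \<in> expos n" by (simp add: expos_add_iff)
  have "\<exists>j\<in>{1..d}. 0 < lookup b j"
  proof (rule ccontr)
    assume no: "\<not> (\<exists>j\<in>{1..d}. 0 < lookup b j)"
    have "keys b \<subseteq> {d+1..n}"
    proof
      fix j assume "j \<in> keys b"
      then have "j \<in> {1..n}" "j \<notin> {1..d}" using bn no unfolding expos_def in_keys_iff
        by (blast intro: in_keys_iff[THEN iffD2], auto)
      then show "j \<in> {d+1..n}" by auto
    qed
    moreover have "u + b \<in> E" using b by (simp add: add.commute)
    ultimately have "u \<in> E" using cyl unfolding cylinder_def by blast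
    then show False using u by (simp add: socle_exponent_def)
  qed
  then show "b \<in> prime_expos n d" using bn by (simp add: prime_expos_def)
next
  fix b assume b: "b \<in> prime_expos n d"
  then obtain j where j: "j \<in> {1..d}" "0 < lookup b j" by (auto simp: prime_expos_def)
  have uj: "u + single j 1 \<in> E" using u j(1) by (simp add: socle_exponent_def)
  have "b + u \<in> E"
  proof (rule upclosedD_le[OF E uj])
    show "b + u \<in> expos n"
      using b upclosed_expos[OF E uj] by (simp add: expos_add_iff prime_expos_def)
    show "lookup (u + single j 1) k \<le> lookup (b + u) k" for k
      using j(2) by (cases "j = k") (simp_all add: lookup_add lookup_single_if)
  qed
  then show "b \<in> {b. b + u \<in> E}" by simp
qed

lemma depth_quotient_eq:
  assumes F: "upclosed n F" and cyl: "cylinder n d F" and d: "d \<le> n" and u: "socle_exponent d F u"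
  shows "depth n (quotient_module (mpoly_ring n) (mspan F :: ('k::field) mpoly set)) = n - d"
proof -
  interpret monomial_module n "quotient_module (mpoly_ring n) (mspan F :: 'k mpoly set)"
    "\<lambda>a. (\<lambda>p. mspan F +>\<^bsub>mpoly_ring n\<^esub> p) ` poly_component n a" "expos n" F
    "\<lambda>p. mspan F +>\<^bsub>mpoly_ring n\<^esub> p"
    by (rule monomial_module_quotient[OF F])
  define js where "js = [d+1..<Suc n]"
  have set_js: "set js = {d+1..n}" by (auto simp: js_def)
  have js: "set js \<subseteq> {1..n}" "d + length js = n" using d by (auto simp: js_def)
  have K: "koszul_class d []"
    using u d by (intro koszul_class_quotient[of d u]) (auto simp: socle_exponent_def)
  have "regular_sequence (mpoly_ring n) (quotient_module (mpoly_ring n) (mspan F :: 'k mpoly set)) (map var js)"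
  proof (rule regular_sequence_vars[OF js(1)])
    fix k b c j
    assume k: "k < length js" and b: "b \<in> expos n" and j: "j \<in> set (take k js)"
      and eq: "b + single (js ! k) 1 = c + single j 1"
    have "j \<noteq> js ! k"
    proof -
      obtain i where "i < k" "j = js ! i" using j by (auto simp: in_set_conv_nth)
      then show ?thesis using k by (simp add: js_def del: upt_Suc)
    qed
    then have "0 < lookup b j"
      using arg_cong[OF eq, of "\<lambda>p. lookup p j"] by (simp add: lookup_add lookup_single_if)
    then have "single j 1 + (b - single j 1) = b"
      by (intro pointwise_le_add_diff) (auto simp: lookup_single_if)
    then show "\<exists>c'\<in>expos n. b = c' + single j 1"
      using b by (metis add.commute expos_add_iff)
  next
    fix k b assume k: "k < length js" and "b + single (js ! k) 1 \<in> F"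
    moreover have "js ! k \<in> {d+1..n}" using nth_mem[OF k] set_js by simp
    ultimately show "b \<in> F" using cyl unfolding cylinder_def by force
  next
    show "0 \<in> expos n" by (simp add: expos_def)
    show "0 \<notin> F"
    proof
      assume "0 \<in> F"
      moreover have "u \<in> expos n" using u d by (auto simp: socle_exponent_def expos_def)
      ultimately have "0 + u \<in> F" using F unfolding upclosed_def by blast
      then show False using u by (simp add: socle_exponent_def)
    qed
    show "0 \<noteq> c + single j 1" for c :: "nat \<Rightarrow>\<^sub>0 nat" and j
      by (metis add_is_0 lookup_add lookup_single_eq lookup_zero zero_neq_one)
  qed
  from depth_eqI[OF K js this] show ?thesis using js(2) by simp
qed

lemma depth_ideal_eq:
  assumes E: "upclosed n E" and cyl: "cylinder n d E" and d: "1 \<le> d" "d \<le> n" and u: "socle_exponent d E u"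
  shows "depth n (ideal_module (mpoly_ring n) (mspan E :: ('k::field) mpoly set)) = n - d + 1"
proof -
  interpret monomial_module n "ideal_module (mpoly_ring n) (mspan E :: 'k mpoly set)"
    "\<lambda>a. mspan E \<inter> poly_component n a" E "{}" "\<lambda>p. p"
    by (rule monomial_module_ideal[OF E])
  define js where "js = [d+1..<Suc n] @ [1]"
  have set_js: "set js = insert 1 {d+1..n}" by (auto simp: js_def)
  have js: "set js \<subseteq> {1..n}" "d - 1 + length js = n" using d by (auto simp: js_def)
  have K: "koszul_class (d - 1) []"
    using u d by (intro koszul_class_ideal[of d u]) (auto simp: socle_exponent_def)
  have "regular_sequence (mpoly_ring n) (ideal_module (mpoly_ring n) (mspan E :: 'k mpoly set)) (map var js)"
  proof -
    let ?deg = "\<lambda>b. \<Sum>j\<in>{1..n}. lookup b j"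
    have "u + single 1 1 \<in> E" using u d by (auto simp: socle_exponent_def)
    \<comment> \<open>An exponent of least degree is no multiple of a variable within the ideal, so the sequence does not generate everything.\<close>
    then obtain b0 where b0: "b0 \<in> E" "\<And>b. b \<in> E \<Longrightarrow> ?deg b0 \<le> ?deg b"
      using ex_has_least_nat[of "\<lambda>b. b \<in> E" _ ?deg] by blast
    show ?thesis
    proof (rule regular_sequence_vars[OF js(1), where ?b0.0 = b0])
      fix k b c j
      assume k: "k < length js" and b: "b \<in> E" and j: "j \<in> set (take k js)"
        and eq: "b + single (js ! k) 1 = c + single j 1"
      have "j \<noteq> js ! k"
      proof -
        have "distinct js" using d by (auto simp: js_def)
        moreover obtain i where "i < k" "j = js ! i" using j by (auto simp: in_set_conv_nth)
        ultimately show ?thesis using k by (simp add: nth_eq_iff_index_eq)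
      qed
      then have "0 < lookup b j"
        using arg_cong[OF eq, of "\<lambda>p. lookup p j"] by (simp add: lookup_add lookup_single_if)
      then have "single j 1 + (b - single j 1) = b"
        by (intro pointwise_le_add_diff) (auto simp: lookup_single_if)
      then have b': "(b - single j 1) + single j 1 = b" by (simp add: add.commute)
      have "take k js = take k [d+1..<Suc n]" using k by (simp add: js_def)
      then have "j \<in> {d+1..n}" using j set_take_subset[of k "[d+1..<Suc n]"] by auto
      then have "keys (single j (1 :: nat)) \<subseteq> {d+1..n}" by simp
      moreover have "(b - single j 1) + single j 1 \<in> E" unfolding b' by (rule b)
      ultimately have "b - single j 1 \<in> E" using cyl unfolding cylinder_def by blast
      then show "\<exists>c'\<in>E. b = c' + single j 1" using b' by metis
    next
      show "b0 \<in> E" by (rule b0(1))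
      fix c j assume c: "c \<in> E" "j \<in> set js"
      show "b0 \<noteq> c + single j 1"
      proof
        assume "b0 = c + single j 1"
        moreover have "?deg (c + single j 1) = ?deg c + 1"
          using js(1) c(2) by (auto simp: lookup_add lookup_single_if sum.distrib)
        ultimately show False using b0(2)[OF c(1)] by simp
      qed
    qed auto
  qed
  from depth_eqI[OF K js this] show ?thesis using js(2) d by simp
qed

lemma le_sdepth_ideal_iff:
  assumes "upclosed n E" "E \<noteq> {}" "partitionable n E t"
  shows "s \<le> sdepth_ideal n (mspan E :: ('k::field) mpoly set) \<longleftrightarrow> partitionable n E s"
  unfolding sdepth_ideal_def
  using monomial_module.le_sdepth_iff[OF monomial_module_ideal[OF assms(1)], where s = s and t = t] assms
  by simp

lemma le_sdepth_quotient_iff: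
  assumes "upclosed n F" "expos n - F \<noteq> {}" "partitionable n (expos n - F) t"
  shows "s \<le> sdepth_quotient n (mspan F :: ('k::field) mpoly set) \<longleftrightarrow> partitionable n (expos n - F) s"
  unfolding sdepth_quotient_def
  by (rule monomial_module.le_sdepth_iff[OF monomial_module_quotient[OF assms(1)] assms(2,3)])

section \<open>The intersections of primary components\<close>

lemma var_power: "(var j :: ('k::field) mpoly) ^ N = monomial (single j N)"
  by (induction N) (simp_all add: var_def monomial_def mult_single single_add[symmetric])

lemma monomial_add: "monomial (a + b) = (monomial a * monomial b :: ('k::field) mpoly)"
  by (simp add: monomial_def mult_single)

lemma monomial_mem_mspan: "(monomial b :: ('k::field) mpoly) \<in> mspan Y \<longleftrightarrow> b \<in> Y"
  by (simp add: monomial_def mspan_single)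

text \<open>The situation of the theorem with \<open>I = mspan E0\<close>; \<open>d i\<close> is the number of variables that generate \<open>P\<^sub>i\<close>.\<close>

locale chain_decomposition =
  fixes n m :: nat and Q :: "nat \<Rightarrow> ('k::field) mpoly set" and d :: "nat \<Rightarrow> nat" and E0 :: "(nat \<Rightarrow>\<^sub>0 nat) set"
  assumes upE0: "upclosed n E0"
    and d_le: "d 0 \<le> n" and d_dec: "\<And>i. i < m \<Longrightarrow> d (Suc i) < d i" and d_pos: "1 \<le> d m"
    and decomposition: "reduced_primary_decomposition (mpoly_ring n) (mspan E0) {0..m} Q"
    and radical: "\<And>i. i \<le> m \<Longrightarrow> radical_ideal (mpoly_ring n) (Q i) = var_ideal n (d i)"
begin

lemma d_antimono: "i \<le> j \<Longrightarrow> j \<le> m \<Longrightarrow> d j \<le> d i"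
proof (induction j)
  case (Suc j)
  then show ?case using d_dec[of j] by (cases "i = Suc j") auto
qed simp

lemma d_strict: "i < j \<Longrightarrow> j \<le> m \<Longrightarrow> d j < d i"
  using d_antimono[of "Suc i" j] d_dec[of i] by simp

lemma d_bounds: "i \<le> m \<Longrightarrow> 1 \<le> d i" "i \<le> m \<Longrightarrow> d i \<le> n"
  using d_antimono[of i m] d_antimono[of 0 i] d_le d_pos by auto

lemma primary: "i \<le> m \<Longrightarrow> primary_ideal (mpoly_ring n) (Q i)"
  using decomposition by (simp add: reduced_primary_decomposition_def)

lemma Q_ideal: "i \<le> m \<Longrightarrow> ideal (Q i) (mpoly_ring n)"
  using primary by (simp add: primary_ideal_def)

lemma Q_subset: "i \<le> m \<Longrightarrow> Q i \<subseteq> mspan (expos n)"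
  using ideal.Icarr[OF Q_ideal] by (auto simp: carrier_mpoly_ring)

lemma Q_mult: "i \<le> m \<Longrightarrow> p \<in> mspan (expos n) \<Longrightarrow> q \<in> Q i \<Longrightarrow> p * q \<in> Q i"
  using ideal.I_l_closed[OF Q_ideal, of i q p] by (simp add: carrier_mpoly_ring)

lemma one_notin_Q: "i \<le> m \<Longrightarrow> 1 \<notin> Q i"
  using ideal.one_imp_carrier[OF Q_ideal, of i] primary[of i] by (auto simp: primary_ideal_def)

text \<open>A monomial in variables outside \<open>P\<^sub>i\<close> is a nonzerodivisor modulo \<open>Q\<^sub>i\<close>.\<close>

lemma Q_primary:
  assumes "i \<le> m" "p \<in> mspan (expos n)" "e \<in> expos n" "p * monomial e \<in> Q i" "\<And>j. j \<in> {1..d i} \<Longrightarrow> lookup e j = 0"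
  shows "p \<in> Q i"
proof -
  have e: "monomial e \<in> (mspan (expos n) :: 'k mpoly set)" using assms(3) by (simp add: monomial_mem_mspan)
  have "p \<in> Q i \<or> monomial e \<in> radical_ideal (mpoly_ring n) (Q i)"
    using primary[OF assms(1)] assms(2,4) e unfolding primary_ideal_def carrier_mpoly_ring by simp
  moreover have "e \<notin> prime_expos n (d i)" using assms(5) by (auto simp: prime_expos_def)
  ultimately show ?thesis
    using radical[OF assms(1)] var_ideal_eq[OF d_bounds(2)[OF assms(1)]] monomial_mem_mspan by metis
qed

lemma var_power_in_Q:
  assumes "i \<le> m" "j \<in> {1..d i}"
  shows "\<exists>N. monomial (single j N) \<in> Q i"
proof -
  have "single j 1 \<in> prime_expos n (d i)"
    using assms d_bounds(2)[OF assms(1)] by (auto simp: prime_expos_def expos_single intro!: bexI[of _ j])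
  then have "(var j :: 'k mpoly) \<in> radical_ideal (mpoly_ring n) (Q i)"
    using radical[OF assms(1)] var_ideal_eq[OF d_bounds(2)[OF assms(1)]]
    unfolding var_def using monomial_mem_mspan by metis
  then show ?thesis by (auto simp: radical_ideal_def nat_pow_mpoly_ring var_power)
qed

definition I_from :: "nat \<Rightarrow> 'k mpoly set" where
  "I_from k = (\<Inter>j\<in>{k..m}. Q j)"

lemma I_from_Suc: "k < m \<Longrightarrow> I_from k = Q k \<inter> I_from (Suc k)"
proof -
  assume "k < m"
  then have "{k..m} = insert k {Suc k..m}" by auto
  then show ?thesis by (simp add: I_from_def)
qed

lemma I_from_0: "I_from 0 = mspan E0"
proof -
  have "(\<Inter>j\<in>{0..m}. Q j) \<subseteq> mspan (expos n)" using Q_subset[of 0] by auto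
  then show ?thesis
    using decomposition by (auto simp: reduced_primary_decomposition_def I_from_def carrier_mpoly_ring)
qed

text \<open>The colon by a high power of \<open>x\<^sub>d\<close> with \<open>d = d k\<close> absorbs \<open>Q\<^sub>k\<close>, which contains that power, and leaves the later
  components unchanged, as \<open>x\<^sub>d\<close> is not in their radicals.\<close>

lemma I_from_colon:
  assumes k: "k < m"
  shows "\<exists>e. I_from (Suc k) = {f \<in> mspan (expos n). f * monomial e \<in> I_from k}"
proof -
  have dk: "d k \<in> {1..d k}" "d k \<in> {1..n}" using d_bounds[of k] k by auto
  obtain N where N: "monomial (single (d k) N) \<in> Q k" using var_power_in_Q[OF _ dk(1)] k by auto
  let ?e = "single (d k) N"
  have e: "?e \<in> expos n" using dk by (simp add: expos_single)
  have em: "monomial ?e \<in> (mspan (expos n) :: 'k mpoly set)" using e by (simp add: monomial_mem_mspan)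
  have "I_from (Suc k) = {f \<in> mspan (expos n). f * monomial ?e \<in> I_from k}"
  proof (intro equalityI subsetI)
    fix f assume f: "f \<in> I_from (Suc k)"
    then have fS: "f \<in> mspan (expos n)" using Q_subset[of m] k by (auto simp: I_from_def)
    have "f * monomial ?e \<in> Q k" using Q_mult[OF _ fS N] k by simp
    moreover have "f * monomial ?e \<in> Q j" if "j \<in> {Suc k..m}" for j
    proof -
      have "f \<in> Q j" using f that by (auto simp: I_from_def)
      then show ?thesis using Q_mult[OF _ em, of j f] that by (simp add: mult.commute)
    qed
    ultimately show "f \<in> {f \<in> mspan (expos n). f * monomial ?e \<in> I_from k}"
      using fS I_from_Suc[OF k] by (simp add: I_from_def)
  next
    fix f assume f: "f \<in> {f \<in> mspan (expos n). f * monomial ?e \<in> I_from k}"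
    have "f \<in> Q j" if j: "j \<in> {Suc k..m}" for j
    proof (rule Q_primary)
      show "f * monomial ?e \<in> Q j" using f j by (auto simp: I_from_def)
      show "lookup ?e i = 0" if "i \<in> {1..d j}" for i
        using that d_strict[of k j] j by (simp add: lookup_single_if)
    qed (use f j e in auto)
    then show "f \<in> I_from (Suc k)" by (simp add: I_from_def)
  qed
  then show ?thesis by blast
qed

definition E_from :: "nat \<Rightarrow> (nat \<Rightarrow>\<^sub>0 nat) set" where
  "E_from k = {b. (monomial b :: 'k mpoly) \<in> I_from k}"

lemma E_from_eqI: "I_from k = mspan Y \<Longrightarrow> E_from k = Y"
  by (simp add: E_from_def monomial_mem_mspan)

lemma colon_mspan:
  assumes "upclosed n Y"
  shows "{f \<in> mspan (expos n). f * monomial e \<in> (mspan Y :: 'k mpoly set)} = mspan {b. b + e \<in> Y}"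
proof -
  have "b \<in> expos n" if "b + e \<in> Y" for b
    using upclosed_expos[OF assms that] by (simp add: expos_add_iff)
  then have "f \<in> mspan (expos n)" if "f \<in> mspan {b. b + e \<in> Y}" for f :: "'k mpoly"
    using that by (auto simp: mspan_def)
  then show ?thesis
    using monomial_mult_mspan_iff[of e _ Y] by (auto simp: mult.commute)
qed

lemma upclosed_colon: "upclosed n Y \<Longrightarrow> upclosed n {b. b + e \<in> Y}"
  unfolding upclosed_def
  by (auto simp: expos_add_iff add.assoc add.commute[of _ e] subset_iff)

lemma I_from_mspan: "k \<le> m \<Longrightarrow> I_from k = mspan (E_from k) \<and> upclosed n (E_from k)"
proof (induction k)
  case 0
  then show ?case using I_from_0 upE0 E_from_eqI[OF I_from_0] by simp
next
  case (Suc k)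
  then have k: "k < m" and IH: "I_from k = mspan (E_from k)" "upclosed n (E_from k)" by auto
  obtain e where "I_from (Suc k) = {f \<in> mspan (expos n). f * monomial e \<in> I_from k}"
    using I_from_colon[OF k] by blast
  then have eq: "I_from (Suc k) = mspan {b. b + e \<in> E_from k}"
    unfolding IH(1) colon_mspan[OF IH(2)] .
  then show ?case using E_from_eqI[OF eq] upclosed_colon[OF IH(2)] by simp
qed

lemma E_from_Suc_colon:
  assumes k: "k < m"
  shows "\<exists>e. E_from (Suc k) = {b. b + e \<in> E_from k}"
proof -
  have IH: "I_from k = mspan (E_from k)" "upclosed n (E_from k)" using I_from_mspan[of k] k by auto
  obtain e where "I_from (Suc k) = {f \<in> mspan (expos n). f * monomial e \<in> I_from k}"
    using I_from_colon[OF k] by blast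
  then have "I_from (Suc k) = mspan {b. b + e \<in> E_from k}"
    unfolding IH(1) colon_mspan[OF IH(2)] .
  then show ?thesis using E_from_eqI by blast
qed

lemma cylinder_E_from:
  assumes k: "k \<le> m"
  shows "cylinder n (d k) (E_from k)"
  unfolding cylinder_def
proof (intro allI impI)
  fix b e :: "nat \<Rightarrow>\<^sub>0 nat" assume e: "keys e \<subseteq> {d k + 1..n}" and be: "b + e \<in> E_from k"
  have "b + e \<in> expos n" using be I_from_mspan[OF k] upclosed_expos by blast
  then have bn: "b \<in> expos n" "e \<in> expos n" by (auto simp: expos_add_iff)
  have "monomial b \<in> Q j" if j: "j \<in> {k..m}" for j
  proof (rule Q_primary)
    show "monomial b * monomial e \<in> Q j"
      using be j by (simp add: E_from_def I_from_def monomial_add)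
    show "lookup e i = 0" if i: "i \<in> {1..d j}" for i
    proof -
      have "i \<notin> {d k + 1..n}" using i d_antimono[of k j] j by auto
      then show ?thesis using e by (auto simp: in_keys_iff)
    qed
  qed (use j bn in \<open>auto simp: monomial_mem_mspan\<close>)
  then show "b \<in> E_from k" by (simp add: E_from_def I_from_def)
qed

text \<open>If every monomial of \<open>I\<^sub>k\<^sub>+\<^sub>1\<close> belonged to \<open>Q\<^sub>k\<close>, then so would every element, since \<open>I\<^sub>k\<^sub>+\<^sub>1\<close> is spanned by
  monomials, and \<open>Q\<^sub>k\<close> could be omitted from the decomposition. For \<open>k = m\<close> the monomial \<open>1\<close> does it.\<close>

lemma component_needed:
  assumes k: "k \<le> m"
  shows "\<exists>w\<in>expos n. (monomial w :: 'k mpoly) \<notin> Q k \<and> (\<forall>j\<in>{Suc k..m}. monomial w \<in> Q j)"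
proof (cases "k = m")
  case True
  have "(monomial 0 :: 'k mpoly) = 1" by (simp add: monomial_def)
  then show ?thesis
    using one_notin_Q[OF k] True by (intro bexI[of _ 0]) (auto simp: expos_def)
next
  case False
  then have km: "k < m" using k by simp
  show ?thesis
  proof (rule ccontr)
    assume no: "\<not> ?thesis"
    have sub: "E_from (Suc k) \<subseteq> E_from k"
    proof
      fix b assume b: "b \<in> E_from (Suc k)"
      then have "\<forall>j\<in>{Suc k..m}. (monomial b :: 'k mpoly) \<in> Q j" by (simp add: E_from_def I_from_def)
      moreover have "b \<in> expos n" using b I_from_mspan[of "Suc k"] km upclosed_expos by auto
      ultimately have "(monomial b :: 'k mpoly) \<in> Q k" using no by blast
      then show "b \<in> E_from k" using b I_from_Suc[OF km] by (simp add: E_from_def)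
    qed
    have "I_from (Suc k) \<subseteq> I_from k"
      using mspan_mono[OF sub] I_from_mspan[of k] I_from_mspan[of "Suc k"] km by auto
    then have Qk: "I_from (Suc k) \<subseteq> Q k" using I_from_Suc[OF km] by blast
    have "carrier (mpoly_ring n) \<inter> (\<Inter>j\<in>{0..m} - {k}. Q j) \<subseteq> carrier (mpoly_ring n) \<inter> (\<Inter>j\<in>{0..m}. Q j)"
    proof
      fix f assume f: "f \<in> carrier (mpoly_ring n) \<inter> (\<Inter>j\<in>{0..m} - {k}. Q j)"
      then have "f \<in> I_from (Suc k)" by (auto simp: I_from_def)
      then have "f \<in> Q k" using Qk by blast
      then show "f \<in> carrier (mpoly_ring n) \<inter> (\<Inter>j\<in>{0..m}. Q j)" using f by auto
    qed
    then have "mspan E0 = carrier (mpoly_ring n) \<inter> (\<Inter>j\<in>{0..m} - {k}. Q j)"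
      using decomposition unfolding reduced_primary_decomposition_def by auto
    moreover have "mspan E0 \<noteq> carrier (mpoly_ring n) \<inter> (\<Inter>j\<in>{0..m} - {k}. Q j)"
      using decomposition k unfolding reduced_primary_decomposition_def by auto
    ultimately show False by blast
  qed
qed

text \<open>Take a monomial of \<open>I\<^sub>k\<^sub>+\<^sub>1\<close> outside \<open>Q\<^sub>k\<close>, where \<open>I\<^sub>m\<^sub>+\<^sub>1 = S\<close>, and multiply it by a monomial in \<open>x\<^sub>1, \<dots>, x\<^sub>d\<close> of largest degree such that
  the product stays outside \<open>Q\<^sub>k\<close>. Powers of these variables lie in \<open>Q\<^sub>k\<close>, so only finitely many multipliers
  compete. The remaining variables are cancelled at the end.\<close>

lemma ex_socle_exponent:
  assumes k: "k \<le> m"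
  shows "\<exists>u. socle_exponent (d k) (E_from k) u"
proof -
  have up: "upclosed n (E_from k)" using I_from_mspan[OF k] by simp
  obtain w where w: "w \<in> expos n" "(monomial w :: 'k mpoly) \<notin> Q k"
      "\<forall>j\<in>{Suc k..m}. (monomial w :: 'k mpoly) \<in> Q j"
    using component_needed[OF k] by blast
  have E_iff: "w + c \<in> E_from k \<longleftrightarrow> (monomial (w + c) :: 'k mpoly) \<in> Q k" if c: "c \<in> expos n" for c
  proof -
    have "(monomial (w + c) :: 'k mpoly) \<in> Q j" if "j \<in> {Suc k..m}" for j
      using Q_mult[of j "monomial c" "monomial w"] that w(3) c
      by (auto simp: monomial_add mult.commute monomial_mem_mspan)
    moreover have "{k..m} = insert k {Suc k..m}" using k by auto
    ultimately show ?thesis by (simp add: E_from_def I_from_def)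
  qed
  have "\<forall>j\<in>{1..d k}. \<exists>N. (monomial (single j N) :: 'k mpoly) \<in> Q k" using var_power_in_Q[OF k] by blast
  then obtain N where N: "\<And>j. j \<in> {1..d k} \<Longrightarrow> (monomial (single j (N j)) :: 'k mpoly) \<in> Q k" by metis
  define A where "A = {c. keys c \<subseteq> {1..d k} \<and> w + c \<notin> E_from k}"
  have An: "c \<in> expos n" if "c \<in> A" for c
    using that d_bounds(2)[OF k] by (auto simp: A_def expos_def)
  have bound: "lookup c j \<le> N j" if c: "c \<in> A" for c j
  proof (cases "j \<in> {1..d k}")
    case True
    show ?thesis
    proof (rule ccontr)
      assume "\<not> lookup c j \<le> N j"
      then have "single j (N j) + (c - single j (N j)) = c"
        by (intro pointwise_le_add_diff) (auto simp: lookup_single_if)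
      then have "w + c = (w + (c - single j (N j))) + single j (N j)" by (simp add: ac_simps)
      moreover have "w + (c - single j (N j)) \<in> expos n"
      proof -
        have "c - single j (N j) \<in> expos n"
          using An[OF c] keys_diff_nat[of c "single j (N j)"] unfolding expos_def by blast
        then show ?thesis using w(1) by (simp add: expos_add_iff)
      qed
      ultimately have "(monomial (w + c) :: 'k mpoly) \<in> Q k"
        using Q_mult[OF k _ N[OF True]] by (simp add: monomial_add[of _ "single j (N j)"] monomial_mem_mspan)
      then show False using E_iff[OF An[OF c]] c by (simp add: A_def)
    qed
  next
    case False
    then have "lookup c j = 0" using c unfolding A_def in_keys_iff[symmetric] by (auto simp: in_keys_iff)
    then show ?thesis by simp
  qed
  have "A \<subseteq> {c\<in>expos n. \<forall>j. lookup c j \<le> N j}" using An bound by blast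
  then have fin: "finite A" using finite_expos_below finite_subset by blast
  have "0 \<in> A" using w(2) E_iff[of 0] by (simp add: A_def expos_def)
  let ?deg = "\<lambda>c. \<Sum>j\<in>{1..n}. lookup c j"
  have "finite (?deg ` A)" "?deg ` A \<noteq> {}" using fin \<open>0 \<in> A\<close> by auto
  then obtain c where c: "c \<in> A" "\<And>c'. c' \<in> A \<Longrightarrow> ?deg c' \<le> ?deg c"
    using Max_in[of "?deg ` A"] Max_ge[of "?deg ` A"] by (metis (no_types, lifting) image_iff)
  define u0 where "u0 = w + c"
  have u0: "u0 \<notin> E_from k" "u0 \<in> expos n" using c(1) An w(1) by (auto simp: A_def u0_def expos_add_iff)
  have soc: "u0 + single j 1 \<in> E_from k" if j: "j \<in> {1..d k}" for j
  proof (rule ccontr)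
    assume "u0 + single j 1 \<notin> E_from k"
    then have "c + single j 1 \<in> A" using c(1) j by (auto simp: A_def u0_def keys_add_nat add.assoc)
    then have "?deg (c + single j 1) \<le> ?deg c" by (rule c(2))
    moreover have "?deg (c + single j 1) = ?deg c + 1"
      using j d_bounds(2)[OF k] by (auto simp: lookup_add lookup_single_if sum.distrib)
    ultimately show False by simp
  qed
  define u where "u = truncate (\<lambda>j. if j \<le> d k then lookup u0 j else 0) u0"
  have lu: "lookup u j = (if j \<le> d k then lookup u0 j else 0)" for j
    by (simp add: u_def lookup_truncate)
  have split: "u + (u0 - u) = u0" by (rule pointwise_le_add_diff) (simp add: lu)
  have hi: "keys (u0 - u) \<subseteq> {d k + 1..n}"
  proof
    fix j assume "j \<in> keys (u0 - u)"
    then have "lookup u0 j \<noteq> 0" "\<not> j \<le> d k" by (auto simp: in_keys_iff lookup_minus lu split: if_splits)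
    then show "j \<in> {d k + 1..n}" using lookup_outside[OF u0(2), of j] by (cases "j \<in> {1..n}") auto
  qed
  have lo: "keys u \<subseteq> {1..d k}"
  proof
    fix j assume "j \<in> keys u"
    then have "lookup u0 j \<noteq> 0" "j \<le> d k" by (auto simp: in_keys_iff lu split: if_splits)
    then show "j \<in> {1..d k}" using lookup_outside[OF u0(2), of j] by (cases "j \<in> {1..n}") auto
  qed
  have "u \<notin> E_from k"
  proof
    assume "u \<in> E_from k"
    then have "u0 \<in> E_from k" using upclosedD_le[OF up _ u0(2), of u] by (simp add: lu)
    then show False using u0(1) by simp
  qed
  moreover have "u + single j 1 \<in> E_from k" if "j \<in> {1..d k}" for j
  proof -
    have "(u + single j 1) + (u0 - u) = u0 + single j 1"
      using split by (metis add.assoc add.commute)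
    then have "(u + single j 1) + (u0 - u) \<in> E_from k" using soc[OF that] by simp
    then show ?thesis using cylinder_E_from[OF k] hi unfolding cylinder_def by blast
  qed
  ultimately show ?thesis using lo by (auto simp: socle_exponent_def)
qed

end

section \<open>Depth and Stanley depth of the intersections\<close>

theorem proposition1p2:
  fixes n m :: nat
    and I :: "('k::field) mpoly set"
    and P Q :: "nat \<Rightarrow> 'k mpoly set"
    and d :: "nat \<Rightarrow> nat"
  defines "S \<equiv> mpoly_ring n :: 'k mpoly ring"
    and "J \<equiv> \<lambda>k. \<Inter>j\<in>{k..m}. Q j"
  assumes "monomial_ideal n I"
    and "borel_type n I"
    and "\<And>i. i \<le> m \<Longrightarrow> P i = var_ideal n (d i)"
    and "d 0 \<le> n"
    and "\<And>i. i < m \<Longrightarrow> d (Suc i) < d i"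
    and "1 \<le> d m"
    and "associated_primes S (quotient_module S I) = P ` {0..m}"
    and "reduced_primary_decomposition S I {0..m} Q"
    and "\<And>i. i \<le> m \<Longrightarrow> P i = radical_ideal S (Q i)"
  shows "(\<forall>i\<le>m. sdepth_quotient n (J i) = depth n (quotient_module S (J i)) \<and>
                depth n (quotient_module S (J i)) = n - d i) \<and>
         (\<forall>i<m. sdepth_ideal n (J i) \<le> sdepth_ideal n (J (Suc i))) \<and>
         (\<forall>i\<le>m. depth n (ideal_module S (J i)) = n - d i + 1 \<and>
                n - d i + 1 \<le> sdepth_ideal n (J i) \<and>
                sdepth_ideal n (J i) \<le> sdepth_ideal n (P i) \<and>
                sdepth_ideal n (P i) = n - d i div 2)"
proof -
  obtain E0 where E0: "upclosed n E0" "I = mspan E0"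
  proof -
    obtain B where B: "\<forall>b\<in>B. keys b \<subseteq> {1..n}" "I = genideal (mpoly_ring n) (monomial ` B)"
      using assms(3) unfolding monomial_ideal_def by blast
    have "keys b \<subseteq> {1..n}" if "b \<in> B" for b using B(1) that by blast
    note gen = genideal_monomials[of B n, OF this]
    show thesis using that[OF gen(1)] gen(2) B(2) by simp
  qed
  interpret chain_decomposition n m Q d E0
  proof (rule chain_decomposition.intro)
    show "reduced_primary_decomposition (mpoly_ring n) (mspan E0) {0..m} Q"
      using assms(10) unfolding S_def E0(2) .
    show "radical_ideal (mpoly_ring n) (Q i) = var_ideal n (d i)" if "i \<le> m" for i
      using assms(5)[OF that] assms(11)[OF that] unfolding S_def by simp
  qed (fact E0(1) assms(6) assms(7) assms(8))+
  have J: "J k = mspan (E_from k)" "upclosed n (E_from k)" if "k \<le> m" for k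
    using I_from_mspan[OF that] by (simp_all add: J_def I_from_def)
  have P: "P k = mspan (prime_expos n (d k))" if "k \<le> m" for k
    using assms(5)[OF that] var_ideal_eq[OF d_bounds(2)[OF that]] by simp
  have part: "partitionable n (E_from k) (n - d k + 1)" if "k \<le> m" for k
    using partitionable_upclosed[OF J(2)[OF that] cylinder_E_from[OF that] d_bounds[OF that]] .
  have ne: "E_from k \<noteq> {}" if k: "k \<le> m" for k
  proof -
    obtain u where "socle_exponent (d k) (E_from k) u" using ex_socle_exponent[OF k] by blast
    then have "u + single 1 1 \<in> E_from k" using d_bounds(1)[OF k] by (simp add: socle_exponent_def)
    then show ?thesis by blast
  qed
  have le_iff: "s \<le> sdepth_ideal n (J k) \<longleftrightarrow> partitionable n (E_from k) s" if k: "k \<le> m" for k s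
    unfolding J(1)[OF k] by (rule le_sdepth_ideal_iff[OF J(2)[OF k] ne[OF k] part[OF k]])
  have le_P_iff: "s \<le> sdepth_ideal n (P k) \<longleftrightarrow> partitionable n (prime_expos n (d k)) s" if k: "k \<le> m" for k s
  proof -
    have "single 1 1 \<in> prime_expos n (d k)"
      using d_bounds[OF k] by (auto simp: prime_expos_def expos_single intro!: bexI[of _ 1])
    then have "prime_expos n (d k) \<noteq> {}" by blast
    then show ?thesis
      unfolding P[OF k] by (rule le_sdepth_ideal_iff[OF upclosed_prime _ partitionable_prime[OF d_bounds[OF k]]])
  qed
  show ?thesis
  proof (intro conjI allI impI)
    fix k assume k: "k \<le> m"
    obtain u where u: "socle_exponent (d k) (E_from k) u" using ex_socle_exponent[OF k] by blast
    have un: "u \<in> expos n - E_from k"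
      using u d_bounds(2)[OF k] by (auto simp: socle_exponent_def expos_def)
    note cyl = cylinder_E_from[OF k] and up = J(2)[OF k] and b = d_bounds[OF k]
    have pc: "partitionable n (expos n - E_from k) (n - d k)"
      by (rule partitionable_complement[OF up cyl])
    have sq: "s \<le> sdepth_quotient n (J k) \<longleftrightarrow> partitionable n (expos n - E_from k) s" for s
      unfolding J(1)[OF k] using un pc by (intro le_sdepth_quotient_iff[OF up]) auto
    show dq: "depth n (quotient_module S (J k)) = n - d k"
      unfolding S_def J(1)[OF k] by (rule depth_quotient_eq[OF up cyl b(2) u])
    have "sdepth_quotient n (J k) \<le> n - d k"
      using u unfolding socle_exponent_def
      by (intro partitionable_complement_le[OF iffD1[OF sq order_refl] un]) blast
    moreover have "n - d k \<le> sdepth_quotient n (J k)" using sq pc by blast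
    ultimately show "sdepth_quotient n (J k) = depth n (quotient_module S (J k))" using dq by simp
    show "depth n (ideal_module S (J k)) = n - d k + 1"
      unfolding S_def J(1)[OF k] by (rule depth_ideal_eq[OF up cyl b u])
    show "n - d k + 1 \<le> sdepth_ideal n (J k)" using le_iff[OF k] part[OF k] by blast
    have "partitionable n (E_from k) (sdepth_ideal n (J k))" using le_iff[OF k] by blast
    from partitionable_colon[OF this, of u]
    have "partitionable n (prime_expos n (d k)) (sdepth_ideal n (J k))"
      unfolding colon_socle_exponent[OF up cyl u] .
    then show "sdepth_ideal n (J k) \<le> sdepth_ideal n (P k)" using le_P_iff[OF k] by blast
    show "sdepth_ideal n (P k) = n - d k div 2"
    proof (rule antisym)
      show "sdepth_ideal n (P k) \<le> n - d k div 2"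
        using partitionable_prime_le[OF b] le_P_iff[OF k] by blast
      show "n - d k div 2 \<le> sdepth_ideal n (P k)"
        using partitionable_prime[OF b] le_P_iff[OF k] by blast
    qed
  next
    fix k assume k: "k < m"
    obtain e where e: "E_from (Suc k) = {b. b + e \<in> E_from k}" using E_from_Suc_colon[OF k] by blast
    have "partitionable n (E_from k) (sdepth_ideal n (J k))" using le_iff[of k "sdepth_ideal n (J k)"] k by simp
    from partitionable_colon[OF this, of e]
    have "partitionable n (E_from (Suc k)) (sdepth_ideal n (J k))" unfolding e .
    then show "sdepth_ideal n (J k) \<le> sdepth_ideal n (J (Suc k))" using le_iff[of "Suc k"] k by simp
  qed
qed

end
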